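(* Let $p\in[0,1]$. Then $v_p=1$ if and only if $p\ge p_c$, where $v_p$ is the almost sure constant value of the game on $\mathbb L$ with i.i.d. Bernoulli($p$) edge costs and $p_c$ is the critical parameter of oriented percolation on $\mathbb L$.
   Context: Graph. $\mathbb L=\{(x,y)\in\mathbb Z^2: x+y \text{ is even}\}$, with an edge between two points exactly when they are at Euclidean distance $\sqrt2$. $E$ is the set of (non-oriented) edges. Each edge $e$ carries a cost $c(e)$; the $(c(e))_{e\in E}$ are i.i.d. Bernoulli random variables with parameter $p$; the law is $\mathbb P_p$. An edge is open if its cost is $1$ and closed if its cost is $0$. Oriented percolation. A path is a (finite, semi-infinite or bi-infinite) sequence of vertices of $\mathbb L$ such that consecutive vertices are joined by an edge; it is vertical if the second coordinate is monotone along the path; it is open if all its edges are open; an infinite path is one indexed by all of $\mathbb Z$. The critical parameter $p_c\in(0,1)$ is the unique number such that for $p<p_c$, $\mathbb P_p$-almost surely there is no infinite vertical open path, and for $p>p_c$, $\mathbb P_p$-almost surely there is an infinite vertical open path. Game. For a fixed realization of $(c(e))_{e\in E}$ (known to both players from the start) and $z\in\mathbb L$, the zero-sum game $\Gamma(z)$ is as follows. A token is placed at $z$. At each stage $m\ge1$, Player 1 selects an action in $\{T,B\}$ and announces it; then Player 2 selects an action in $\{L,R\}$. If the token is at $(x,y)$, it moves to $(x+1,y+1)$ if $(T,R)$ is played, to $(x-1,y+1)$ if $(T,L)$, to $(x+1,y-1)$ if $(B,R)$, to $(x-1,y-1)$ if $(B,L)$. Let $e_m$ be the edge crossed at stage $m$.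 The history at stage $m$ is $(e_1,\dots,e_{m-1})$, and $H=\bigcup_{m\ge1}E^{m-1}$. A strategy of Player 1 is a map $\sigma:H\to\{T,B\}$; a strategy of Player 2 is a map $\tau:H\to\{L,R\}^2$, whose first (resp. second) component is the action played when Player 1 plays $T$ (resp. $B$) at that stage. The sets of strategies are $\Sigma$ and $\mathcal T$. Player 1 minimizes and Player 2 maximizes the total cost $\gamma(z,\sigma,\tau)=\limsup_{n\to+\infty}\frac1n\sum_{m=1}^n c(e_m)$. The game has a value $v(z)=\inf_{\sigma\in\Sigma}\sup_{\tau\in\mathcal T}\gamma(z,\sigma,\tau)=\sup_{\tau\in\mathcal T}\inf_{\sigma\in\Sigma}\gamma(z,\sigma,\tau)$. For each $p$ there is a constant $v_p\in[0,1]$ such that $\mathbb P_p$-almost surely $v(z)=v_p$ for all $z\in\mathbb L$; this defines $v_p$. *)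

theory Defs
  imports "HOL-Probability.Probability"
begin

type_synonym vertex = "int \<times> int"
type_synonym edge = "vertex set"

definition vertices :: "vertex set" where
  "vertices = {(x, y). even (x + y)}"

definition plane_point :: "vertex \<Rightarrow> real \<times> real" where
  "plane_point u = (real_of_int (fst u), real_of_int (snd u))"

definition edges :: "edge set" where
  "edges = {{u, v} | u v. u \<in> vertices \<and> v \<in> vertices \<and>
     dist (plane_point u) (plane_point v) = sqrt 2}"

text \<open>A realization is a function \<open>\<omega>\<close> on the edges, \<open>\<omega> e = True\<close> meaning that the cost of
  \<open>e\<close> is 1 (the edge is open) and \<open>\<omega> e = False\<close> that it is 0 (the edge is closed).\<close>

type_synonym config = "edge \<Rightarrow> bool"

definition cost :: "config \<Rightarrow> edge \<Rightarrow> real" where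
  "cost \<omega> e = (if \<omega> e then 1 else 0)"

definition percolation_law :: "real \<Rightarrow> config measure" where
  "percolation_law p = (\<Pi>\<^sub>M e\<in>edges. measure_pmf (bernoulli_pmf p))"


definition infinite_path :: "(int \<Rightarrow> vertex) \<Rightarrow> bool" where
  "infinite_path \<pi> \<longleftrightarrow> (\<forall>i. \<pi> i \<in> vertices \<and> {\<pi> i, \<pi> (i + 1)} \<in> edges)"

definition vertical :: "(int \<Rightarrow> vertex) \<Rightarrow> bool" where
  "vertical \<pi> \<longleftrightarrow> mono (\<lambda>i. snd (\<pi> i)) \<or> antimono (\<lambda>i. snd (\<pi> i))"

definition open_path :: "config \<Rightarrow> (int \<Rightarrow> vertex) \<Rightarrow> bool" where
  "open_path \<omega> \<pi> \<longleftrightarrow> (\<forall>i. cost \<omega> {\<pi> i, \<pi> (i + 1)} = 1)"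

definition percolates :: "config \<Rightarrow> bool" where
  "percolates \<omega> \<longleftrightarrow> (\<exists>\<pi>. infinite_path \<pi> \<and> vertical \<pi> \<and> open_path \<omega> \<pi>)"

text \<open>The property that defines the critical parameter; at most one number has it, see
  \<open>is_critical_parameter_unique\<close> below.\<close>

definition is_critical_parameter :: "real \<Rightarrow> bool" where
  "is_critical_parameter q \<longleftrightarrow> 0 < q \<and> q < 1 \<and>
     (\<forall>p\<in>{0..1}. p < q \<longrightarrow> (AE \<omega> in percolation_law p. \<not> percolates \<omega>)) \<and>
     (\<forall>p\<in>{0..1}. q < p \<longrightarrow> (AE \<omega> in percolation_law p. percolates \<omega>))"


datatype action1 = Top | Bottom
datatype action2 = Left | Right

text \<open>A history is the list of the edges crossed so far, the oldest one first. Strategies are total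
  functions on lists of arbitrary vertex sets; their values outside \<open>lists edges\<close> are never used
  in a play that starts at a vertex.\<close>

type_synonym strategy1 = "edge list \<Rightarrow> action1"
type_synonym strategy2 = "edge list \<Rightarrow> action2 \<times> action2"

definition response :: "action2 \<times> action2 \<Rightarrow> action1 \<Rightarrow> action2" where
  "response r a = (case a of Top \<Rightarrow> fst r | Bottom \<Rightarrow> snd r)"

definition move :: "vertex \<Rightarrow> action1 \<Rightarrow> action2 \<Rightarrow> vertex" where
  "move u a b =
     (fst u + (case b of Right \<Rightarrow> 1 | Left \<Rightarrow> -1), snd u + (case a of Top \<Rightarrow> 1 | Bottom \<Rightarrow> -1))"

text \<open>The position of the token and the history after \<open>n\<close> stages.\<close>

primrec play :: "vertex \<Rightarrow> strategy1 \<Rightarrow> strategy2 \<Rightarrow> nat \<Rightarrow> vertex \<times> edge list" where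
  "play z \<sigma> \<tau> 0 = (z, [])"
| "play z \<sigma> \<tau> (Suc n) =
     (let (u, h) = play z \<sigma> \<tau> n;
          a = \<sigma> h;
          u' = move u a (response (\<tau> h) a)
      in (u', h @ [{u, u'}]))"

definition crossed_edge :: "vertex \<Rightarrow> strategy1 \<Rightarrow> strategy2 \<Rightarrow> nat \<Rightarrow> edge" where
  "crossed_edge z \<sigma> \<tau> m = last (snd (play z \<sigma> \<tau> m))"

definition total_cost :: "config \<Rightarrow> vertex \<Rightarrow> strategy1 \<Rightarrow> strategy2 \<Rightarrow> ereal" where
  "total_cost \<omega> z \<sigma> \<tau> =
     limsup (\<lambda>n. ereal (1 / real n * (\<Sum>m = 1..n. cost \<omega> (crossed_edge z \<sigma> \<tau> m))))"

definition has_value :: "config \<Rightarrow> vertex \<Rightarrow> real \<Rightarrow> bool" where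
  "has_value \<omega> z v \<longleftrightarrow>
     (INF \<sigma>. SUP \<tau>. total_cost \<omega> z \<sigma> \<tau>) = ereal v \<and>
     (SUP \<tau>. INF \<sigma>. total_cost \<omega> z \<sigma> \<tau>) = ereal v"

text \<open>The property that defines the almost sure value of the game for the parameter \<open>p\<close>; at most
  one number has it, see \<open>is_as_value_unique\<close> below.\<close>

definition is_as_value :: "real \<Rightarrow> real \<Rightarrow> bool" where
  "is_as_value p v \<longleftrightarrow> (AE \<omega> in percolation_law p. \<forall>z\<in>vertices. has_value \<omega> z v)"


lemma prob_space_percolation_law: "prob_space (percolation_law p)"
  unfolding percolation_law_def by (intro prob_space_PiM prob_space_measure_pmf)

lemma is_critical_parameter_unique:
  assumes "is_critical_parameter q" "is_critical_parameter q'"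
  shows "q = q'"
proof -
  have False if q: "is_critical_parameter q" and q': "is_critical_parameter q'" and less: "q < q'"
    for q q'
  proof -
    obtain p where p: "q < p" "p < q'" using dense[OF less] by blast
    interpret prob_space "percolation_law p" by (rule prob_space_percolation_law)
    have "p \<in> {0..1}" using p q q' by (auto simp: is_critical_parameter_def)
    then have "AE \<omega> in percolation_law p. percolates \<omega>"
      and "AE \<omega> in percolation_law p. \<not> percolates \<omega>"
      using p q q' by (auto simp: is_critical_parameter_def)
    then have "AE \<omega> in percolation_law p. False" by eventually_elim simp
    then show False by simp
  qed
  from this[of q q'] this[of q' q] assms show ?thesis by (meson linorder_neqE_linordered_idom)
qed

lemma is_as_value_unique:
  assumes "is_as_value p v" "is_as_value p v'"
  shows "v = v'"
proof -
  interpret prob_space "percolation_law p" by (rule prob_space_percolation_law)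
  have "AE \<omega> in percolation_law p. v = v'"
    using assms unfolding is_as_value_def
  proof eventually_elim
    case (elim \<omega>)
    have "(0, 0) \<in> vertices" by (simp add: vertices_def)
    with elim have "has_value \<omega> (0, 0) v" "has_value \<omega> (0, 0) v'" by blast+
    then show ?case by (simp add: has_value_def)
  qed
  then show ?thesis by simp
qed

lemma crossed_edge_in_edges:
  assumes "z \<in> vertices" "m \<ge> 1"
  shows "crossed_edge z \<sigma> \<tau> m \<in> edges"
proof -
  have move: "move u a b \<in> vertices \<and> {u, move u a b} \<in> edges" if "u \<in> vertices" for u a b
  proof -
    have "move u a b \<in> vertices"
      using that by (auto simp: move_def vertices_def split: action1.splits action2.splits)
    moreover have "dist (plane_point u) (plane_point (move u a b)) = sqrt 2"
      by (auto simp: move_def plane_point_def dist_prod_def dist_real_def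
          split: action1.splits action2.splits)
    ultimately show ?thesis using that unfolding edges_def by blast
  qed
  have pos: "fst (play z \<sigma> \<tau> n) \<in> vertices" for n
    by (induction n) (use assms move in \<open>auto simp: Let_def case_prod_beta\<close>)
  obtain n where "m = Suc n" using assms(2) by (cases m) auto
  then show ?thesis using move[OF pos[of n]]
    by (simp add: crossed_edge_def Let_def case_prod_beta)
qed

end

theory Submission
  imports Defs
begin

text \<open>
  Below \<open>p\<^sub>c\<close>, Player 1 always plays \<open>Top\<close>. The token follows an upward path, and since connection
  probabilities decay exponentially (by the argument of Duminil-Copin and Tassion), a union bound over
  coarse-grained paths shows that every upward path crosses closed edges with positive density.

  At or above \<open>p\<^sub>c\<close>, for every \<open>R\<close> the probability to cross a rectangle of width \<open>w\<close> and height
  \<open>2 R w\<close> vertically is bounded below uniformly in \<open>w\<close>: otherwise connection probabilities would decay,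
  and this persists for slightly larger parameters. By pigeonhole on the abscissa at half height, with
  probability bounded below there is an open path reaching \<open>R w\<close> levels above and below the origin
  that passes at distance of order \<open>w\<close> to its right. If \<open>p < 1\<close>, such a path is unlikely to be almost
  diagonal, so Player 2 hits it within a time of order \<open>w\<close> by playing \<open>Right\<close>, and then stays on it up to
  time \<open>R w\<close>. As this occurs for infinitely many \<open>w\<close> with positive probability and the payoff is an upper
  limit, Player 2 guarantees almost \<open>1\<close> with positive probability, which suffices because the value is
  almost surely constant.
\<close>

section \<open>Functions of finitely many independent Bernoulli variables\<close>

text \<open>Nothing is known about infinite open paths at \<open>p\<^sub>c\<close> itself, since
  \<open>is_critical_parameter\<close> only speaks of smaller and larger parameters. Hence the
  finite crossings, on every scale \<open>w\<close>, with a lower bound that depends on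
  \<open>R\<close> alone. The constants are chosen in the order \<open>p\<close>, then
  \<open>\<mu>\<close> and \<open>r\<close>, then \<open>R\<close>, then \<open>w\<close>: a path is
  hit within about \<open>2 * r * w\<close> stages and followed until time \<open>R * w\<close>, so
  the fraction of time lost is at most \<open>(1 + 2 * r) / R\<close>, which vanishes as
  \<open>R\<close> grows. Player 1 cannot avoid the path: each answer \<open>Right\<close> moves the
  token one unit to the right whatever Player 1 plays, and a vertical path is a graph over the
  heights, which Player 1 changes by only one unit per stage. For \<open>p = 1\<close> the path may
  be diagonal and run away from the token, whence the separate treatment of that case. Probabilities
  of finitely determined events are polynomials in \<open>p\<close>. This yields derivatives and
  continuity in \<open>p\<close> without measure theory; the product measure only enters for
  countable unions, limits of events and almost sure statements.\<close>

text \<open>Expectation of \<open>f\<close> applied to the random set that contains each element of \<open>J\<close> independently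
  with probability \<open>p\<close>. The probability \<open>p\<close> is not restricted to the unit interval, so that the
  expectation is a polynomial in \<open>p\<close>.\<close>

definition bexp :: "real \<Rightarrow> 'e set \<Rightarrow> ('e set \<Rightarrow> real) \<Rightarrow> real" where
  "bexp p J f = (\<Sum>A\<in>Pow J. p ^ card A * (1 - p) ^ card (J - A) * f A)"

definition dep :: "'e set \<Rightarrow> ('e set \<Rightarrow> 'b) \<Rightarrow> bool" where
  "dep J f \<longleftrightarrow> (\<forall>A. f A = f (A \<inter> J))"

definition fdep :: "('e set \<Rightarrow> 'b) \<Rightarrow> bool" where
  "fdep f \<longleftrightarrow> (\<exists>J. finite J \<and> dep J f)"

text \<open>The choice of \<open>J\<close> is immaterial (\<open>expct_eq\<close>); the value is junk unless \<open>fdep f\<close>.\<close>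

definition expct :: "real \<Rightarrow> ('e set \<Rightarrow> real) \<Rightarrow> real" where
  "expct p f = bexp p (SOME J. finite J \<and> dep J f) f"

abbreviation pr :: "real \<Rightarrow> ('e set \<Rightarrow> bool) \<Rightarrow> real" where
  "pr p Q \<equiv> expct p (\<lambda>A. of_bool (Q A))"

lemma bexp_empty [simp]: "bexp p {} f = f {}"
  by (simp add: bexp_def)

text \<open>Conditioning on the state of \<open>e\<close>. Most inductions on the index set below
  reduce to this identity.\<close>

lemma bexp_insert:
  assumes "finite J" "e \<notin> J"
  shows "bexp p (insert e J) f = p * bexp p J (\<lambda>A. f (insert e A)) + (1 - p) * bexp p J f"
proof -
  have inj: "inj_on (insert e) (Pow J)"
    using assms by (auto simp: inj_on_def)
  have disj: "Pow J \<inter> insert e ` Pow J = {}" using assms by auto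
  have 1: "card (insert e J - A) = Suc (card (J - A))" if "A \<in> Pow J" for A
  proof -
    have "insert e J - A = insert e (J - A)" using that assms by auto
    then show ?thesis using assms by simp
  qed
  have 2: "card (insert e A) = Suc (card A)" "insert e J - insert e A = J - A" if "A \<in> Pow J" for A
    using that assms finite_subset[of A J] by (auto simp: card_insert_if)
  show ?thesis
    unfolding bexp_def Pow_insert
    using assms
    by (subst sum.union_disjoint)
       (use disj in \<open>auto simp: sum.reindex[OF inj] 1 2 sum_distrib_left mult_ac intro!: sum.cong\<close>)
qed

lemma bexp_mono:
  assumes "0 \<le> p" "p \<le> 1" "\<And>A. A \<subseteq> J \<Longrightarrow> f A \<le> g A"
  shows "bexp p J f \<le> bexp p J g"
  unfolding bexp_def using assms by (intro sum_mono mult_left_mono) auto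

lemma bexp_cong: "(\<And>A. A \<subseteq> J \<Longrightarrow> f A = g A) \<Longrightarrow> bexp p J f = bexp p J g"
  unfolding bexp_def by (rule sum.cong) (simp_all add: Pow_def)

lemma bexp_add: "bexp p J (\<lambda>A. f A + g A) = bexp p J f + bexp p J g"
  unfolding bexp_def by (simp only: distrib_left sum.distrib)

lemma bexp_diff: "bexp p J (\<lambda>A. f A - g A) = bexp p J f - bexp p J g"
  unfolding bexp_def by (simp only: right_diff_distrib sum_subtractf)

lemma bexp_cmult: "bexp p J (\<lambda>A. c * f A) = c * bexp p J f"
  unfolding bexp_def by (simp only: sum_distrib_left mult.left_commute[of c])

lemma bexp_sum: "bexp p J (\<lambda>A. \<Sum>i\<in>I. f i A) = (\<Sum>i\<in>I. bexp p J (f i))"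
  unfolding bexp_def by (simp only: sum_distrib_left) (rule sum.swap)

lemma bexp_const: "finite J \<Longrightarrow> bexp p J (\<lambda>_. c) = c"
  by (induction J rule: finite_induct) (simp_all add: bexp_insert algebra_simps)

lemma bexp_nonneg:
  "0 \<le> p \<Longrightarrow> p \<le> 1 \<Longrightarrow> (\<And>A. A \<subseteq> J \<Longrightarrow> 0 \<le> f A) \<Longrightarrow> 0 \<le> bexp p J f"
  unfolding bexp_def by (rule sum_nonneg) simp

lemma continuous_bexp: "continuous_on UNIV (\<lambda>p. bexp p J f)"
  unfolding bexp_def by (intro continuous_intros)

lemma dep_insert_arg: "dep J f \<Longrightarrow> dep J (\<lambda>A. f (insert e A))"
  unfolding dep_def by (metis Int_insert_left inf.right_idem insert_absorb2 inf_assoc)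

lemma dep_insert_notin: "dep J f \<Longrightarrow> e \<notin> J \<Longrightarrow> f (insert e A) = f A"
  unfolding dep_def by (metis Int_insert_left)

text \<open>Induction on \<open>J\<close>: a new element lies in at most one of the two supports, so
  one of the two factors ignores it and can be pulled out of the conditioning identity.\<close>

lemma bexp_indep:
  assumes "finite J"
  shows "dep J1 f \<Longrightarrow> dep J2 g \<Longrightarrow> J1 \<inter> J2 = {} \<Longrightarrow>
    bexp p J (\<lambda>A. f A * g A) = bexp p J f * bexp p J g"
  using assms
proof (induction J arbitrary: f g rule: finite_induct)
  case (insert e J)
  note IH = insert.IH[OF _ _ insert.prems(3)] and ins = bexp_insert[OF insert.hyps(1,2)]
  have c: "p * a + (1 - p) * a = a" for a :: real by (simp add: algebra_simps)
  show ?case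
  proof (cases "e \<in> J1")
    case True
    then have "e \<notin> J2" using insert.prems by auto
    from dep_insert_notin[OF insert.prems(2) this] have g: "g (insert e A) = g A" for A .
    have "bexp p (insert e J) (\<lambda>A. f A * g A)
        = p * (bexp p J (\<lambda>A. f (insert e A)) * bexp p J g) + (1 - p) * (bexp p J f * bexp p J g)"
      by (simp only: ins g IH[OF dep_insert_arg[OF insert.prems(1)] insert.prems(2)]
        IH[OF insert.prems(1,2)])
    also have "\<dots> = bexp p (insert e J) f * bexp p (insert e J) g"
      by (simp only: ins g c) (simp add: algebra_simps)
    finally show ?thesis .
  next
    case False
    from dep_insert_notin[OF insert.prems(1) this] have f: "f (insert e A) = f A" for A .
    have "bexp p (insert e J) (\<lambda>A. f A * g A)
        = p * (bexp p J f * bexp p J (\<lambda>A. g (insert e A))) + (1 - p) * (bexp p J f * bexp p J g)"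
      by (simp only: ins f IH[OF insert.prems(1) dep_insert_arg[OF insert.prems(2)]]
        IH[OF insert.prems(1,2)])
    also have "\<dots> = bexp p (insert e J) f * bexp p (insert e J) g"
      by (simp only: ins f c) (simp add: algebra_simps)
    finally show ?thesis .
  qed
qed simp

lemma dep_mono: "dep J f \<Longrightarrow> J \<subseteq> J' \<Longrightarrow> dep J' f"
  unfolding dep_def by (metis inf.absorb_iff2 inf_assoc)

lemma dep_Int: "dep J f \<Longrightarrow> dep J' f \<Longrightarrow> dep (J \<inter> J') f"
  unfolding dep_def by (metis inf_assoc)

lemma dep_restrict: "dep J f \<Longrightarrow> dep (J \<inter> K) (\<lambda>A. f (A \<inter> K))"
  unfolding dep_def by (metis inf.idem inf.left_commute inf_commute)

lemma bexp_mono_set: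
  assumes "finite J'" "J \<subseteq> J'" "dep J f"
  shows "bexp p J' f = bexp p J f"
proof -
  have "bexp p (J \<union> K) f = bexp p J f" if "finite K" for K
    using that
  proof (induction K rule: finite_induct)
    case (insert e K)
    show ?case
    proof (cases "e \<in> J")
      case True
      with insert show ?thesis by (simp add: insert_absorb)
    next
      case False
      have "f (insert e A) = f A" for A using dep_insert_notin[OF assms(3) False] .
      then show ?thesis
        using insert False assms finite_subset[of J J'] by (simp add: bexp_insert algebra_simps)
    qed
  qed simp
  from this[of J'] assms show ?thesis by (simp add: Un_absorb1)
qed

text \<open>Two finite supports are compared through their intersection, which is again a support
  (\<open>dep_Int\<close>).\<close>

lemma expct_eq:
  assumes "finite J" "dep J f"
  shows "expct p f = bexp p J f"
proof -
  define K where "K = (SOME J. finite J \<and> dep J f)"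
  have K: "finite K" "dep K f"
    unfolding atomize_conj K_def by (rule someI[of _ J]) (use assms in auto)
  have "bexp p K f = bexp p (K \<inter> J) f" "bexp p J f = bexp p (K \<inter> J) f"
    using assms K by (auto intro!: bexp_mono_set dep_Int)
  then show ?thesis by (simp add: expct_def K_def)
qed

lemma fdep_common:
  assumes "fdep f" "fdep g"
  obtains J where "finite J" "dep J f" "dep J g"
  using assms unfolding fdep_def by (metis dep_mono finite_Un sup_ge1 sup_ge2)

lemma fdep_const [simp]: "fdep (\<lambda>_. c)"
  unfolding fdep_def dep_def by blast

lemma fdep_mem [simp]: "fdep (\<lambda>A. e \<in> A)"
  unfolding fdep_def dep_def by (rule exI[of _ "{e}"]) auto

lemma fdep_comp: "fdep f \<Longrightarrow> fdep (\<lambda>A. h (f A))"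
  unfolding fdep_def dep_def by metis

lemma fdep_comp2:
  assumes "fdep f" "fdep g"
  shows "fdep (\<lambda>A. h (f A) (g A))"
proof -
  from assms obtain J where "finite J" "dep J f" "dep J g" by (rule fdep_common)
  then show ?thesis unfolding fdep_def dep_def by (intro exI[of _ J]) metis
qed

lemmas fdep_logic =
  fdep_comp[of _ Not] fdep_comp2[of _ _ "(\<and>)"] fdep_comp2[of _ _ "(\<or>)"]
  fdep_comp[of _ "of_bool :: bool \<Rightarrow> real"] fdep_comp2[of _ _ "(*)"] fdep_comp2[of _ _ "(+)"]

lemma fdep_sum:
  assumes "finite I" "\<And>i. i \<in> I \<Longrightarrow> fdep (f i)"
  shows "fdep (\<lambda>A. \<Sum>i\<in>I. f i A :: real)"
  using assms by (induction I rule: finite_induct) (auto intro: fdep_logic)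

lemma fdep_Bex:
  assumes "finite I" "\<And>i. i \<in> I \<Longrightarrow> fdep (f i)"
  shows "fdep (\<lambda>A. \<exists>i\<in>I. f i A)"
  using assms by (induction I rule: finite_induct) (auto intro: fdep_logic)

lemma fdep_restrict: "fdep f \<Longrightarrow> fdep (\<lambda>A. f (A \<inter> K))"
  unfolding fdep_def using dep_restrict by blast

lemma dep_const [simp]: "dep J (\<lambda>_. c)"
  unfolding dep_def by blast

lemma dep_mem: "e \<in> J \<Longrightarrow> dep J (\<lambda>A. e \<in> A)"
  unfolding dep_def by auto

lemma dep_comp: "dep J f \<Longrightarrow> dep J (\<lambda>A. h (f A))"
  unfolding dep_def by metis

lemma dep_comp2: "dep J f \<Longrightarrow> dep J g \<Longrightarrow> dep J (\<lambda>A. h (f A) (g A))"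
  unfolding dep_def by metis

lemma dep_sum: "(\<And>i. i \<in> I \<Longrightarrow> dep J (f i)) \<Longrightarrow> dep J (\<lambda>A. \<Sum>i\<in>I. f i A :: real)"
  unfolding dep_def by (intro allI sum.cong refl) blast

lemma dep_Bex: "(\<And>i. i \<in> I \<Longrightarrow> dep J (f i)) \<Longrightarrow> dep J (\<lambda>A. \<exists>i\<in>I. f i A)"
  unfolding dep_def by blast

lemma expct_mono:
  assumes "0 \<le> p" "p \<le> 1" "fdep f" "fdep g" "\<And>A. f A \<le> g A"
  shows "expct p f \<le> expct p g"
proof -
  from assms(3,4) obtain J where "finite J" "dep J f" "dep J g" by (rule fdep_common)
  then show ?thesis using assms by (simp add: expct_eq bexp_mono)
qed

lemma expct_const [simp]: "expct p (\<lambda>_. c) = c"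
  by (simp add: expct_eq[of "{}"])

lemma expct_cmult: "fdep f \<Longrightarrow> expct p (\<lambda>A. c * f A) = c * expct p f"
proof -
  assume "fdep f"
  then obtain J where "finite J" "dep J f" by (auto simp: fdep_def)
  then show ?thesis using dep_comp[of J f "\<lambda>x. c * x"] by (simp add: expct_eq bexp_cmult)
qed

lemma expct_add:
  assumes "fdep f" "fdep g"
  shows "expct p (\<lambda>A. f A + g A) = expct p f + expct p g"
proof -
  from assms obtain J where "finite J" "dep J f" "dep J g" by (rule fdep_common)
  then show ?thesis using dep_comp2[of J f g "(+)"] by (simp add: expct_eq bexp_add)
qed

lemma expct_sum:
  assumes "finite I" "\<And>i. i \<in> I \<Longrightarrow> fdep (f i)"
  shows "expct p (\<lambda>A. \<Sum>i\<in>I. f i A) = (\<Sum>i\<in>I. expct p (f i))"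
  using assms by (induction I rule: finite_induct) (auto simp: expct_add fdep_sum)

lemma expct_nonneg:
  assumes "0 \<le> p" "p \<le> 1" "fdep f" "\<And>A. 0 \<le> f A"
  shows "0 \<le> expct p f"
  using expct_mono[of p "\<lambda>_. 0" f] assms by simp

lemma expct_indep:
  assumes "fdep f" "fdep g" "dep J1 f" "dep J2 g" "J1 \<inter> J2 = {}"
  shows "expct p (\<lambda>A. f A * g A) = expct p f * expct p g"
proof -
  from assms(1,2) obtain J where J: "finite J" "dep J f" "dep J g" by (rule fdep_common)
  then show ?thesis
    using dep_comp2[OF J(2,3), of "(*)"] bexp_indep[OF J(1) assms(3,4,5)] by (simp add: expct_eq)
qed

lemma pr_indep:
  assumes "fdep P" "fdep Q" "dep J1 P" "dep J2 Q" "J1 \<inter> J2 = {}"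
  shows "pr p (\<lambda>A. P A \<and> Q A) = pr p P * pr p Q"
proof -
  have "pr p (\<lambda>A. P A \<and> Q A) = expct p (\<lambda>A. of_bool (P A) * of_bool (Q A))"
    by (simp add: of_bool_conj)
  also have "\<dots> = pr p P * pr p Q"
    using assms by (intro expct_indep[of _ _ J1 J2] fdep_logic dep_comp[of _ _ of_bool])
  finally show ?thesis .
qed

lemma pr_mono:
  assumes "0 \<le> p" "p \<le> 1" "fdep P" "fdep Q" "\<And>A. P A \<Longrightarrow> Q A"
  shows "pr p P \<le> pr p Q"
  using assms by (intro expct_mono fdep_logic) auto

lemma pr_Bex_le:
  assumes "0 \<le> p" "p \<le> 1" "finite I" "\<And>i. i \<in> I \<Longrightarrow> fdep (P i)"
  shows "pr p (\<lambda>A. \<exists>i\<in>I. P i A) \<le> (\<Sum>i\<in>I. pr p (P i))"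
proof -
  have "of_bool (\<exists>i\<in>I. P i A) \<le> (\<Sum>i\<in>I. of_bool (P i A) :: real)" for A
  proof (cases "\<exists>i\<in>I. P i A")
    case True
    then obtain i where "i \<in> I" "P i A" by blast
    then show ?thesis
      using member_le_sum[of i I "\<lambda>i. of_bool (P i A) :: real"] assms(3) by auto
  qed (simp add: sum_nonneg)
  then have "pr p (\<lambda>A. \<exists>i\<in>I. P i A) \<le> expct p (\<lambda>A. \<Sum>i\<in>I. of_bool (P i A))"
    using assms by (intro expct_mono fdep_logic fdep_Bex fdep_sum)
  also have "\<dots> = (\<Sum>i\<in>I. pr p (P i))"
    using assms by (intro expct_sum fdep_logic)
  finally show ?thesis .
qed

lemma pr_disj_le:
  assumes "0 \<le> p" "p \<le> 1" "fdep P" "fdep Q"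
  shows "pr p (\<lambda>A. P A \<or> Q A) \<le> pr p P + pr p Q"
proof -
  have "pr p (\<lambda>A. P A \<or> Q A) \<le> expct p (\<lambda>A. of_bool (P A) + of_bool (Q A))"
    using assms by (intro expct_mono fdep_logic) auto
  also have "\<dots> = pr p P + pr p Q"
    using assms by (intro expct_add fdep_logic)
  finally show ?thesis .
qed

lemma pr_markov:
  assumes "0 \<le> p" "p \<le> 1" "fdep f" "\<And>A. 0 \<le> f A" "0 < c"
  shows "pr p (\<lambda>A. c \<le> f A) \<le> expct p f / c"
proof -
  have "pr p (\<lambda>A. c \<le> f A) \<le> expct p (\<lambda>A. (1 / c) * f A)"
    using assms
    by (intro expct_mono fdep_logic fdep_comp[of f "\<lambda>x. c \<le> x"] fdep_comp[of f "\<lambda>x. 1 / c * x"]) auto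
  also have "\<dots> = expct p f / c" using assms(3) by (simp only: expct_cmult) simp
  finally show ?thesis .
qed

lemma pr_mem: "pr p (\<lambda>A. e \<in> A) = p"
proof -
  have "dep {e} (\<lambda>A. of_bool (e \<in> A) :: real)" by (intro dep_comp[of _ _ of_bool] dep_mem) simp
  from expct_eq[OF _ this] show ?thesis by (simp add: bexp_insert)
qed

section \<open>Invariance under relabelling, and Russo's formula\<close>

lemma bexp_image:
  assumes "finite J" "inj_on h J"
  shows "bexp p (h ` J) f = bexp p J (\<lambda>A. f (h ` A))"
  using assms
proof (induction J arbitrary: f rule: finite_induct)
  case (insert e J)
  then show ?case by (auto simp: bexp_insert)
qed simp

lemma dep_image:
  assumes "bij h" "dep J f"
  shows "dep (h -` J) (\<lambda>A. f (h ` A))"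
  unfolding dep_def
proof
  fix A
  have "h ` (A \<inter> h -` J) = h ` A \<inter> J" by auto
  then show "f (h ` A) = f (h ` (A \<inter> h -` J))"
    using assms(2) unfolding dep_def by (metis)
qed

lemma fdep_image: "bij h \<Longrightarrow> fdep f \<Longrightarrow> fdep (\<lambda>A. f (h ` A))"
  unfolding fdep_def using dep_image[of h] finite_vimageI[of _ h] by (auto simp: bij_def)

text \<open>Used for translations and for the point reflection that exchanges upward and downward
  paths.\<close>

lemma expct_image:
  assumes h: "bij h" and "fdep f"
  shows "expct p (\<lambda>A. f (h ` A)) = expct p f"
proof -
  obtain J where J: "finite J" "dep J f" using assms(2) by (auto simp: fdep_def)
  have fin: "finite (h -` J)" using J h by (simp add: bij_def finite_vimageI)
  have "expct p (\<lambda>A. f (h ` A)) = bexp p (h -` J) (\<lambda>A. f (h ` A))"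
    by (intro expct_eq fin dep_image h J)
  also have "\<dots> = bexp p (h ` (h -` J)) f"
    using h by (intro bexp_image[symmetric] fin) (auto simp: bij_def inj_on_def)
  also have "h ` (h -` J) = J" using h by (simp add: bij_def surj_image_vimage_eq)
  finally show ?thesis using J by (simp add: expct_eq)
qed

text \<open>Monotonicity is not assumed, so the influence of \<open>e\<close> is a signed
  difference. Differentiating the conditioning identity \<open>bexp_insert\<close> by the product
  rule produces the influence of the new element; the other influences come from the induction
  hypothesis applied to both conditioned functions.\<close>

lemma russo_formula:
  assumes "finite J"
  shows "((\<lambda>p. bexp p J f) has_real_derivative
    (\<Sum>e\<in>J. bexp p J (\<lambda>A. f (insert e A) - f (A - {e})))) (at p)"
  using assms
proof (induction J arbitrary: f rule: finite_induct)
  case empty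
  show ?case by (simp only: bexp_empty sum.empty DERIV_const)
next
  case (insert e J)
  let ?f' = "\<lambda>A. f (insert e A)"
  have D: "((\<lambda>p. p * bexp p J ?f' + (1 - p) * bexp p J f) has_real_derivative
     (p * (\<Sum>d\<in>J. bexp p J (\<lambda>A. ?f' (insert d A) - ?f' (A - {d})))
      + bexp p J ?f' + ((1 - p) * (\<Sum>d\<in>J. bexp p J (\<lambda>A. f (insert d A) - f (A - {d})))
      - bexp p J f))) (at p)"
    using DERIV_add[OF DERIV_mult[OF DERIV_ident insert.IH[of ?f']]
      DERIV_mult[OF DERIV_diff[OF DERIV_const[of 1] DERIV_ident] insert.IH[of f]]]
    by (simp add: algebra_simps)
  have e: "bexp p J (\<lambda>A. f (insert e A) - f (A - {e})) = bexp p J ?f' - bexp p J f"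
    unfolding bexp_diff[symmetric]
    using insert.hyps by (intro bexp_cong arg_cong2[where f = "(-)"] arg_cong[where f = f]) auto
  have "bexp p (insert e J) (\<lambda>A. f (insert e A) - f (A - {e})) = bexp p J ?f' - bexp p J f"
  proof -
    have c: "p * a + (1 - p) * a = a" for a :: real by (simp add: algebra_simps)
    show ?thesis using insert.hyps by (simp add: bexp_insert e c)
  qed
  moreover have "bexp p (insert e J) (\<lambda>A. f (insert d A) - f (A - {d})) =
      p * bexp p J (\<lambda>A. ?f' (insert d A) - ?f' (A - {d}))
      + (1 - p) * bexp p J (\<lambda>A. f (insert d A) - f (A - {d}))" if "d \<in> J" for d
  proof -
    have "insert e A - {d} = insert e (A - {d})" for A using that insert.hyps by auto
    then show ?thesis using insert.hyps by (simp add: bexp_insert insert_commute)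
  qed
  ultimately have "(\<Sum>d\<in>insert e J. bexp p (insert e J) (\<lambda>A. f (insert d A) - f (A - {d}))) =
      p * (\<Sum>d\<in>J. bexp p J (\<lambda>A. ?f' (insert d A) - ?f' (A - {d})))
      + bexp p J ?f' + ((1 - p) * (\<Sum>d\<in>J. bexp p J (\<lambda>A. f (insert d A) - f (A - {d})))
      - bexp p J f)"
    using insert.hyps by (simp only: sum.insert sum_distrib_left) (simp add: sum.distrib)
  with D show ?case by (simp only: bexp_insert[OF insert.hyps(1,2)])
qed

section \<open>Oriented percolation\<close>

type_synonym site = "int \<times> int"
type_synonym bond = "site \<times> bool"

text \<open>The site \<open>(k, a)\<close> stands for the vertex at height \<open>k\<close> with abscissa \<open>2 a - k\<close>, so that no parity
  condition is needed; the bond \<open>(u, b)\<close> goes up from \<open>u\<close>, to the right iff \<open>b\<close>.\<close>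

definition up :: "bool \<Rightarrow> site \<Rightarrow> site" where
  "up b u = u + (1, of_bool b)"

definition dn :: "bool \<Rightarrow> site \<Rightarrow> site" where
  "dn b u = u - (1, of_bool b)"

definition loc :: "site \<Rightarrow> vertex" where
  "loc u = (2 * snd u - fst u, fst u)"

definition bond_edge :: "bond \<Rightarrow> edge" where
  "bond_edge e = {loc (fst e), loc (up (snd e) (fst e))}"

definition opn :: "config \<Rightarrow> bond set" where
  "opn \<omega> = {e. \<omega> (bond_edge e)}"

lemma up_dn [simp]: "up b (dn b u) = u" "dn b (up b u) = u"
  by (simp_all add: up_def dn_def)

lemma up_plus: "up b (u + d) = up b u + d"
  by (simp add: up_def algebra_simps)

lemma dn_plus: "dn b (u + d) = dn b u + d"
  by (simp add: dn_def algebra_simps)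

lemma fst_up [simp]: "fst (up b u) = fst u + 1" and snd_up: "snd (up b u) = snd u + of_bool b"
  by (simp_all add: up_def)

lemma fst_dn [simp]: "fst (dn b u) = fst u - 1"
  by (simp_all add: dn_def)

lemma loc_eq_iff [simp]: "loc u = loc v \<longleftrightarrow> u = v"
  by (cases u; cases v) (auto simp: loc_def)

lemma loc_in_vertices: "loc u \<in> vertices"
  by (simp add: loc_def vertices_def)

lemma vertices_loc:
  assumes "z \<in> vertices"
  shows "loc (snd z, (fst z + snd z) div 2) = z"
  using assms by (cases z) (auto simp: loc_def vertices_def)

lemma bond_edge_in_edges: "bond_edge e \<in> edges"
proof -
  have "dist (plane_point (loc u)) (plane_point (loc (up b u))) = sqrt 2" for u b
    by (cases b) (simp_all add: plane_point_def loc_def up_def dist_prod_def dist_real_def)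
  then show ?thesis
    unfolding edges_def bond_edge_def using loc_in_vertices by blast
qed

text \<open>The endpoints of an edge have different heights, so the edge determines its lower
  endpoint and its direction. This is what makes the states of distinct bonds independent.\<close>

lemma inj_bond_edge: "inj bond_edge"
proof
  fix d e assume "bond_edge d = bond_edge e"
  then have "loc (fst d) = loc (fst e) \<and> loc (up (snd d) (fst d)) = loc (up (snd e) (fst e))
      \<or> loc (fst d) = loc (up (snd e) (fst e)) \<and> loc (up (snd d) (fst d)) = loc (fst e)"
    unfolding bond_edge_def doubleton_eq_iff .
  then show "d = e"
    by (cases d; cases e; cases "snd d"; cases "snd e") (auto simp: up_def)
qed

section \<open>From the product measure to finite sums\<close>

lemma percolation_law_cylinder:
  assumes p: "0 \<le> p" "p \<le> 1" and J: "finite J" "A \<subseteq> J"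
  defines "C \<equiv> {\<omega> \<in> space (percolation_law p). opn \<omega> \<inter> J = A}"
  shows "C \<in> sets (percolation_law p)"
    and "measure (percolation_law p) C = p ^ card A * (1 - p) ^ card (J - A)"
proof -
  let ?M = "\<lambda>_ :: edge. measure_pmf (bernoulli_pmf p)"
  interpret product_prob_space ?M edges
    by unfold_locales
  \<comment> \<open>The coordinates of the product space are edges, so the bond has to be recovered
    through \<open>inv bond_edge\<close>.\<close>
  define X where "X i = {inv bond_edge i \<in> A}" for i
  have inv: "inv bond_edge (bond_edge e) = e" for e by (simp add: inj_bond_edge)
  have C: "C = prod_emb edges ?M (bond_edge ` J) (Pi\<^sub>E (bond_edge ` J) X)"
    using J(2) by (auto simp: C_def prod_emb_def percolation_law_def space_PiM opn_def X_def
        PiE_iff restrict_def inv extensional_def)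
  have sub: "bond_edge ` J \<subseteq> edges" using bond_edge_in_edges by auto
  show "C \<in> sets (percolation_law p)"
    unfolding C percolation_law_def using sub J by (intro sets_PiM_I) auto
  have *: "measure (percolation_law p) C = (\<Prod>i\<in>bond_edge ` J. measure (?M i) (X i))"
    unfolding C percolation_law_def using sub J by (intro measure_PiM_emb) auto
  have b: "measure (bernoulli_pmf p) {b} = (if b then p else 1 - p)" for b
    using p by (cases b) (simp_all add: measure_pmf_single)
  have "(\<Prod>i\<in>bond_edge ` J. measure (?M i) (X i)) = (\<Prod>e\<in>J. if e \<in> A then p else 1 - p)"
    using inj_on_subset[OF inj_bond_edge, of J]
    by (subst prod.reindex) (auto simp: X_def inv b intro!: prod.cong)
  also have "\<dots> = p ^ card A * (1 - p) ^ card (J - A)"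
    using J by (simp add: prod.If_cases Int_absorb1 Diff_eq)
  finally show "measure (percolation_law p) C = p ^ card A * (1 - p) ^ card (J - A)"
    using * by simp
qed

lemma percolation_law_fdep:
  assumes p: "0 \<le> p" "p \<le> 1" and Q: "fdep Q"
  shows sets_percolation_law: "{\<omega> \<in> space (percolation_law p). Q (opn \<omega>)} \<in> sets (percolation_law p)"
    and measure_percolation_law:
      "measure (percolation_law p) {\<omega> \<in> space (percolation_law p). Q (opn \<omega>)} = pr p Q"
proof -
  interpret prob_space "percolation_law p" by (rule prob_space_percolation_law)
  obtain J where J: "finite J" "dep J Q" using Q by (auto simp: fdep_def)
  define C where "C A = {\<omega> \<in> space (percolation_law p). opn \<omega> \<inter> J = A}" for A
  let ?I = "{A \<in> Pow J. Q A}"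
  have eq: "{\<omega> \<in> space (percolation_law p). Q (opn \<omega>)} = (\<Union>A\<in>?I. C A)"
    using J(2) unfolding dep_def C_def by auto
  have C: "C A \<in> sets (percolation_law p)"
      "measure (percolation_law p) (C A) = p ^ card A * (1 - p) ^ card (J - A)" if "A \<in> ?I" for A
    using percolation_law_cylinder[OF p J(1)] that unfolding C_def by auto
  show "{\<omega> \<in> space (percolation_law p). Q (opn \<omega>)} \<in> sets (percolation_law p)"
    unfolding eq using C J(1) by (intro sets.finite_UN) auto
  have "measure (percolation_law p) (\<Union>A\<in>?I. C A) = (\<Sum>A\<in>?I. measure (percolation_law p) (C A))"
    using C J(1) by (intro finite_measure_finite_Union) (auto simp: disjoint_family_on_def C_def)
  also have "\<dots> = (\<Sum>A\<in>?I. p ^ card A * (1 - p) ^ card (J - A))"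
    using C by simp
  also have "\<dots> = bexp p J (\<lambda>A. of_bool (Q A))"
    unfolding bexp_def using J(1) by (intro sum.mono_neutral_cong_left) auto
  also have "\<dots> = pr p Q" using J by (intro expct_eq[symmetric] dep_comp[of _ _ of_bool])
  finally show "measure (percolation_law p) {\<omega> \<in> space (percolation_law p). Q (opn \<omega>)} = pr p Q"
    unfolding eq .
qed

section \<open>Finite open paths, translations and reflection\<close>

primrec reach :: "nat \<Rightarrow> bond set \<Rightarrow> site \<Rightarrow> bool" where
  "reach 0 A u \<longleftrightarrow> True"
| "reach (Suc n) A u \<longleftrightarrow> (\<exists>b. (u, b) \<in> A \<and> reach n A (up b u))"

primrec dreach :: "nat \<Rightarrow> bond set \<Rightarrow> site \<Rightarrow> bool" where
  "dreach 0 A u \<longleftrightarrow> True"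
| "dreach (Suc n) A u \<longleftrightarrow> (\<exists>b. (dn b u, b) \<in> A \<and> dreach n A (dn b u))"

definition shift_bond :: "site \<Rightarrow> bond \<Rightarrow> bond" where
  "shift_bond d e = (fst e + d, snd e)"

text \<open>Action on bonds of the point reflection \<open>u \<mapsto> - u\<close>: the upper
  endpoint becomes the lower one, while the direction \<open>b\<close> is kept.\<close>

definition flip_bond :: "bond \<Rightarrow> bond" where
  "flip_bond e = (- up (snd e) (fst e), snd e)"

lemma bij_shift: "bij (shift_bond d)"
  by (rule o_bij[of "shift_bond (- d)"]) (auto simp: shift_bond_def)

lemma flip_flip: "flip_bond (flip_bond e) = e"
  by (auto simp: flip_bond_def up_def)

lemma bij_flip: "bij flip_bond"
  by (rule o_bij[of flip_bond]) (auto simp: flip_flip)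

lemma shift_image: "(u + d, b) \<in> shift_bond d ` A \<longleftrightarrow> (u, b) \<in> A"
proof -
  have "(u + d, b) = shift_bond d (u, b)" by (simp add: shift_bond_def)
  then show ?thesis using bij_shift[of d] by (simp only: inj_image_mem_iff bij_def)
qed

lemma flip_image: "(- u, b) \<in> flip_bond ` A \<longleftrightarrow> (dn b u, b) \<in> A"
proof -
  have "(- u, b) = flip_bond (dn b u, b)" by (simp add: flip_bond_def)
  then show ?thesis using bij_flip by (simp only: inj_image_mem_iff bij_def)
qed

lemma reach_shift: "reach n (shift_bond d ` A) (u + d) \<longleftrightarrow> reach n A u"
  by (induction n arbitrary: u) (simp_all add: shift_image up_plus)

lemma dreach_flip: "dreach n A u \<longleftrightarrow> reach n (flip_bond ` A) (- u)"
proof (induction n arbitrary: u)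
  case (Suc n)
  have "up b (- u) = - dn b u" for b by (simp add: up_def dn_def)
  then show ?case by (simp add: flip_image Suc)
qed simp

lemma dreach_shift: "dreach n (shift_bond d ` A) (u + d) \<longleftrightarrow> dreach n A u"
proof (induction n arbitrary: u)
  case (Suc n)
  have "(dn b u + d, b) \<in> shift_bond d ` A \<longleftrightarrow> (dn b u, b) \<in> A" for b by (rule shift_image)
  then show ?case by (simp add: dn_plus Suc)
qed simp

text \<open>An upward step adds 0 or 1 to the second coordinate of a site, so the light cone
  consists of the sites whose second increment lies between 0 and the first.\<close>

definition fwd_cone :: "site \<Rightarrow> nat \<Rightarrow> bond set" where
  "fwd_cone u n = {e. fst u \<le> fst (fst e) \<and> fst (fst e) < fst u + int n \<and>
     snd u \<le> snd (fst e) \<and> snd (fst e) - snd u \<le> fst (fst e) - fst u}"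

lemma finite_cone: "finite (fwd_cone u n)"
proof (rule finite_subset)
  show "fwd_cone u n \<subseteq> ({fst u..fst u + int n} \<times> {snd u..snd u + int n}) \<times> UNIV"
    by (auto simp: fwd_cone_def)
qed simp

lemma dep_reach: "dep (fwd_cone u n) (\<lambda>A. reach n A u)"
proof (induction n arbitrary: u)
  case (Suc n)
  have "(\<lambda>A. reach (Suc n) A u) = (\<lambda>A. \<exists>b\<in>UNIV. (u, b) \<in> A \<and> reach n A (up b u))" by auto
  moreover have "fwd_cone (up b u) n \<subseteq> fwd_cone u (Suc n)" for b
    by (cases b) (auto simp: fwd_cone_def up_def)
  moreover have "(u, b) \<in> fwd_cone u (Suc n)" for b by (simp add: fwd_cone_def)
  ultimately show ?case
    by (simp only:) (intro dep_Bex dep_comp2[of _ _ _ "(\<and>)"] dep_mem dep_mono[OF Suc])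
qed simp

lemma fdep_reach [simp]: "fdep (\<lambda>A. reach n A u)"
  using dep_reach finite_cone unfolding fdep_def by blast

lemma fdep_dreach [simp]: "fdep (\<lambda>A. dreach n A u)"
  unfolding dreach_flip by (intro fdep_image[of flip_bond "\<lambda>A. reach n A (- u)"] bij_flip fdep_reach)

lemma dep_dreach: "dep {e. fst (fst e) < fst u} (\<lambda>A. dreach n A u)"
proof (induction n arbitrary: u)
  case (Suc n)
  have "(\<lambda>A. dreach (Suc n) A u) = (\<lambda>A. \<exists>b\<in>UNIV. (dn b u, b) \<in> A \<and> dreach n A (dn b u))" by auto
  then show ?case
    by (simp only:) (intro dep_Bex dep_comp2[of _ _ _ "(\<and>)"] dep_mem dep_mono[OF Suc]; force)
qed simp

lemma reach_antimono: "m \<le> n \<Longrightarrow> reach n A u \<Longrightarrow> reach m A u"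
proof (induction n arbitrary: m u)
  case (Suc n)
  note prems = Suc.prems and IH = Suc.IH
  show ?case
  proof (cases m)
    case (Suc k)
    obtain b where b: "(u, b) \<in> A" "reach n A (up b u)" using prems(2) by auto
    have "reach k A (up b u)" using IH[OF _ b(2)] prems(1) Suc by simp
    with b(1) show ?thesis unfolding Suc by auto
  qed simp
qed simp

lemma dreach_antimono: "m \<le> n \<Longrightarrow> dreach n A u \<Longrightarrow> dreach m A u"
  unfolding dreach_flip by (rule reach_antimono)

lemma reach_mono: "A \<subseteq> B \<Longrightarrow> reach n A u \<Longrightarrow> reach n B u"
  by (induction n arbitrary: u) (simp, meson reach.simps(2) subsetD)

lemma reach_add:
  assumes "reach (n + m) A u"
  shows "reach n A u \<and>
    (\<exists>j\<in>{0..int n}. reach m A (u + (int n, j)) \<and> dreach n A (u + (int n, j)))"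
proof -
  \<comment> \<open>The part of the path already travelled is carried through the induction as an
    open downward path of length \<open>i\<close>; at the intermediate level it has grown by
    \<open>n\<close>.\<close>
  have "\<exists>j\<in>{0..int n}. reach m A (u + (int n, j)) \<and> dreach (n + i) A (u + (int n, j))"
    if "reach (n + m) A u" "dreach i A u" for i
    using that
  proof (induction n arbitrary: u i)
    case 0
    then show ?case by (auto simp: zero_prod_def[symmetric])
  next
    case (Suc n)
    then obtain b where b: "(u, b) \<in> A" "reach (n + m) A (up b u)" by auto
    have "dreach (Suc i) A (up b u)" using b Suc.prems by (auto intro!: exI[of _ b])
    from Suc.IH[OF b(2) this] obtain j where j: "j \<in> {0..int n}"
      "reach m A (up b u + (int n, j))" "dreach (Suc n + i) A (up b u + (int n, j))" by (metis add_Suc add_Suc_right)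
    have "up b u + (int n, j) = u + (int (Suc n), j + of_bool b)"
      by (simp add: up_def add.assoc add.commute)
    then show ?case using j by (intro bexI[of _ "j + of_bool b"]) auto
  qed
  from this[of 0] assms show ?thesis using reach_antimono[of n "n + m" A u] by auto
qed

definition theta :: "real \<Rightarrow> nat \<Rightarrow> real" where
  "theta p n = pr p (\<lambda>A. reach n A 0)"

lemma pr_shift: "fdep Q \<Longrightarrow> pr p (\<lambda>A. Q (shift_bond d ` A)) = pr p Q"
  by (intro expct_image[of "shift_bond d" "\<lambda>A. of_bool (Q A)"] bij_shift fdep_logic)

lemma pr_reach: "pr p (\<lambda>A. reach n A u) = theta p n"
proof -
  have "pr p (\<lambda>A. reach n (shift_bond u ` A) (0 + u)) = pr p (\<lambda>A. reach n A (0 + u))"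
    by (rule pr_shift) simp
  then show ?thesis unfolding reach_shift theta_def by simp
qed

lemma pr_dreach: "pr p (\<lambda>A. dreach n A u) = theta p n"
  unfolding dreach_flip
  using expct_image[of flip_bond "\<lambda>A. of_bool (reach n A (- u))" p] bij_flip
  by (simp add: pr_reach fdep_logic)

lemma theta_antimono: "0 \<le> p \<Longrightarrow> p \<le> 1 \<Longrightarrow> m \<le> n \<Longrightarrow> theta p n \<le> theta p m"
  unfolding theta_def by (intro pr_mono) (auto intro: reach_antimono)

lemma theta_nonneg: "0 \<le> p \<Longrightarrow> p \<le> 1 \<Longrightarrow> 0 \<le> theta p n"
  unfolding theta_def by (intro expct_nonneg) (auto intro: fdep_logic)

section \<open>Sharpness of the phase transition\<close>

definition tgt :: "bond \<Rightarrow> site" where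
  "tgt e = up (snd e) (fst e)"

definition step :: "bond set \<Rightarrow> (site \<times> site) set" where
  "step A = (\<lambda>e. (fst e, tgt e)) ` A"

definition inner_bonds :: "site set \<Rightarrow> bond set \<Rightarrow> bond set" where
  "inner_bonds S A = {e \<in> A. fst e \<in> S \<and> tgt e \<in> S}"

text \<open>Sites at height at least \<open>n\<close> belong to it for every \<open>A\<close>; its
  complement therefore stays below level \<open>n\<close>, as required of the sets \<open>S\<close>
  in the sharpness argument.\<close>

definition hits :: "nat \<Rightarrow> bond set \<Rightarrow> site set" where
  "hits n A = {x. \<exists>z. int n \<le> fst z \<and> (x, z) \<in> (step A)\<^sup>*}"

text \<open>The origin belongs to it even if it is not in \<open>S\<close>, whence the assumption
  \<open>0 \<in> S\<close> in \<open>cluster_subset\<close>.\<close>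

definition cluster :: "site set \<Rightarrow> bond set \<Rightarrow> site set" where
  "cluster S A = {x. (0, x) \<in> (step (inner_bonds S A))\<^sup>*}"

text \<open>The restriction to the cone makes this set finite. No exit bond of the cluster of the
  origin is lost: if \<open>0 \<in> S\<close> and \<open>S\<close> lies below level
  \<open>n\<close>, that cluster stays in the cone (\<open>cluster_in_cone\<close>).\<close>

definition boundary :: "nat \<Rightarrow> site set \<Rightarrow> bond set" where
  "boundary n S = {e \<in> fwd_cone 0 n. fst e \<in> S \<and> tgt e \<notin> S}"

text \<open>\<open>p * psi p n S\<close> is the quantity \<open>\<phi>\<^sub>p(S)\<close> of Duminil-Copin and Tassion: the expected number of
  open bonds leaving \<open>S\<close> from a site that is connected to the origin inside \<open>S\<close>.\<close>

definition psi :: "real \<Rightarrow> nat \<Rightarrow> site set \<Rightarrow> real" where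
  "psi p n S = (\<Sum>e\<in>boundary n S. pr p (\<lambda>A. fst e \<in> cluster S A))"

lemma fst_tgt [simp]: "fst (tgt e) = fst (fst e) + 1"
  by (simp add: tgt_def)

lemma step_mono: "A \<subseteq> B \<Longrightarrow> (step A)\<^sup>* \<subseteq> (step B)\<^sup>*"
  unfolding step_def by (intro rtrancl_mono image_mono)

lemma stepI: "e \<in> A \<Longrightarrow> (fst e, tgt e) \<in> step A"
  unfolding step_def by auto

lemma stepE:
  assumes "(x, y) \<in> step A" obtains e where "e \<in> A" "x = fst e" "y = tgt e"
  using assms unfolding step_def by auto

lemma inside_subset: "inner_bonds S A \<subseteq> A"
  by (auto simp: inner_bonds_def)

lemma rtrancl_step_reach:
  assumes "(x, z) \<in> (step A)\<^sup>*"
  shows "fst x \<le> fst z \<and> reach (nat (fst z - fst x)) A x"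
  using assms
proof (induction rule: converse_rtrancl_induct)
  case (step x y)
  from step.hyps(1) obtain e where e: "e \<in> A" "x = fst e" "y = tgt e" by (rule stepE)
  have "nat (fst z - fst x) = Suc (nat (fst z - fst y))" using e step.IH by (simp add: Suc_nat_eq_nat_zadd1)
  moreover have "(x, snd e) \<in> A" "y = up (snd e) x" using e by (simp_all add: tgt_def)
  ultimately show ?case using step.IH e(3) by (simp, metis e(2) fst_up order_refl zle_add1_eq_le order_less_imp_le)
qed simp

lemma reach_rtrancl_step:
  assumes "reach n A x"
  shows "\<exists>z. fst z = fst x + int n \<and> (x, z) \<in> (step A)\<^sup>*"
  using assms
proof (induction n arbitrary: x)
  case (Suc n)
  then obtain b where b: "(x, b) \<in> A" "reach n A (up b x)" by auto
  obtain z where "fst z = fst (up b x) + int n" "(up b x, z) \<in> (step A)\<^sup>*"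
    using Suc.IH[OF b(2)] by blast
  moreover have "(x, up b x) \<in> step A" using stepI[OF b(1)] by (simp add: tgt_def)
  ultimately show ?case by (intro exI[of _ z]) auto
qed auto

lemma hits_reach: "x \<in> hits n A \<longleftrightarrow> reach (nat (int n - fst x)) A x"
proof
  assume "x \<in> hits n A"
  then obtain z where z: "int n \<le> fst z" "(x, z) \<in> (step A)\<^sup>*" by (auto simp: hits_def)
  have "nat (int n - fst x) \<le> nat (fst z - fst x)" using z(1) by (intro nat_mono) simp
  then show "reach (nat (int n - fst x)) A x"
    by (rule reach_antimono) (use rtrancl_step_reach[OF z(2)] in blast)
next
  assume "reach (nat (int n - fst x)) A x"
  from reach_rtrancl_step[OF this] obtain z
    where z: "fst z = fst x + int (nat (int n - fst x))" "(x, z) \<in> (step A)\<^sup>*" by blast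
  have "int n \<le> fst z" using z(1) by linarith
  then show "x \<in> hits n A" unfolding hits_def using z(2) by blast
qed

lemma hits_0: "0 \<in> hits n A \<longleftrightarrow> reach n A 0"
  by (simp add: hits_reach)

lemma hits_mono: "A \<subseteq> B \<Longrightarrow> hits n A \<subseteq> hits n B"
  unfolding hits_def using step_mono by blast

lemma hits_step: "e \<in> A \<Longrightarrow> tgt e \<in> hits n A \<Longrightarrow> fst e \<in> hits n A"
  unfolding hits_def by (auto intro: converse_rtrancl_into_rtrancl stepI)

lemma hits_above: "int n \<le> fst z \<Longrightarrow> z \<in> hits n A"
  unfolding hits_def by blast

lemma hits_rtrancl: "(x, y) \<in> (step A)\<^sup>* \<Longrightarrow> y \<in> hits n A \<Longrightarrow> x \<in> hits n A"
  unfolding hits_def by (auto intro: rtrancl_trans)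

lemma hits_induct [consumes 1, case_names above step]:
  assumes "x \<in> hits n A" and "\<And>z. int n \<le> fst z \<Longrightarrow> P z"
    and "\<And>e. e \<in> A \<Longrightarrow> tgt e \<in> hits n A \<Longrightarrow> P (tgt e) \<Longrightarrow> P (fst e)"
  shows "P x"
proof -
  obtain z where z: "int n \<le> fst z" "(x, z) \<in> (step A)\<^sup>*" using assms(1) by (auto simp: hits_def)
  from z(2) have "x \<in> hits n A \<and> P x"
  proof (induction rule: converse_rtrancl_induct)
    case base
    show ?case using assms(2) hits_above z(1) by auto
  next
    case (step x y)
    from step.hyps(1) obtain e where e: "e \<in> A" "x = fst e" "y = tgt e" by (rule stepE)
    show ?case using assms(3)[OF e(1)] hits_step[OF e(1), of n] step.IH by (simp only: e)
  qed
  then show ?thesis ..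
qed

text \<open>A bond used on the way to level \<open>n\<close> has a target that itself hits level
  \<open>n\<close>, hence lies outside \<open>S\<close>. Such a path survives the deletion of all
  bonds with both endpoints in \<open>S\<close>, and the same argument run in the reduced
  configuration gives the converse.\<close>

lemma dep_hits_eq: "dep (- {e. fst e \<in> S \<and> tgt e \<in> S}) (\<lambda>A. - hits n A = S)"
  unfolding dep_def
proof
  fix A
  let ?B = "A \<inter> - {e. fst e \<in> S \<and> tgt e \<in> S}"
  have sub: "hits n ?B \<subseteq> hits n A" by (intro hits_mono) auto
  show "(- hits n A = S) = (- hits n ?B = S)"
  proof
    assume S: "- hits n A = S"
    have "x \<in> hits n ?B" if "x \<in> hits n A" for x
      using that
    proof (induction rule: hits_induct)
      case (step e)
      have "e \<in> ?B" using step S by auto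
      then show ?case using step.IH by (rule hits_step)
    qed (rule hits_above)
    then show "- hits n ?B = S" using sub S by blast
  next
    assume S: "- hits n ?B = S"
    have "x \<in> hits n ?B" if "x \<in> hits n A" for x
      using that
    proof (induction rule: hits_induct)
      case (step e)
      have "e \<in> ?B" using step S by auto
      then show ?case using step.IH by (rule hits_step)
    qed (rule hits_above)
    then show "- hits n A = S" using sub S by blast
  qed
qed

lemma cluster_0: "0 \<in> cluster S A"
  by (simp add: cluster_def)

lemma cluster_step: "fst e \<in> cluster S A \<Longrightarrow> e \<in> inner_bonds S A \<Longrightarrow> tgt e \<in> cluster S A"
  unfolding cluster_def by (auto intro: rtrancl_into_rtrancl stepI)

lemma cluster_induct [consumes 1, case_names zero step]:
  assumes "x \<in> cluster S A" "P 0"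
    and "\<And>e. fst e \<in> cluster S A \<Longrightarrow> e \<in> inner_bonds S A \<Longrightarrow> P (fst e) \<Longrightarrow> P (tgt e)"
  shows "P x"
proof -
  have "(0, x) \<in> (step (inner_bonds S A))\<^sup>*" using assms(1) by (simp add: cluster_def)
  then have "x \<in> cluster S A \<and> P x"
  proof (induction rule: rtrancl_induct)
    case base
    show ?case using assms(2) cluster_0 by blast
  next
    case (step y z)
    from step.hyps(2) obtain e where "e \<in> inner_bonds S A" "y = fst e" "z = tgt e" by (rule stepE)
    then show ?case using assms(3)[of e] cluster_step[of e S A] step.IH by simp
  qed
  then show ?thesis ..
qed

lemma inside_mono: "A \<subseteq> B \<Longrightarrow> inner_bonds S A \<subseteq> inner_bonds S B"
  by (auto simp: inner_bonds_def)

lemma cluster_mono: "A \<subseteq> B \<Longrightarrow> cluster S A \<subseteq> cluster S B"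
  unfolding cluster_def using step_mono[OF inside_mono] by blast

lemma cluster_subset: "0 \<in> S \<Longrightarrow> cluster S A \<subseteq> S"
proof
  fix x assume "0 \<in> S" "x \<in> cluster S A"
  from this(2,1) show "x \<in> S" by (induction rule: cluster_induct) (auto simp: inner_bonds_def)
qed

lemma cluster_cone:
  assumes "x \<in> cluster S A"
  shows "0 \<le> fst x \<and> 0 \<le> snd x \<and> snd x \<le> fst x"
  using assms by (induction rule: cluster_induct) (auto simp: tgt_def snd_up)

lemma cluster_in_cone:
  assumes "S \<subseteq> {v. fst v < int n}" "0 \<in> S" "fst e \<in> cluster S A"
  shows "e \<in> fwd_cone 0 n"
  using cluster_cone[OF assms(3)] cluster_subset[OF assms(2)] assms unfolding fwd_cone_def by auto

lemma dep_cluster: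
  assumes "S \<subseteq> {v. fst v < int n}" "0 \<in> S"
  shows "dep (fwd_cone 0 n) (cluster S)"
  unfolding dep_def
proof
  fix A
  have "x \<in> cluster S (A \<inter> fwd_cone 0 n)" if "x \<in> cluster S A" for x
    using that
  proof (induction rule: cluster_induct)
    case (step e)
    have "e \<in> inner_bonds S (A \<inter> fwd_cone 0 n)"
      using step cluster_in_cone[OF assms step.hyps(1)] by (auto simp: inner_bonds_def)
    with step.IH show ?case by (rule cluster_step)
  qed (rule cluster_0)
  moreover have "cluster S (A \<inter> fwd_cone 0 n) \<subseteq> cluster S A" by (intro cluster_mono) auto
  ultimately show "cluster S A = cluster S (A \<inter> fwd_cone 0 n)" by blast
qed

lemma fdep_cluster:
  assumes "S \<subseteq> {v. fst v < int n}" "0 \<in> S"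
  shows "fdep (cluster S)"
  using dep_cluster[OF assms] finite_cone unfolding fdep_def by blast

lemma dep_cluster_inside: "dep {e. fst e \<in> S \<and> tgt e \<in> S} (cluster S)"
proof -
  have "inner_bonds S (A \<inter> {e. fst e \<in> S \<and> tgt e \<in> S}) = inner_bonds S A" for A
    by (auto simp: inner_bonds_def)
  then show ?thesis unfolding dep_def cluster_def by simp
qed

text \<open>Exploring the cluster from the origin only examines bonds that start at one of its sites
  and end in \<open>S\<close>. Bonds leaving \<open>S\<close>, and bonds that start outside
  \<open>C\<close>, remain unexplored and can be used afterwards.\<close>

lemma dep_cluster_eq: "dep {e. fst e \<in> C \<and> tgt e \<in> S} (\<lambda>A. cluster S A = C)"
  unfolding dep_def
proof
  fix A
  let ?B = "A \<inter> {e. fst e \<in> C \<and> tgt e \<in> S}"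
  have sub: "cluster S ?B \<subseteq> cluster S A" by (intro cluster_mono) auto
  show "(cluster S A = C) = (cluster S ?B = C)"
  proof
    assume C: "cluster S A = C"
    have "x \<in> cluster S ?B" if "x \<in> cluster S A" for x
      using that
    proof (induction rule: cluster_induct)
      case (step e)
      have "e \<in> inner_bonds S ?B" using step C by (auto simp: inner_bonds_def)
      with step.IH show ?case by (rule cluster_step)
    qed (rule cluster_0)
    then show "cluster S ?B = C" using sub C by blast
  next
    assume C: "cluster S ?B = C"
    have "x \<in> cluster S ?B" if "x \<in> cluster S A" for x
      using that
    proof (induction rule: cluster_induct)
      case (step e)
      have "e \<in> inner_bonds S ?B" using step C by (auto simp: inner_bonds_def)
      with step.IH show ?case by (rule cluster_step)
    qed (rule cluster_0)
    then show "cluster S A = C" using sub C by blast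
  qed
qed

section \<open>The differential inequality\<close>

definition dtheta :: "real \<Rightarrow> nat \<Rightarrow> real" where
  "dtheta p n = (\<Sum>e\<in>fwd_cone 0 n. bexp p (fwd_cone 0 n)
     (\<lambda>A. of_bool (reach n (insert e A) 0) - of_bool (reach n (A - {e}) 0)))"

lemma theta_bexp: "theta p n = bexp p (fwd_cone 0 n) (\<lambda>A. of_bool (reach n A 0))"
  unfolding theta_def by (intro expct_eq finite_cone dep_comp[of _ _ of_bool] dep_reach)

lemma DERIV_theta: "((\<lambda>p. theta p n) has_real_derivative dtheta p n) (at p)"
  unfolding theta_bexp dtheta_def by (rule russo_formula[OF finite_cone])

lemma dtheta_nonneg:
  assumes "0 \<le> p" "p \<le> 1"
  shows "0 \<le> dtheta p n"
  unfolding dtheta_def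
proof (intro sum_nonneg bexp_nonneg assms)
  fix e :: bond and A
  have "reach n (A - {e}) 0 \<Longrightarrow> reach n (insert e A) 0" by (rule reach_mono[rotated]) auto
  then show "0 \<le> (of_bool (reach n (insert e A) 0) - of_bool (reach n (A - {e}) 0) :: real)" by auto
qed

lemma theta_mono:
  assumes "0 \<le> p" "p \<le> q" "q \<le> 1"
  shows "theta p n \<le> theta q n"
  by (rule DERIV_nonneg_imp_nondecreasing[OF assms(2)])
    (use assms DERIV_theta dtheta_nonneg in \<open>meson order_trans\<close>)

text \<open>If the origin is not connected to level \<open>n\<close>, let \<open>S\<close> be the set of sites that are not. It is
  determined by the bonds that are not contained in \<open>S\<close>, and the bonds leaving \<open>S\<close> from the
  cluster of the origin in \<open>S\<close> are pivotal.\<close>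

lemma dtheta_ge:
  assumes p: "0 \<le> p" "p \<le> 1"
    and psi: "\<And>S. 0 \<in> S \<Longrightarrow> S \<subseteq> {v. fst v < int n} \<Longrightarrow> 1 \<le> psi p n S"
  shows "1 - theta p n \<le> (1 - p) * dtheta p n"
proof -
  define J where "J = fwd_cone 0 n"
  have J: "finite J" by (simp add: J_def finite_cone)
  define X where "X S e A \<longleftrightarrow> 0 \<in> S \<and> e \<in> boundary n S \<and> fst e \<in> cluster S A" for S e A
  \<comment> \<open>The finitely many possible values of the random set \<open>- hits n A\<close>;
    the event that the origin is not connected is decomposed according to this value.\<close>
  define \<S> where "\<S> = (\<lambda>A. - hits n A) ` Pow J"
  have fin: "finite \<S>" using J by (simp add: \<S>_def)
  have piv: "bexp p J (\<lambda>A. of_bool (X (- hits n A) e A)) \<le>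
      (1 - p) * bexp p J (\<lambda>A. of_bool (reach n (insert e A) 0) - of_bool (reach n (A - {e}) 0))"
    if e: "e \<in> J" for e
  proof -
    let ?d = "\<lambda>A. of_bool (reach n (insert e A) 0) - of_bool (reach n (A - {e}) 0) :: real"
    have mono: "reach n (A - {e}) 0 \<Longrightarrow> reach n (insert e A) 0" for A
      by (rule reach_mono[rotated]) auto
    have "bexp p J (\<lambda>A. of_bool (X (- hits n A) e A)) \<le> bexp p J (\<lambda>A. of_bool (e \<notin> A) * ?d A)"
    proof (intro bexp_mono p)
      fix A
      show "of_bool (X (- hits n A) e A) \<le> of_bool (e \<notin> A) * ?d A"
      proof (cases "X (- hits n A) e A")
        case True
        then have 0: "0 \<notin> hits n A" and t: "tgt e \<in> hits n A" and c: "(0, fst e) \<in> (step A)\<^sup>*"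
          using step_mono[OF inside_subset] by (auto simp: X_def boundary_def cluster_def)
        have "e \<notin> A" using hits_step[OF _ t] hits_rtrancl[OF c] 0 by blast
        moreover from this have "\<not> reach n (A - {e}) 0" using 0 by (simp add: hits_0)
        moreover have "reach n (insert e A) 0"
          unfolding hits_0[symmetric]
        proof (rule hits_rtrancl)
          show "(0, fst e) \<in> (step (insert e A))\<^sup>*" using c step_mono[of A "insert e A"] by blast
          show "fst e \<in> hits n (insert e A)"
            using t hits_mono[of A "insert e A"] by (intro hits_step) auto
        qed
        ultimately show ?thesis by simp
      qed (use mono[of A] in auto)
    qed
    \<comment> \<open>The influence of \<open>e\<close> does not depend on the state of
      \<open>e\<close>, so requiring \<open>e\<close> to be closed costs exactly the factor
      \<open>1 - p\<close>.\<close>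
    also have "\<dots> = bexp p J (\<lambda>A. of_bool (e \<notin> A)) * bexp p J ?d"
    proof (rule bexp_indep[OF J, of "{e}" _ "- {e}"])
      show "dep {e} (\<lambda>A. of_bool (e \<notin> A) :: real)"
        by (intro dep_comp[of _ "\<lambda>A. e \<in> A" "\<lambda>x. of_bool (\<not> x)"] dep_mem) simp
      have "insert e (A \<inter> - {e}) = insert e A" "A \<inter> - {e} - {e} = A - {e}" for A by auto
      then show "dep (- {e}) ?d" unfolding dep_def by simp
    qed auto
    also have "bexp p J (\<lambda>A. of_bool (e \<notin> A)) = 1 - p"
    proof -
      have "bexp p J (\<lambda>A. of_bool (e \<notin> A)) = bexp p {e} (\<lambda>A. of_bool (e \<notin> A))"
        using e J by (intro bexp_mono_set dep_comp[of _ "\<lambda>A. e \<in> A" "\<lambda>x. of_bool (\<not> x)"] dep_mem) auto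
      then show ?thesis by (simp add: bexp_insert)
    qed
    finally show ?thesis .
  qed
  have S: "S \<subseteq> {v. fst v < int n}" if "S \<in> \<S>" for S
    using that hits_above by (fastforce simp: \<S>_def)
  have sub: "boundary n S \<subseteq> J" for S by (auto simp: boundary_def J_def)
  have "1 - theta p n = bexp p J (\<lambda>A. of_bool (0 \<notin> hits n A))"
    using bexp_diff[of p J "\<lambda>_. 1" "\<lambda>A. of_bool (reach n A 0)"] bexp_const[OF J, of p 1]
    by (simp add: theta_bexp J_def hits_0 of_bool_not_iff)
  also have "\<dots> = bexp p J (\<lambda>A. \<Sum>S\<in>\<S>. of_bool (0 \<in> S) * of_bool (- hits n A = S))"
  proof (rule bexp_cong)
    fix A assume "A \<subseteq> J"
    then have "- hits n A \<in> \<S>" by (auto simp: \<S>_def)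
    have "(\<Sum>S\<in>\<S>. of_bool (0 \<in> S) * of_bool (- hits n A = S)) =
      (\<Sum>S\<in>\<S>. if - hits n A = S then of_bool (0 \<in> S) else 0 :: real)"
      by (intro sum.cong) auto
    also have "\<dots> = of_bool (0 \<notin> hits n A)"
      using fin \<open>- hits n A \<in> \<S>\<close> by (simp add: sum.delta')
    finally show "of_bool (0 \<notin> hits n A) =
        (\<Sum>S\<in>\<S>. of_bool (0 \<in> S) * of_bool (- hits n A = S) :: real)" ..
  qed
  also have "\<dots> = (\<Sum>S\<in>\<S>. of_bool (0 \<in> S) * bexp p J (\<lambda>A. of_bool (- hits n A = S)))"
    by (simp only: bexp_sum bexp_cmult)
  \<comment> \<open>The hypothesis on \<open>psi\<close> allows a factor \<open>psi p n S\<close> to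
    be inserted. Expanded over the boundary, it merges with the probability of
    \<open>- hits n A = S\<close>, because the two events read disjoint sets of bonds.\<close>
  also have "\<dots> \<le> (\<Sum>S\<in>\<S>. of_bool (0 \<in> S) * (bexp p J (\<lambda>A. of_bool (- hits n A = S)) * psi p n S))"
  proof (rule sum_mono)
    fix S assume "S \<in> \<S>"
    have "0 \<le> bexp p J (\<lambda>A. of_bool (- hits n A = S))" using p by (intro bexp_nonneg) auto
    then show "of_bool (0 \<in> S) * bexp p J (\<lambda>A. of_bool (- hits n A = S))
      \<le> of_bool (0 \<in> S) * (bexp p J (\<lambda>A. of_bool (- hits n A = S)) * psi p n S)"
      using mult_left_mono[OF psi[OF _ S[OF \<open>S \<in> \<S>\<close>]]] by (cases "0 \<in> S") force+
  qed
  also have "\<dots> = (\<Sum>S\<in>\<S>. \<Sum>e\<in>J. bexp p J (\<lambda>A. of_bool (- hits n A = S) * of_bool (X S e A)))"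
  proof (intro sum.cong refl)
    fix S assume SS: "S \<in> \<S>"
    show "of_bool (0 \<in> S) * (bexp p J (\<lambda>A. of_bool (- hits n A = S)) * psi p n S) =
      (\<Sum>e\<in>J. bexp p J (\<lambda>A. of_bool (- hits n A = S) * of_bool (X S e A)))"
    proof (cases "0 \<in> S")
      case True
      have "bexp p J (\<lambda>A. of_bool (- hits n A = S)) * psi p n S =
        (\<Sum>e\<in>boundary n S. bexp p J (\<lambda>A. of_bool (- hits n A = S)) *
           bexp p J (\<lambda>A. of_bool (fst e \<in> cluster S A)))"
        unfolding psi_def sum_distrib_left
        using dep_cluster[OF S[OF SS] True] J
        by (intro sum.cong arg_cong2[where f = "(*)"] refl expct_eq)
          (auto simp: J_def intro: dep_comp[of _ "cluster S" "\<lambda>C. of_bool (_ \<in> C)"])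
      also have "\<dots> = (\<Sum>e\<in>boundary n S. bexp p J (\<lambda>A. of_bool (- hits n A = S) * of_bool (X S e A)))"
      proof (intro sum.cong refl)
        fix e assume "e \<in> boundary n S"
        then have X: "X S e A \<longleftrightarrow> fst e \<in> cluster S A" for A using True by (simp add: X_def)
        show "bexp p J (\<lambda>A. of_bool (- hits n A = S)) * bexp p J (\<lambda>A. of_bool (fst e \<in> cluster S A))
          = bexp p J (\<lambda>A. of_bool (- hits n A = S) * of_bool (X S e A))"
          unfolding X
          by (rule bexp_indep[OF J, symmetric], rule dep_comp[OF dep_hits_eq],
              rule dep_comp[OF dep_cluster_inside]) auto
      qed
      also have "\<dots> = (\<Sum>e\<in>J. bexp p J (\<lambda>A. of_bool (- hits n A = S) * of_bool (X S e A)))"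
        using J sub bexp_const[OF J, of p 0] by (intro sum.mono_neutral_left) (auto simp: X_def)
      finally show ?thesis using True by simp
    next
      case False
      then show ?thesis using bexp_const[OF J, of p 0] by (simp add: X_def)
    qed
  qed
  also have "\<dots> = (\<Sum>e\<in>J. bexp p J (\<lambda>A. \<Sum>S\<in>\<S>. of_bool (- hits n A = S) * of_bool (X S e A)))"
    unfolding bexp_sum by (rule sum.swap)
  also have "\<dots> = (\<Sum>e\<in>J. bexp p J (\<lambda>A. of_bool (X (- hits n A) e A)))"
  proof (intro sum.cong refl bexp_cong)
    fix e A assume "A \<subseteq> J"
    then have "- hits n A \<in> \<S>" by (auto simp: \<S>_def)
    have "(\<Sum>S\<in>\<S>. of_bool (- hits n A = S) * of_bool (X S e A)) =
      (\<Sum>S\<in>\<S>. if - hits n A = S then of_bool (X S e A) else 0 :: real)"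
      by (intro sum.cong) auto
    also have "\<dots> = of_bool (X (- hits n A) e A)"
      using fin \<open>- hits n A \<in> \<S>\<close> by (simp add: sum.delta')
    finally show "(\<Sum>S\<in>\<S>. of_bool (- hits n A = S) * of_bool (X S e A)) =
      (of_bool (X (- hits n A) e A) :: real)" .
  qed
  also have "\<dots> \<le> (1 - p) * dtheta p n"
    unfolding dtheta_def sum_distrib_left J_def[symmetric] by (intro sum_mono piv)
  finally show ?thesis .
qed

text \<open>With \<open>1 - s \<le> 1\<close>, \<open>dtheta_ge\<close> says that the derivative of
  \<open>theta\<close> is at least \<open>1 - theta\<close>, so
  \<open>(1 - theta s n) * exp s\<close> is nonincreasing in \<open>s\<close>. All that matters is
  that the resulting lower bound on \<open>theta q n\<close> is positive and does not depend on
  \<open>n\<close>.\<close>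

lemma one_minus_theta_le:
  assumes "0 \<le> p" "p \<le> q" "q < 1"
    and psi: "\<And>s S. p \<le> s \<Longrightarrow> s \<le> q \<Longrightarrow> 0 \<in> S \<Longrightarrow> S \<subseteq> {v. fst v < int n} \<Longrightarrow> 1 \<le> psi s n S"
  shows "1 - theta q n \<le> exp (- (q - p))"
proof -
  let ?g = "\<lambda>s. (1 - theta s n) * exp s"
  have "?g q \<le> ?g p"
  proof (rule DERIV_nonpos_imp_nonincreasing[OF assms(2)])
    fix s assume s: "p \<le> s" "s \<le> q"
    then have s01: "0 \<le> s" "s \<le> 1" using assms by auto
    have "(1 - s) * dtheta s n \<le> dtheta s n"
      using dtheta_nonneg[OF s01] s01 by (simp add: mult_left_le_one_le)
    then have "1 - theta s n \<le> dtheta s n"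
      using dtheta_ge[OF s01 psi[OF s]] by (meson order_trans)
    then have "(- dtheta s n + (1 - theta s n)) * exp s \<le> 0"
      by (simp add: mult_nonpos_nonneg)
    moreover have "(?g has_real_derivative (- dtheta s n + (1 - theta s n)) * exp s) (at s)"
      by (auto intro!: derivative_eq_intros DERIV_theta simp: algebra_simps)
    ultimately show "\<exists>y. (?g has_real_derivative y) (at s) \<and> y \<le> 0" by blast
  qed
  moreover have "?g p \<le> 1 * exp p"
    using theta_nonneg[of p n] assms by (intro mult_right_mono) auto
  ultimately have "(1 - theta q n) * exp q \<le> exp p" by linarith
  then have "1 - theta q n \<le> exp p / exp q" by (simp add: field_simps)
  then show ?thesis by (simp add: exp_diff[symmetric])
qed

section \<open>Renewal and exponential decay\<close>

text \<open>Induction from the end of the path: each suffix either already contains the last exit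
  from \<open>C\<close> or avoids \<open>C\<close> altogether.\<close>

lemma last_exit:
  assumes "(x, z) \<in> (step A)\<^sup>*" "x \<in> C" "z \<notin> C"
  shows "\<exists>e\<in>A. fst e \<in> C \<and> tgt e \<notin> C \<and> (tgt e, z) \<in> (step (A \<inter> {d. fst d \<notin> C}))\<^sup>*"
proof -
  let ?B = "A \<inter> {d. fst d \<notin> C}"
  from assms(1) have "(\<exists>e\<in>A. fst e \<in> C \<and> tgt e \<notin> C \<and> (tgt e, z) \<in> (step ?B)\<^sup>*)
    \<or> x \<notin> C \<and> (x, z) \<in> (step ?B)\<^sup>*"
  proof (induction rule: converse_rtrancl_induct)
    case (step x y)
    from step.hyps(1) obtain e where e: "e \<in> A" "x = fst e" "y = tgt e" by (rule stepE)
    from step.IH show ?case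
    proof
      assume y: "y \<notin> C \<and> (y, z) \<in> (step ?B)\<^sup>*"
      show ?thesis
      proof (cases "x \<in> C")
        case True
        then show ?thesis using y e by blast
      next
        case False
        then have "(x, y) \<in> step ?B" using e stepI[of e ?B] by simp
        then show ?thesis using False y by (meson converse_rtrancl_into_rtrancl)
      qed
    qed blast
  qed (use assms(3) in blast)
  then show ?thesis using assms(2) by blast
qed

text \<open>Condition on the cluster of the origin in \<open>S\<close> and cut the path at its last exit from that cluster:
  the remainder of the path uses fresh bonds only.\<close>

lemma theta_renewal:
  assumes p: "0 \<le> p" "p \<le> 1" and S: "0 \<in> S" "S \<subseteq> {v. fst v < int n}" and "n \<le> m"
  shows "theta p m \<le> p * psi p n S * theta p (m - n)"
proof -
  define \<C> where "\<C> = cluster S ` Pow (fwd_cone 0 n)"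
  have fin: "finite \<C>" by (simp add: \<C>_def finite_cone)
  have finB: "finite (boundary n S)"
    using finite_cone by (rule finite_subset[rotated]) (auto simp: boundary_def)
  have in_C: "cluster S A \<in> \<C>" for A
  proof -
    have "cluster S A = cluster S (A \<inter> fwd_cone 0 n)"
      using dep_cluster[OF S(2,1)] unfolding dep_def by blast
    then show ?thesis unfolding \<C>_def by blast
  qed
  define G where "G e C A \<longleftrightarrow> cluster S A = C \<and>
    (e \<in> A \<and> reach (m - n) (A \<inter> {d. fst d \<notin> C}) (tgt e))" for e C A
  have fd1: "fdep (\<lambda>A. cluster S A = C)" for C
    using fdep_cluster[OF S(2,1)] by (rule fdep_comp)
  have fd2: "fdep (\<lambda>A. reach (m - n) (A \<inter> {d. fst d \<notin> C}) u)" for C u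
    by (rule fdep_restrict[of "\<lambda>A. reach (m - n) A u"]) simp
  have fdG: "fdep (G e C)" for e C
    unfolding G_def by (intro fdep_logic fd1 fd2 fdep_mem)
  \<comment> \<open>Three disjoint sets of bonds: the cluster is determined by bonds from
    \<open>C\<close> into \<open>S\<close>, the bond \<open>e\<close> goes from \<open>C\<close> out
    of \<open>S\<close>, and the remainder of the path uses bonds that do not start in
    \<open>C\<close>.\<close>
  have prG: "pr p (G e C) \<le> pr p (\<lambda>A. cluster S A = C) * (p * theta p (m - n))"
    if e: "e \<in> boundary n S" "fst e \<in> C" for e C
  proof -
    have d: "dep (UNIV \<inter> {d. fst d \<notin> C}) (\<lambda>A. reach (m - n) (A \<inter> {d. fst d \<notin> C}) (tgt e))"
      by (rule dep_restrict, rule dep_mono[OF dep_reach]) simp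
    have "pr p (G e C) = pr p (\<lambda>A. cluster S A = C) *
        pr p (\<lambda>A. e \<in> A \<and> reach (m - n) (A \<inter> {d. fst d \<notin> C}) (tgt e))"
      unfolding G_def
    proof (rule pr_indep[OF fd1 _ dep_cluster_eq])
      show "fdep (\<lambda>A. e \<in> A \<and> reach (m - n) (A \<inter> {d. fst d \<notin> C}) (tgt e))"
        by (intro fdep_logic fd2 fdep_mem)
      show "dep (insert e {d. fst d \<notin> C})
          (\<lambda>A. e \<in> A \<and> reach (m - n) (A \<inter> {d. fst d \<notin> C}) (tgt e))"
        by (intro dep_comp2[of _ _ _ "(\<and>)"] dep_mem dep_mono[OF d]) auto
    qed (use e in \<open>auto simp: boundary_def\<close>)
    also have "pr p (\<lambda>A. e \<in> A \<and> reach (m - n) (A \<inter> {d. fst d \<notin> C}) (tgt e)) =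
        p * pr p (\<lambda>A. reach (m - n) (A \<inter> {d. fst d \<notin> C}) (tgt e))"
      using e by (subst pr_indep[OF fdep_mem fd2 dep_mem[of e "{e}"] d]) (auto simp: pr_mem)
    also have "pr p (\<lambda>A. reach (m - n) (A \<inter> {d. fst d \<notin> C}) (tgt e)) \<le> theta p (m - n)"
      unfolding pr_reach[of p _ "tgt e", symmetric]
      by (intro pr_mono p fd2) (auto intro: reach_mono[rotated])
    finally show ?thesis
      using p by (simp add: mult_left_mono expct_nonneg fd1 fdep_logic)
  qed
  have "theta p m \<le> pr p (\<lambda>A. \<exists>e\<in>boundary n S. \<exists>C\<in>{C \<in> \<C>. fst e \<in> C}. G e C A)"
    unfolding theta_def
  proof (intro pr_mono p fdep_Bex finB fdG)
    fix A assume "reach m A 0"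
    then obtain z where z: "fst z = int m" "(0, z) \<in> (step A)\<^sup>*"
      using reach_rtrancl_step by fastforce
    let ?C = "cluster S A"
    have "z \<notin> ?C" using cluster_subset[OF S(1)] S(2) z(1) \<open>n \<le> m\<close> by fastforce
    from last_exit[OF z(2) cluster_0 this] obtain e where
      e: "e \<in> A" "fst e \<in> ?C" "tgt e \<notin> ?C" "(tgt e, z) \<in> (step (A \<inter> {d. fst d \<notin> ?C}))\<^sup>*" by blast
    have fS: "fst e \<in> S" using cluster_subset[OF S(1)] e(2) by blast
    then have lt: "fst (tgt e) \<le> int n" using S(2) by auto
    have "tgt e \<notin> S"
      using cluster_step[OF e(2)] e(1,3) fS by (auto simp: inner_bonds_def)
    then have b: "e \<in> boundary n S"
      using fS cluster_in_cone[OF S(2,1) e(2)] by (simp add: boundary_def)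
    \<comment> \<open>The exit bond ends at height at most \<open>n\<close>, so at least
      \<open>m - n\<close> levels remain.\<close>
    have "m - n \<le> nat (fst z - fst (tgt e))" using lt z(1) by linarith
    then have "reach (m - n) (A \<inter> {d. fst d \<notin> ?C}) (tgt e)"
      by (rule reach_antimono) (use rtrancl_step_reach[OF e(4)] in blast)
    then have "G e ?C A" using e by (simp add: G_def)
    then show "\<exists>e\<in>boundary n S. \<exists>C\<in>{C \<in> \<C>. fst e \<in> C}. G e C A"
      using b in_C e(2) by blast
  qed (use fin in auto)
  also have "\<dots> \<le> (\<Sum>e\<in>boundary n S. pr p (\<lambda>A. \<exists>C\<in>{C \<in> \<C>. fst e \<in> C}. G e C A))"
    by (intro pr_Bex_le p finB fdep_Bex fdG) (use fin in auto)
  also have "\<dots> \<le> (\<Sum>e\<in>boundary n S. \<Sum>C\<in>{C \<in> \<C>. fst e \<in> C}. pr p (G e C))"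
    by (intro sum_mono pr_Bex_le p fdG) (use fin in auto)
  also have "\<dots> \<le> (\<Sum>e\<in>boundary n S. \<Sum>C\<in>{C \<in> \<C>. fst e \<in> C}.
      pr p (\<lambda>A. cluster S A = C) * (p * theta p (m - n)))"
    by (intro sum_mono prG) auto
  also have "\<dots> = (\<Sum>e\<in>boundary n S. pr p (\<lambda>A. fst e \<in> cluster S A) * (p * theta p (m - n)))"
  proof (intro sum.cong refl)
    fix e
    have "(\<Sum>C\<in>{C \<in> \<C>. fst e \<in> C}. of_bool (cluster S A = C)) = (of_bool (fst e \<in> cluster S A) :: real)"
      for A
    proof -
      have "(\<Sum>C\<in>{C \<in> \<C>. fst e \<in> C}. of_bool (cluster S A = C)) =
        (\<Sum>C\<in>{C \<in> \<C>. fst e \<in> C}. if cluster S A = C then 1 else 0 :: real)"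
        by (intro sum.cong) auto
      also have "\<dots> = of_bool (fst e \<in> cluster S A)"
        using fin in_C by (subst sum.delta') auto
      finally show ?thesis .
    qed
    then have "pr p (\<lambda>A. fst e \<in> cluster S A) =
        expct p (\<lambda>A. \<Sum>C\<in>{C \<in> \<C>. fst e \<in> C}. of_bool (cluster S A = C))"
      by simp
    also have "\<dots> = (\<Sum>C\<in>{C \<in> \<C>. fst e \<in> C}. pr p (\<lambda>A. cluster S A = C))"
      using fin by (intro expct_sum fdep_logic fd1) auto
    finally show "(\<Sum>C\<in>{C \<in> \<C>. fst e \<in> C}. pr p (\<lambda>A. cluster S A = C) * (p * theta p (m - n)))
        = pr p (\<lambda>A. fst e \<in> cluster S A) * (p * theta p (m - n))"
      by (simp add: sum_distrib_right)
  qed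
  also have "\<dots> = p * psi p n S * theta p (m - n)"
    by (simp add: psi_def sum_distrib_right sum_distrib_left mult_ac)
  finally show ?thesis .
qed

text \<open>If \<open>psi\<close> were at least 1 for all parameters in \<open>[p, q]\<close> and
  all \<open>S\<close> below level \<open>n\<close>, then \<open>theta q n\<close> would be at least
  \<open>1 - exp (- (q - p))\<close>; this fails for large \<open>n\<close>. Some \<open>s\<close>
  in \<open>[p, q]\<close> thus has a set \<open>S\<close> with \<open>psi s n S < 1\<close>, the
  renewal inequality is iterated at \<open>s\<close>, and monotonicity carries the decay down to
  \<open>p\<close>.\<close>

lemma theta_exponential_decay:
  assumes pq: "0 \<le> p" "p < q" "q < 1" and lim: "theta q \<longlonglongrightarrow> 0"
  obtains n \<phi> where "n > 0" "0 \<le> \<phi>" "\<phi> < 1" "\<And>k. theta p (k * n) \<le> \<phi> ^ k"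
proof -
  have "0 < 1 - exp (- (q - p))" using pq by simp
  with order_tendstoD(2)[OF lim this] obtain n where n: "theta q n < 1 - exp (- (q - p))"
    by (auto simp: eventually_sequentially)
  then obtain s S where s: "p \<le> s" "s \<le> q" and S: "0 \<in> S" "S \<subseteq> {v. fst v < int n}"
    and psi: "psi s n S < 1"
    using one_minus_theta_le[of p q n] pq by (smt (verit, best))
  have s01: "0 \<le> s" "s \<le> 1" using s pq by auto
  have psi0: "0 \<le> psi s n S"
    unfolding psi_def using fdep_comp[OF fdep_cluster[OF S(2,1)]] s01
    by (intro sum_nonneg expct_nonneg) auto
  define \<phi> where "\<phi> = s * psi s n S"
  have \<phi>: "0 \<le> \<phi>" "\<phi> < 1"
    using s01 psi psi0 mult_left_le_one_le[of "psi s n S" s] by (auto simp: \<phi>_def)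
  have "theta s (k * n) \<le> \<phi> ^ k" for k
  proof (induction k)
    case (Suc k)
    have "theta s (Suc k * n) \<le> \<phi> * theta s (Suc k * n - n)"
      unfolding \<phi>_def by (rule theta_renewal[OF s01 S]) simp
    also have "\<dots> \<le> \<phi> * \<phi> ^ k" using Suc \<phi> by (intro mult_left_mono) auto
    finally show ?case by simp
  qed (simp add: theta_def)
  moreover have "theta p m \<le> theta s m" for m by (rule theta_mono) (use s pq in auto)
  ultimately have "theta p (k * n) \<le> \<phi> ^ k" for k by (meson order_trans)
  moreover have "n > 0" using S by auto
  ultimately show ?thesis using that \<phi> by blast
qed

text \<open>The constant \<open>64 * (real L + 1)\<^sup>2\<close> is the square of the threshold
  \<open>t = 8 * (real L + 1)\<close> of \<open>value_lt_1\<close>; exponential decay beats this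
  polynomial.\<close>

lemma theta_small:
  assumes "0 \<le> p" "p < q" "q < 1" and "theta q \<longlonglongrightarrow> 0"
  obtains L :: nat where "L > 0" "64 * (real L + 1)\<^sup>2 * theta p L \<le> 1"
proof -
  obtain n \<phi> where n: "n > 0" and \<phi>: "0 \<le> \<phi>" "\<phi> < 1" and le: "\<And>k. theta p (k * n) \<le> \<phi> ^ k"
    by (rule theta_exponential_decay[OF assms]) blast
  \<comment> \<open>Writing \<open>\<phi> = x\<^sup>2\<close> turns the quadratic factor into the
    square of \<open>k * x ^ k\<close>, up to constants and a lower order term.\<close>
  define x where "x = sqrt \<phi>"
  have x: "0 \<le> x" "x < 1" "\<phi> = x\<^sup>2" using \<phi> by (auto simp: x_def)
  have "(\<lambda>k. 64 * (real n * (real k * x ^ k) + x ^ k)\<^sup>2) \<longlonglongrightarrow> 64 * (real n * 0 + 0)\<^sup>2"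
    using x by (intro tendsto_intros powser_times_n_limit_0 LIMSEQ_power_zero) auto
  then have "(\<lambda>k. 64 * (real (k * n) + 1)\<^sup>2 * \<phi> ^ k) \<longlonglongrightarrow> 0"
    by (simp add: x power2_eq_square algebra_simps power_mult_distrib)
  then have "\<forall>\<^sub>F k in sequentially. 64 * (real (k * n) + 1)\<^sup>2 * \<phi> ^ k < 1"
    by (rule order_tendstoD) simp
  then have "\<forall>\<^sub>F k in sequentially. 0 < k \<and> 64 * (real (k * n) + 1)\<^sup>2 * \<phi> ^ k < 1"
    using eventually_gt_at_top[of 0] by eventually_elim simp
  then obtain k where k: "0 < k" "64 * (real (k * n) + 1)\<^sup>2 * \<phi> ^ k < 1"
    by (auto simp: eventually_sequentially)
  have "64 * (real (k * n) + 1)\<^sup>2 * theta p (k * n) \<le> 64 * (real (k * n) + 1)\<^sup>2 * \<phi> ^ k"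
    using le by (intro mult_left_mono) auto
  then show ?thesis using that[of "k * n"] k n by auto
qed

text \<open>A sum over the sequences of sites that an upward path from \<open>u\<close> can visit at the heights divisible
  by \<open>L\<close> (relative to \<open>u\<close>); a sequence gets a factor \<open>1 + M\<close> for each block of \<open>L\<close> levels that can
  be crossed through open bonds. Its expectation factorizes over the blocks.\<close>

primrec block_weight :: "real \<Rightarrow> nat \<Rightarrow> nat \<Rightarrow> bond set \<Rightarrow> site \<Rightarrow> real" where
  "block_weight M L 0 A u = 1"
| "block_weight M L (Suc k) A u =
     (1 + M * of_bool (reach L A u)) * (\<Sum>d\<le>L. block_weight M L k A (u + (int L, int d)))"

lemma block_weight_nonneg: "0 \<le> M \<Longrightarrow> 0 \<le> block_weight M L k A u"
  by (induction k arbitrary: u) (auto intro!: mult_nonneg_nonneg sum_nonneg)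

lemma block_factor: "fdep (\<lambda>A. 1 + M * of_bool (reach L A u) :: real)"
  by (rule fdep_comp[of "\<lambda>A. reach L A u" "\<lambda>b. 1 + M * of_bool b"]) simp

lemma fdep_block_weight: "fdep (\<lambda>A. block_weight M L k A u)"
proof (induction k arbitrary: u)
  case (Suc k)
  then show ?case
    unfolding block_weight.simps by (intro fdep_comp2[of _ _ "(*)"] block_factor fdep_sum) auto
qed simp

lemma dep_block_weight: "dep {e. fst u \<le> fst (fst e)} (\<lambda>A. block_weight M L k A u)"
proof (induction k arbitrary: u)
  case (Suc k)
  have r: "dep {e. fst u \<le> fst (fst e)} (\<lambda>A. reach L A u)"
    by (rule dep_mono[OF dep_reach]) (auto simp: fwd_cone_def)
  have d: "dep {e. fst u \<le> fst (fst e)} (\<lambda>A. block_weight M L k A (u + (int L, int d)))" for d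
    by (rule dep_mono[OF Suc]) auto
  show ?case
    unfolding block_weight.simps
    by (intro dep_comp2[of _ _ _ "(*)"] dep_comp[OF r, of "\<lambda>b. 1 + M * of_bool b"] dep_sum d)
qed simp

text \<open>The factor \<open>L + 1\<close> counts the displacements possible over one block;
  successive blocks read bonds at disjoint heights.\<close>

lemma expct_block_weight:
  "expct p (\<lambda>A. block_weight M L k A u) = ((real L + 1) * (1 + M * theta p L)) ^ k"
proof (induction k arbitrary: u)
  case (Suc k)
  have r: "dep {e. fst (fst e) < fst u + int L} (\<lambda>A. reach L A u)"
    by (rule dep_mono[OF dep_reach]) (auto simp: fwd_cone_def)
  have s: "dep {e. fst u + int L \<le> fst (fst e)}
      (\<lambda>A. block_weight M L k A (u + (int L, int d)))" for d
    by (rule dep_mono[OF dep_block_weight]) auto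
  have "expct p (\<lambda>A. block_weight M L (Suc k) A u) =
      expct p (\<lambda>A. 1 + M * of_bool (reach L A u)) *
      expct p (\<lambda>A. \<Sum>d\<le>L. block_weight M L k A (u + (int L, int d)))"
    unfolding block_weight.simps
    by (rule expct_indep[OF block_factor _ dep_comp[OF r, of "\<lambda>b. 1 + M * of_bool b"] dep_sum[OF s]])
      (auto intro!: fdep_sum fdep_block_weight)
  also have "expct p (\<lambda>A. \<Sum>d\<le>L. block_weight M L k A (u + (int L, int d))) =
      (\<Sum>d\<le>L. ((real L + 1) * (1 + M * theta p L)) ^ k)"
    by (subst expct_sum) (auto simp: fdep_block_weight Suc)
  also have "expct p (\<lambda>A. 1 + M * of_bool (reach L A u)) = 1 + M * theta p L"
    using expct_add[of "\<lambda>_. 1" "\<lambda>A. M * of_bool (reach L A u)" p]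
      expct_cmult[of "\<lambda>A. of_bool (reach L A u)" p M] pr_reach[of p L u]
      fdep_comp[OF fdep_reach, of "\<lambda>b. M * of_bool b" L u] by (simp add: fdep_logic)
  finally show ?case by (simp add: mult_ac)
qed simp

lemma card_Collect_less_Suc:
  "card {j. j < Suc k \<and> P j} = of_bool (P 0) + card {j. j < k \<and> P (Suc j)}"
proof -
  have *: "{j. j < Suc k \<and> P j} = (if P 0 then {0} else {}) \<union> Suc ` {j. j < k \<and> P (Suc j)}"
    by (auto simp: image_iff less_Suc_eq_0_disj)
  show ?thesis unfolding * by (simp add: card_image card_insert_if)
qed

text \<open>The sequence \<open>us\<close> is one of the sequences summed over, and the discarded
  summands are nonnegative.\<close>

lemma block_weight_ge:
  assumes "0 \<le> M" and "\<And>j. \<exists>d\<le>L. us (Suc j) = us j + (int L, int d)"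
  shows "(1 + M) ^ card {j. j < k \<and> reach L A (us j)} \<le> block_weight M L k A (us 0)"
  using assms(2)
proof (induction k arbitrary: us)
  case (Suc k)
  obtain d where d: "d \<le> L" "us 1 = us 0 + (int L, int d)" using Suc.prems[of 0] by auto
  have "(1 + M) ^ card {j. j < k \<and> reach L A (us (Suc j))} \<le> block_weight M L k A (us 1)"
    using Suc.IH[of "\<lambda>j. us (Suc j)"] Suc.prems by simp
  also have "\<dots> \<le> (\<Sum>d\<le>L. block_weight M L k A (us 0 + (int L, int d)))"
    unfolding d(2) using d(1) assms(1)
    by (intro member_le_sum[of d "{..L}" "\<lambda>d. block_weight M L k A (us 0 + (int L, int d))"])
      (auto intro: block_weight_nonneg)
  finally have "(1 + M) ^ of_bool (reach L A (us 0)) *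
      (1 + M) ^ card {j. j < k \<and> reach L A (us (Suc j))} \<le>
      (1 + M * of_bool (reach L A (us 0))) * (\<Sum>d\<le>L. block_weight M L k A (us 0 + (int L, int d)))"
    using assms(1) by (intro mult_mono) (auto simp: of_bool_def)
  then show ?case by (simp only: card_Collect_less_Suc power_add block_weight.simps)
qed simp

section \<open>Infinite paths\<close>

text \<open>Two integer squares with sum 2 are both 1, so every edge is a diagonal step; the
  inequality between the heights selects its lower endpoint.\<close>

lemma edge_loc:
  assumes "v \<in> vertices" "w \<in> vertices" "{v, w} \<in> edges" "snd v \<le> snd w"
  obtains u b where "v = loc u" "w = loc (up b u)"
proof -
  from assms(3) obtain x y where xy: "{v, w} = {x, y}"
    "dist (plane_point x) (plane_point y) = sqrt 2" unfolding edges_def by blast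
  then have "dist (plane_point v) (plane_point w) = sqrt 2"
    by (auto simp: doubleton_eq_iff dist_commute)
  then have "real_of_int ((fst v - fst w)\<^sup>2 + (snd v - snd w)\<^sup>2) = 2"
    by (simp add: plane_point_def dist_prod_def dist_real_def)
  then have eq: "(fst v - fst w)\<^sup>2 + (snd v - snd w)\<^sup>2 = 2" by linarith
  have small: "\<bar>x\<bar> \<le> 1" if "x\<^sup>2 \<le> 2" for x :: int
  proof (rule ccontr)
    assume "\<not> \<bar>x\<bar> \<le> 1"
    then have "2\<^sup>2 \<le> \<bar>x\<bar>\<^sup>2" by (intro power_mono) auto
    then show False using that by simp
  qed
  have "\<bar>fst v - fst w\<bar> \<le> 1" "\<bar>snd v - snd w\<bar> \<le> 1"
    by (rule small; use eq zero_le_power2[of "fst v - fst w"] zero_le_power2[of "snd v - snd w"] in linarith)+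
  then have "(fst v - fst w)\<^sup>2 \<le> 1" "(snd v - snd w)\<^sup>2 \<le> 1"
    by (simp_all add: abs_square_le_1)
  then have "(fst v - fst w)\<^sup>2 = 1" "(snd v - snd w)\<^sup>2 = 1" using eq by linarith+
  then have "fst v - fst w = 1 \<or> fst v - fst w = - 1" "snd v - snd w = 1 \<or> snd v - snd w = - 1"
    by (simp_all add: power2_eq_1_iff)
  then have d: "snd w = snd v + 1" "fst w = fst v + 1 \<or> fst w = fst v - 1"
    using assms(4) by linarith+
  define u where "u = (snd v, (fst v + snd v) div 2)"
  have v: "v = loc u" unfolding u_def using vertices_loc[OF assms(1)] by simp
  have "w = loc (up (fst w = fst v + 1) u)"
    using d v by (cases w; cases v) (auto simp: loc_def up_def)
  then show ?thesis using that v by blast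
qed

lemma reach_of_path:
  assumes "\<And>i. f i \<in> vertices" "\<And>i. {f i, f (Suc i)} \<in> edges" "\<And>i. snd (f i) \<le> snd (f (Suc i))"
    and "\<And>i. \<omega> {f i, f (Suc i)}" and "f 0 = loc u"
  shows "reach n (opn \<omega>) u"
  using assms
proof (induction n arbitrary: f u)
  case (Suc n)
  obtain u' b where u': "f 0 = loc u'" "f (Suc 0) = loc (up b u')"
    using edge_loc[OF Suc.prems(1)[of 0] Suc.prems(1)[of "Suc 0"] Suc.prems(2)[of 0] Suc.prems(3)[of 0]]
    by blast
  then have u: "u' = u" using Suc.prems by simp
  have "reach n (opn \<omega>) (up b u)"
    by (rule Suc.IH[of "\<lambda>i. f (Suc i)"]) (use Suc.prems u' u in auto)
  moreover have "(u, b) \<in> opn \<omega>"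
    using Suc.prems(4)[of 0] u' u by (simp add: opn_def bond_edge_def)
  ultimately show ?case by auto
qed simp

text \<open>One half of the bi-infinite path is enough: the nonnegative half if the heights
  increase, the nonpositive half run backwards if they decrease.\<close>

lemma percolates_reach:
  assumes "percolates \<omega>"
  shows "\<exists>u. \<forall>n. reach n (opn \<omega>) u"
proof -
  obtain \<pi> where \<pi>: "\<And>i. \<pi> i \<in> vertices" "\<And>i. {\<pi> i, \<pi> (i + 1)} \<in> edges"
    "\<And>i. \<omega> {\<pi> i, \<pi> (i + 1)}" and "vertical \<pi>"
    using assms unfolding percolates_def infinite_path_def open_path_def cost_def
    by (auto split: if_splits)
  define u where "u = (snd (\<pi> 0), (fst (\<pi> 0) + snd (\<pi> 0)) div 2)"
  have u: "\<pi> 0 = loc u" unfolding u_def using vertices_loc[OF \<pi>(1)] by simp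
  from \<open>vertical \<pi>\<close> have "reach n (opn \<omega>) u" for n
    unfolding vertical_def
  proof
    assume m: "mono (\<lambda>i. snd (\<pi> i))"
    show ?thesis
      by (rule reach_of_path[of "\<lambda>i. \<pi> (int i)"])
        (use \<pi> u monoD[OF m] in \<open>auto simp: add.commute[of 1]\<close>)
  next
    assume m: "antimono (\<lambda>i. snd (\<pi> i))"
    have eq: "{\<pi> (- int i), \<pi> (- int (Suc i))} = {\<pi> (- int (Suc i)), \<pi> (- int (Suc i) + 1)}" for i
      by auto
    show ?thesis
      by (rule reach_of_path[of "\<lambda>i. \<pi> (- int i)"])
        (use \<pi> u antimonoD[OF m] in \<open>auto simp only: eq, auto\<close>)
  qed
  then show ?thesis by blast
qed

text \<open>Koenig's lemma for two branches: if each open continuation stopped at some length, a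
  path from \<open>u\<close> one step longer than the larger of the two lengths could not
  exist.\<close>

lemma reach_all_step:
  assumes "\<And>n. reach n A u"
  shows "\<exists>b. (u, b) \<in> A \<and> (\<forall>n. reach n A (up b u))"
proof (rule ccontr)
  assume "\<not> ?thesis"
  then have "\<forall>b. \<exists>n. (u, b) \<in> A \<longrightarrow> \<not> reach n A (up b u)" by blast
  then obtain m where m: "\<And>b. (u, b) \<in> A \<Longrightarrow> \<not> reach (m b) A (up b u)" by metis
  obtain b where b: "(u, b) \<in> A" "reach (max (m True) (m False)) A (up b u)"
    using assms[of "Suc (max (m True) (m False))"] by auto
  have "m b \<le> max (m True) (m False)" by (cases b) auto
  then show False using m[OF b(1)] reach_antimono[OF _ b(2)] by blast
qed

lemma reach_all_path:
  assumes "\<And>n. reach n A u"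
  obtains f b where "f 0 = u" "\<And>i. (f i, b i) \<in> A" "\<And>i. f (Suc i) = up (b i) (f i)"
proof -
  have "\<exists>f. f 0 = u \<and> (\<forall>i. (\<forall>n. reach n A (f i)) \<and> (\<exists>b. (f i, b) \<in> A \<and> f (Suc i) = up b (f i)))"
  proof -
    have "\<exists>f. \<forall>i. ((\<forall>n. reach n A (f i)) \<and> (i = 0 \<longrightarrow> f i = u)) \<and>
      (\<exists>b. (f i, b) \<in> A \<and> f (Suc i) = up b (f i))"
      by (rule dependent_nat_choice) (use assms reach_all_step in \<open>blast+\<close>)
    then show ?thesis by blast
  qed
  then show ?thesis using that by metis
qed

lemma percolates_if_reach:
  assumes up: "\<And>n. reach n (opn \<omega>) 0" and down: "\<And>n. dreach n (opn \<omega>) 0"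
  shows "percolates \<omega>"
proof -
  let ?A = "opn \<omega>"
  obtain f b where f: "f 0 = 0" "\<And>i. (f i, b i) \<in> ?A" "\<And>i. f (Suc i) = up (b i) (f i)"
    using reach_all_path[OF up] by metis
  \<comment> \<open>The infinite downward path is obtained as an upward path in the reflected
    configuration and reflected back as \<open>h\<close>.\<close>
  have "reach n (flip_bond ` ?A) 0" for n using down[of n] by (simp add: dreach_flip)
  then obtain g c where g: "g 0 = 0" "\<And>i. (g i, c i) \<in> flip_bond ` ?A" "\<And>i. g (Suc i) = up (c i) (g i)"
    using reach_all_path by metis
  define h where "h i = - g i" for i
  have h: "h 0 = 0" "\<And>i. (h (Suc i), c i) \<in> ?A" "\<And>i. h i = up (c i) (h (Suc i))"
  proof -
    show "h 0 = 0" by (simp add: h_def g)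
    have s: "h (Suc i) = dn (c i) (h i)" for i by (simp add: h_def g up_def dn_def)
    show "(h (Suc i), c i) \<in> ?A" for i
      using g(2)[of i] unfolding s flip_image[symmetric] by (simp add: h_def)
    show "h i = up (c i) (h (Suc i))" for i by (simp add: s)
  qed
  have lf: "fst (f i) = int i" for i by (induction i) (simp_all add: f)
  have lh: "fst (h i) = - int i" for i
  proof (induction i)
    case (Suc i)
    have "fst (h i) = fst (h (Suc i)) + 1" using h(3)[of i] by (metis fst_up)
    then show ?case using Suc by simp
  qed (simp add: h(1))
  define \<pi> where "\<pi> i = loc (if 0 \<le> i then f (nat i) else h (nat (- i)))" for i :: int
  have snd: "snd (\<pi> i) = i" for i by (simp add: \<pi>_def loc_def lf lh)
  have bond: "\<exists>e\<in>?A. {\<pi> i, \<pi> (i + 1)} = bond_edge e" for i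
  proof (cases "0 \<le> i")
    case True
    then have "{\<pi> i, \<pi> (i + 1)} = bond_edge (f (nat i), b (nat i))"
      using f(3)[of "nat i"] by (simp add: \<pi>_def bond_edge_def nat_add_distrib)
    then show ?thesis using f(2) by blast
  next
    case False
    define j where "j = nat (- i - 1)"
    have j: "nat (- i) = Suc j" using False by (simp add: j_def)
    \<comment> \<open>At \<open>i = - 1\<close> the next vertex is defined through \<open>f\<close>
      instead of \<open>h\<close>; the two halves agree there because both start at the
      origin.\<close>
    have "\<pi> (i + 1) = loc (h j)"
    proof (cases "i = - 1")
      case True
      then show ?thesis using j f(1) h(1) by (simp add: \<pi>_def)
    next
      case False
      then show ?thesis using \<open>\<not> 0 \<le> i\<close> by (simp add: \<pi>_def j_def)
    qed
    moreover have "\<pi> i = loc (h (Suc j))" using False j by (simp add: \<pi>_def)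
    ultimately have "{\<pi> i, \<pi> (i + 1)} = bond_edge (h (Suc j), c j)"
      using h(3)[of j] by (simp add: bond_edge_def)
    then show ?thesis using h(2) by blast
  qed
  have "infinite_path \<pi>"
    unfolding infinite_path_def
  proof (intro allI conjI)
    fix i
    show "\<pi> i \<in> vertices" by (simp add: \<pi>_def loc_in_vertices)
    show "{\<pi> i, \<pi> (i + 1)} \<in> edges" using bond[of i] bond_edge_in_edges by metis
  qed
  moreover have "vertical \<pi>" by (simp add: vertical_def snd mono_def)
  moreover have "open_path \<omega> \<pi>"
    unfolding open_path_def cost_def
  proof
    fix i
    show "(if \<omega> {\<pi> i, \<pi> (i + 1)} then 1 else 0) = (1 :: real)"
      using bond[of i] by (auto simp: opn_def)
  qed
  ultimately show ?thesis unfolding percolates_def by blast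
qed

lemma AE_not_percolates:
  assumes p: "0 \<le> p" "p \<le> 1" and lim: "theta p \<longlonglongrightarrow> 0"
  shows "AE \<omega> in percolation_law p. \<not> percolates \<omega>"
proof -
  let ?M = "percolation_law p"
  interpret prob_space ?M by (rule prob_space_percolation_law)
  have "AE \<omega> in ?M. \<not> (\<forall>n. reach n (opn \<omega>) u)" for u
  proof -
    define E where "E n = {\<omega> \<in> space ?M. reach n (opn \<omega>) u}" for n
    have E: "E n \<in> sets ?M" "measure ?M (E n) = theta p n" for n
      using percolation_law_fdep[OF p fdep_reach, of n u] unfolding E_def by (simp_all add: pr_reach)
    have I: "(\<Inter>n. E n) \<in> sets ?M" using E by (intro sets.countable_INT) auto
    have "measure ?M (\<Inter>n. E n) \<le> theta p n" for n
      unfolding E(2)[symmetric] by (rule finite_measure_mono) (use E in auto)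
    then have "measure ?M (\<Inter>n. E n) \<le> 0"
      using lim by (intro LIMSEQ_le_const[OF lim]) auto
    then have "measure ?M (\<Inter>n. E n) = 0" by (simp add: measure_le_0_iff)
    then have "AE \<omega> in ?M. \<omega> \<notin> (\<Inter>n. E n)" using I prob_eq_0 by blast
    then show ?thesis using AE_space by eventually_elim (auto simp: E_def)
  qed
  then have "AE \<omega> in ?M. \<forall>u. \<not> (\<forall>n. reach n (opn \<omega>) u)" by (simp add: AE_all_countable)
  then show ?thesis by eventually_elim (use percolates_reach in blast)
qed

text \<open>Open paths of length \<open>n\<close> above and below the origin use disjoint bonds, so
  both exist with probability \<open>(theta p n)\<^sup>2\<close>. These events decrease to one that
  forces a bi-infinite open path.\<close>

lemma theta_tendsto_0:
  assumes p: "0 \<le> p" "p \<le> 1" and AE: "AE \<omega> in percolation_law p. \<not> percolates \<omega>"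
  shows "theta p \<longlonglongrightarrow> 0"
proof -
  let ?M = "percolation_law p"
  interpret prob_space ?M by (rule prob_space_percolation_law)
  define E where "E n = {\<omega> \<in> space ?M. reach n (opn \<omega>) 0 \<and> dreach n (opn \<omega>) 0}" for n
  have "pr p (\<lambda>A. reach n A 0 \<and> dreach n A 0) = pr p (\<lambda>A. reach n A 0) * pr p (\<lambda>A. dreach n A 0)" for n
    by (rule pr_indep[OF _ _ dep_reach dep_dreach]) (auto simp: fwd_cone_def)
  then have E: "E n \<in> sets ?M" "measure ?M (E n) = (theta p n)\<^sup>2" for n
    using percolation_law_fdep[OF p fdep_logic(2)[OF fdep_reach fdep_dreach], of n 0 n 0]
    unfolding E_def by (simp_all add: pr_reach pr_dreach power2_eq_square)
  have dec: "decseq E"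
    unfolding E_def decseq_def by (auto intro: reach_antimono dreach_antimono)
  have "(\<lambda>n. measure ?M (E n)) \<longlonglongrightarrow> measure ?M (\<Inter>n. E n)"
    using E dec by (intro finite_Lim_measure_decseq) auto
  moreover have "measure ?M (\<Inter>n. E n) = 0"
  proof -
    have "AE \<omega> in ?M. \<omega> \<notin> (\<Inter>n. E n)"
      using AE by eventually_elim (auto simp: E_def intro: percolates_if_reach)
    moreover have "(\<Inter>n. E n) \<in> sets ?M" using E by (intro sets.countable_INT) auto
    ultimately show ?thesis using prob_eq_0 by blast
  qed
  ultimately have "(\<lambda>n. sqrt ((theta p n)\<^sup>2)) \<longlonglongrightarrow> sqrt 0"
    unfolding E(2) by (intro tendsto_real_sqrt) simp
  then show ?thesis using theta_nonneg[OF p] by simp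
qed

section \<open>The subcritical game\<close>

definition pos :: "vertex \<Rightarrow> strategy1 \<Rightarrow> strategy2 \<Rightarrow> nat \<Rightarrow> vertex" where
  "pos z \<sigma> \<tau> n = fst (play z \<sigma> \<tau> n)"

definition hist :: "vertex \<Rightarrow> strategy1 \<Rightarrow> strategy2 \<Rightarrow> nat \<Rightarrow> edge list" where
  "hist z \<sigma> \<tau> n = snd (play z \<sigma> \<tau> n)"

lemma pos_0 [simp]: "pos z \<sigma> \<tau> 0 = z" and hist_0 [simp]: "hist z \<sigma> \<tau> 0 = []"
  by (simp_all add: pos_def hist_def)

lemma pos_Suc: "pos z \<sigma> \<tau> (Suc n) =
    move (pos z \<sigma> \<tau> n) (\<sigma> (hist z \<sigma> \<tau> n)) (response (\<tau> (hist z \<sigma> \<tau> n)) (\<sigma> (hist z \<sigma> \<tau> n)))"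
  by (simp add: pos_def hist_def Let_def case_prod_beta)

lemma hist_Suc: "hist z \<sigma> \<tau> (Suc n) = hist z \<sigma> \<tau> n @ [{pos z \<sigma> \<tau> n, pos z \<sigma> \<tau> (Suc n)}]"
  by (simp add: pos_def hist_def Let_def case_prod_beta)

lemma length_hist [simp]: "length (hist z \<sigma> \<tau> n) = n"
  by (induction n) (simp_all add: hist_Suc)

lemma crossed_edge_Suc: "crossed_edge z \<sigma> \<tau> (Suc n) = {pos z \<sigma> \<tau> n, pos z \<sigma> \<tau> (Suc n)}"
  unfolding crossed_edge_def hist_def[symmetric] by (simp add: hist_Suc)

lemma total_cost_pos: "total_cost \<omega> z \<sigma> \<tau> =
    limsup (\<lambda>n. ereal (1 / real n * (\<Sum>m<n. cost \<omega> {pos z \<sigma> \<tau> m, pos z \<sigma> \<tau> (Suc m)})))"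
  by (simp add: total_cost_def sum.atLeast1_atMost_eq crossed_edge_Suc)

lemma move_loc:
  "move (loc u) Top r = loc (up (r = Right) u)" "move (loc u) Bottom r = loc (dn (r = Left) u)"
  by (cases r; simp add: move_def loc_def up_def dn_def)+

lemma cost_bond_edge: "cost \<omega> (bond_edge e) = of_bool (e \<in> opn \<omega>)"
  by (simp add: cost_def opn_def)

lemma cost_le_1: "cost \<omega> e \<le> 1" and cost_nonneg: "0 \<le> cost \<omega> e"
  by (simp_all add: cost_def)

lemma reach_of_open_steps:
  assumes "\<And>i. us (Suc i) = up (bs i) (us i)" and "\<And>i. i < n \<Longrightarrow> (us (s + i), bs (s + i)) \<in> A"
  shows "reach n A (us s)"
  using assms(2)
proof (induction n arbitrary: s)
  case (Suc n)
  have "reach n A (us (Suc s))"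
    by (rule Suc.IH) (use Suc.prems[of "Suc _"] in simp)
  then show ?case using Suc.prems[of 0] assms(1)[of s] by auto
qed simp

lemma up_steps:
  assumes "\<And>i. us (Suc i) = up (bs i) (us i)"
  shows "\<exists>d\<le>n. us (s + n) = us s + (int n, int d)"
proof (induction n)
  case (Suc n)
  then obtain d where d: "d \<le> n" "us (s + n) = us s + (int n, int d)" by blast
  then have "us (s + Suc n) = us s + (int (Suc n), int (d + of_bool (bs (s + n))))"
    by (simp add: assms up_def add_ac)
  then show ?case using d(1) by (intro exI[of _ "d + of_bool (bs (s + n))"]) auto
qed (simp add: zero_prod_def[symmetric])

text \<open>A block that cannot be crossed costs the path at least one closed bond. As
  \<open>1 + M = t\<^sup>2\<close>, having \<open>B\<close> crossable blocks among \<open>k\<close>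
  gives a weight at least \<open>t ^ (2 * B)\<close>; the bound \<open>t ^ k\<close> then forces
  \<open>2 * B < k\<close>, so at least half of the blocks contain a closed bond.\<close>

lemma open_steps_le:
  assumes us: "\<And>i. us (Suc i) = up (bs i) (us i)" and L: "L > 0" and M: "M = t\<^sup>2 - 1" "1 < t"
    and good: "\<And>k. 0 < k \<Longrightarrow> block_weight M L k A (us 0) < t ^ k"
  shows "(\<Sum>m<n. of_bool ((us m, bs m) \<in> A)) \<le> real n - (real n / real L - 1) / 2"
proof -
  let ?c = "\<lambda>m. of_bool ((us m, bs m) \<in> A) :: real"
  let ?r = "\<lambda>j. reach L A (us (j * L))"
  have block: "(\<Sum>m<k * L. ?c m) \<le> real (k * L) - real (card {j. j < k \<and> \<not> ?r j})" for k
  proof (induction k)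
    case (Suc k)
    have "(\<Sum>m<Suc k * L. ?c m) = (\<Sum>m<k * L. ?c m) + (\<Sum>i<L. ?c (k * L + i))"
      using sum.nat_group[of ?c L "Suc k"] sum.nat_group[of ?c L k]
        sum.shift_bounds_nat_ivl[of ?c 0 "k * L" L]
      by (simp add: add.commute lessThan_atLeast0)
    also have "(\<Sum>i<L. ?c (k * L + i)) \<le> real L - of_bool (\<not> ?r k)"
    proof (cases "?r k")
      case True
      then show ?thesis using sum_bounded_above[of "{..<L}" "\<lambda>i. ?c (k * L + i)" 1] by simp
    next
      case False
      then obtain i where i: "i < L" "(us (k * L + i), bs (k * L + i)) \<notin> A"
        using reach_of_open_steps[where us = us and bs = bs, OF us] by blast
      have "(\<Sum>i<L. ?c (k * L + i)) = ?c (k * L + i) + (\<Sum>j\<in>{..<L} - {i}. ?c (k * L + j))"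
        using i by (intro sum.remove) auto
      also have "\<dots> = (\<Sum>j\<in>{..<L} - {i}. ?c (k * L + j))" using i(2) by (simp only: of_bool_eq(1) simp_thms add_0)
      also have "\<dots> \<le> real (card ({..<L} - {i})) * 1"
        by (intro sum_bounded_above) auto
      finally show ?thesis using False i by simp
    qed
    also have "card {j. j < Suc k \<and> \<not> ?r j} = card {j. j < k \<and> \<not> ?r j} + of_bool (\<not> ?r k)"
    proof -
      have *: "{j. j < Suc k \<and> \<not> ?r j} = {j. j < k \<and> \<not> ?r j} \<union> (if ?r k then {} else {k})"
        by (auto simp: less_Suc_eq)
      show ?thesis unfolding * by (simp add: card_insert_if)
    qed
    ultimately show ?case using Suc by simp
  qed simp
  have half: "real k / 2 \<le> real (card {j. j < k \<and> \<not> ?r j})" for k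
  proof (cases "k = 0")
    case False
    let ?B = "card {j. j < k \<and> ?r j}"
    have "(1 + M) ^ ?B \<le> block_weight M L k A (us (0 * L))"
    proof (rule block_weight_ge)
      show "0 \<le> M" using M one_le_power[of t 2] by simp
      show "\<exists>d\<le>L. us (Suc j * L) = us (j * L) + (int L, int d)" for j
        using up_steps[where us = us and bs = bs and s = "j * L" and n = L, OF us]
        by (simp add: add.commute)
    qed
    also have "\<dots> < t ^ k" using good False by simp
    finally have "t ^ (2 * ?B) < t ^ k" using M by (simp add: power_mult)
    then have "2 * ?B < k" using M by simp
    moreover have "card ({j. j < k \<and> ?r j} \<union> {j. j < k \<and> \<not> ?r j}) = ?B + card {j. j < k \<and> \<not> ?r j}"
      by (rule card_Un_disjoint) auto
    moreover have "{j. j < k \<and> ?r j} \<union> {j. j < k \<and> \<not> ?r j} = {..<k}" by auto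
    ultimately show ?thesis by simp
  qed simp
  \<comment> \<open>All steps of the incomplete last block are counted as open; this is the source
    of the \<open>- 1\<close> in the bound.\<close>
  define k where "k = n div L"
  have kL: "k * L \<le> n" by (simp add: k_def)
  have "(\<Sum>m<n. ?c m) = (\<Sum>m<k * L. ?c m) + (\<Sum>m\<in>{k * L..<n}. ?c m)"
    using sum.atLeastLessThan_concat[of 0 "k * L" n ?c] kL by (simp only: lessThan_atLeast0)
  also have "(\<Sum>m\<in>{k * L..<n}. ?c m) \<le> real (card {k * L..<n}) * 1"
    by (intro sum_bounded_above) auto
  finally have le: "(\<Sum>m<n. ?c m) \<le> real n - real k / 2"
    using block[of k] half[of k] kL by simp
  have k: "real n / real L - 1 \<le> real k"
  proof -
    have "n < (k + 1) * L" using L by (simp add: k_def dividend_less_div_times)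
    then have "real n < real ((k + 1) * L)" by (simp only: of_nat_less_iff)
    then show ?thesis using L by (simp add: field_simps)
  qed
  have "real n - real k / 2 \<le> real n - (real n / real L - 1) / 2"
    using k by (intro diff_left_mono divide_right_mono) auto
  with le show ?thesis by (rule order_trans)
qed

lemma total_cost_Top_le:
  assumes "L > 0" "M = t\<^sup>2 - 1" "1 < t"
    and good: "\<And>k. 0 < k \<Longrightarrow> block_weight M L k (opn \<omega>) 0 < t ^ k"
  shows "total_cost \<omega> (loc 0) (\<lambda>_. Top) \<tau> \<le> ereal (1 - 1 / (2 * real L))"
proof -
  let ?h = "hist (loc 0) (\<lambda>_. Top) \<tau>" and ?z = "pos (loc 0) (\<lambda>_. Top) \<tau>"
  define bs where "bs i \<longleftrightarrow> fst (\<tau> (?h i)) = Right" for i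
  define us where "us = rec_nat 0 (\<lambda>i. up (bs i))"
  have us: "us 0 = 0" "us (Suc i) = up (bs i) (us i)" for i by (simp_all add: us_def)
  have z: "?z i = loc (us i)" for i
    by (induction i) (simp_all add: us pos_Suc response_def move_loc bs_def)
  have "cost \<omega> {?z m, ?z (Suc m)} = of_bool ((us m, bs m) \<in> opn \<omega>)" for m
    using cost_bond_edge[of \<omega> "(us m, bs m)"] by (simp add: z us bond_edge_def)
  then have le: "(\<Sum>m<n. cost \<omega> {?z m, ?z (Suc m)}) \<le> real n - (real n / real L - 1) / 2" for n
    using open_steps_le[where us = us and bs = bs, OF us(2) assms(1,2,3)] good us(1) by simp
  have "1 / real n * (\<Sum>m<n. cost \<omega> {?z m, ?z (Suc m)}) \<le> 1 - 1 / (2 * real L) + 1 / 2 * (1 / real n)"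
    if "n > 0" for n
    using mult_left_mono[OF le[of n], of "1 / real n"] that assms(1) by (simp add: field_simps)
  then have "total_cost \<omega> (loc 0) (\<lambda>_. Top) \<tau>
      \<le> limsup (\<lambda>n. ereal (1 - 1 / (2 * real L) + 1 / 2 * (1 / real n)))"
    unfolding total_cost_pos
    by (intro Limsup_mono eventually_mono[OF eventually_gt_at_top[of 0]]) simp
  also have "\<dots> = ereal (1 - 1 / (2 * real L) + 1 / 2 * 0)"
    by (intro lim_imp_Limsup tendsto_intros lim_1_over_n) simp
  finally show ?thesis by simp
qed

text \<open>The bad events are only shown to have total probability at most \<open>1/3\<close>. A
  single realization that avoids them and has value \<open>v\<close> is enough, because
  \<open>v\<close> does not depend on the realization.\<close>

lemma value_lt_1:
  assumes pq: "0 \<le> p" "p < q" "q < 1" and lim: "theta q \<longlonglongrightarrow> 0" and v: "is_as_value p v"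
  shows "v < 1"
proof -
  let ?M = "percolation_law p"
  interpret prob_space ?M by (rule prob_space_percolation_law)
  have p: "0 \<le> p" "p \<le> 1" using pq by auto
  obtain L :: nat where L: "L > 0" "64 * (real L + 1)\<^sup>2 * theta p L \<le> 1"
    by (rule theta_small[OF pq lim])
  \<comment> \<open>With this choice \<open>t\<^sup>2 * theta p L \<le> 1\<close>, so the expected
    weight per block is at most \<open>2 * (real L + 1) = t / 4\<close>, and Markov's inequality
    gives a geometric series of ratio \<open>1/4\<close> whose sum is less than 1.\<close>
  define t where "t = 8 * (real L + 1)"
  define M where "M = t\<^sup>2 - 1"
  have t: "1 < t" by (simp add: t_def)
  have M: "0 \<le> M" using t one_le_power[of t 2] by (simp add: M_def)
  \<comment> \<open>Zero blocks are excluded: there weight and threshold are both 1 and the event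
    would be certain.\<close>
  define Bad where "Bad k = {\<omega> \<in> space ?M. t ^ Suc k \<le> block_weight M L (Suc k) (opn \<omega>) 0}" for k
  have fd: "fdep (\<lambda>A. t ^ Suc k \<le> block_weight M L (Suc k) A 0)" for k
    by (rule fdep_comp[OF fdep_block_weight])
  have Bad: "Bad k \<in> sets ?M" "measure ?M (Bad k) \<le> (1 / 4) ^ Suc k" for k
  proof -
    show "Bad k \<in> sets ?M" unfolding Bad_def by (rule sets_percolation_law[OF p fd])
    have "measure ?M (Bad k) = pr p (\<lambda>A. t ^ Suc k \<le> block_weight M L (Suc k) A 0)"
      unfolding Bad_def by (rule measure_percolation_law[OF p fd])
    also have "\<dots> \<le> expct p (\<lambda>A. block_weight M L (Suc k) A 0) / t ^ Suc k"
      using t by (intro pr_markov p fdep_block_weight block_weight_nonneg M) simp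
    also have "\<dots> = ((real L + 1) * (1 + M * theta p L) / t) ^ Suc k"
      by (simp only: expct_block_weight power_divide)
    also have "\<dots> \<le> (1 / 4) ^ Suc k"
    proof (rule power_mono)
      have "M * theta p L \<le> t\<^sup>2 * theta p L"
        using theta_nonneg[OF p] by (intro mult_right_mono) (auto simp: M_def)
      also have "\<dots> \<le> 1" using L(2) unfolding t_def power_mult_distrib by simp
      finally have "(real L + 1) * (1 + M * theta p L) \<le> (real L + 1) * 2"
        by (intro mult_left_mono) auto
      then show "(real L + 1) * (1 + M * theta p L) / t \<le> 1 / 4"
        by (simp add: t_def field_simps)
      show "0 \<le> (real L + 1) * (1 + M * theta p L) / t"
        using M t theta_nonneg[OF p] by simp
    qed
    finally show "measure ?M (Bad k) \<le> (1 / 4) ^ Suc k" .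
  qed
  have sums: "(\<lambda>k. (1 / 4) ^ Suc k) sums (1 / 3 :: real)"
    using geometric_sums[of "1 / 4 :: real"] sums_mult[of _ _ "1 / 4 :: real"] by fastforce
  have smb: "summable (\<lambda>k. measure ?M (Bad k))"
    by (rule summable_comparison_test'[OF sums_summable[OF sums], of 0]) (use Bad in auto)
  have "measure ?M (\<Union>k. Bad k) \<le> (\<Sum>k. measure ?M (Bad k))"
    using Bad by (intro finite_measure_subadditive_countably smb) auto
  also have "\<dots> \<le> (\<Sum>k. (1 / 4) ^ Suc k)"
    by (intro suminf_le Bad smb sums_summable[OF sums])
  also have "\<dots> = 1 / 3" using sums by (rule sums_unique[symmetric])
  finally have lt: "measure ?M (\<Union>k. Bad k) < 1" by simp
  have "\<exists>\<omega>\<in>space ?M. \<omega> \<notin> (\<Union>k. Bad k) \<and> (\<forall>z\<in>vertices. has_value \<omega> z v)"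
  proof (rule ccontr)
    assume n: "\<not> ?thesis"
    have "AE \<omega> in ?M. \<omega> \<in> (\<Union>k. Bad k)"
      using v[unfolded is_as_value_def] AE_space by eventually_elim (use n in blast)
    then have "measure ?M (\<Union>k. Bad k) = 1"
      using Bad by (subst prob_eq_1) auto
    then show False using lt by simp
  qed
  then obtain \<omega> where \<omega>: "\<omega> \<in> space ?M" "\<And>k. \<omega> \<notin> Bad k" "\<And>z. z \<in> vertices \<Longrightarrow> has_value \<omega> z v"
    by auto
  have good: "block_weight M L k (opn \<omega>) 0 < t ^ k" if "0 < k" for k
    using \<omega>(1) \<omega>(2)[of "k - 1"] that by (auto simp: Bad_def not_le)
  have "ereal v = (INF \<sigma>. SUP \<tau>. total_cost \<omega> (loc 0) \<sigma> \<tau>)"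
    using \<omega>(3)[OF loc_in_vertices, of 0] by (simp add: has_value_def)
  also have "\<dots> \<le> (SUP \<tau>. total_cost \<omega> (loc 0) (\<lambda>_. Top) \<tau>)" by (rule INF_lower) simp
  also have "\<dots> \<le> ereal (1 - 1 / (2 * real L))"
    by (intro SUP_least total_cost_Top_le[OF L(1) M_def t good])
  finally have "v \<le> 1 - 1 / (2 * real L)" by simp
  also have "\<dots> < 1" using L(1) by simp
  finally show ?thesis .
qed

section \<open>Crossing probabilities\<close>

text \<open>Only the start is confined to a window of \<open>w\<close> sites. Lateral confinement
  can be dispensed with, since after \<open>r * w\<close> upward steps the path is in one of
  \<open>r + 1\<close> translated windows (\<open>window\<close>).\<close>

definition wreach :: "nat \<Rightarrow> nat \<Rightarrow> bond set \<Rightarrow> site \<Rightarrow> bool" where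
  "wreach w n A u \<longleftrightarrow> (\<exists>j\<in>{0..<int w}. reach n A (u + (0, j)))"

definition bireach :: "nat \<Rightarrow> nat \<Rightarrow> bond set \<Rightarrow> site \<Rightarrow> bool" where
  "bireach w n A u \<longleftrightarrow> (\<exists>j\<in>{0..<int w}. reach n A (u + (0, j)) \<and> dreach n A (u + (0, j)))"

lemma fdep_wreach: "fdep (\<lambda>A. wreach w n A u)"
  unfolding wreach_def by (intro fdep_Bex) auto

lemma fdep_bireach: "fdep (\<lambda>A. bireach w n A u)"
  unfolding bireach_def by (intro fdep_Bex fdep_logic) auto

lemma wreach_shift: "wreach w n (shift_bond d ` A) (u + d) \<longleftrightarrow> wreach w n A u"
proof -
  have "u + d + (0, j) = u + (0, j) + d" for j by (simp add: add_ac)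
  then show ?thesis by (simp only: wreach_def reach_shift)
qed

lemma bireach_shift: "bireach w n (shift_bond d ` A) (u + d) \<longleftrightarrow> bireach w n A u"
proof -
  have "u + d + (0, j) = u + (0, j) + d" for j by (simp add: add_ac)
  then show ?thesis by (simp only: bireach_def reach_shift dreach_shift)
qed

lemma pr_wreach: "pr p (\<lambda>A. wreach w n A u) = pr p (\<lambda>A. wreach w n A 0)"
  using pr_shift[OF fdep_wreach, of p w n u "0 + u"] unfolding wreach_shift by simp

lemma pr_bireach: "pr p (\<lambda>A. bireach w n A u) = pr p (\<lambda>A. bireach w n A v)"
  using pr_shift[OF fdep_bireach, of p w n u "0 + u"] pr_shift[OF fdep_bireach, of p w n v "0 + v"]
  unfolding bireach_shift by simp

lemma window:
  assumes "0 < w" "0 \<le> x" "x < int w + int (r * w)"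
  shows "\<exists>i\<in>{0..r}. \<exists>j\<in>{0..<int w}. x = int (i * w) + j"
proof (intro bexI)
  define y where "y = nat x"
  have "y < (r + 1) * w" using assms unfolding y_def by (simp add: nat_less_iff)
  then have "y div w < r + 1" by (rule less_mult_imp_div_less)
  then show "y div w \<in> {0..r}" by simp
  show "x = int (y div w * w) + int (y mod w)"
    using assms(2) by (simp only: of_nat_add[symmetric] div_mult_mod_eq) (simp add: y_def)
  show "int (y mod w) \<in> {0..<int w}" using assms(1) by simp
qed

lemma wreach_split:
  assumes "0 < w" "wreach w (r * w + m) A 0"
  shows "wreach w (r * w) A 0 \<and> (\<exists>i\<in>{0..r}. wreach w m A (int (r * w), int (i * w)))"
    and "\<exists>i\<in>{0..r}. \<exists>j\<in>{0..<int w}. reach m A (int (r * w), int (i * w) + j)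
           \<and> dreach (r * w) A (int (r * w), int (i * w) + j)"
proof -
  obtain j where j: "j \<in> {0..<int w}" "reach (r * w + m) A (0 + (0, j))"
    using assms(2) by (auto simp: wreach_def)
  from reach_add[OF j(2)] obtain d where d: "reach (r * w) A (0 + (0, j))" "d \<in> {0..int (r * w)}"
    "reach m A (0 + (0, j) + (int (r * w), d))" "dreach (r * w) A (0 + (0, j) + (int (r * w), d))"
    by blast
  obtain i j' where i: "i \<in> {0..r}" "j' \<in> {0..<int w}" "j + d = int (i * w) + j'"
    using window[OF assms(1), of "j + d" r] j(1) d(2) by auto
  have eq: "0 + (0, j) + (int (r * w), d) = (int (r * w), int (i * w) + j')"
    using i(3) by simp
  show "\<exists>i\<in>{0..r}. \<exists>j\<in>{0..<int w}. reach m A (int (r * w), int (i * w) + j)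
           \<and> dreach (r * w) A (int (r * w), int (i * w) + j)"
    using i(1,2) d(3,4) unfolding eq by blast
  have "wreach w m A (int (r * w), int (i * w))"
    unfolding wreach_def using i(2) d(3) unfolding eq by auto
  moreover have "wreach w (r * w) A 0" unfolding wreach_def using j(1) d(1) by blast
  ultimately show "wreach w (r * w) A 0 \<and> (\<exists>i\<in>{0..r}. wreach w m A (int (r * w), int (i * w)))"
    using i(1) by blast
qed

text \<open>Submultiplicativity up to the number \<open>r + 1\<close> of windows at height
  \<open>r * w\<close>: the bonds below and above that height are independent.\<close>

lemma pr_wreach_add:
  assumes p: "0 \<le> p" "p \<le> 1" and w: "0 < w"
  shows "pr p (\<lambda>A. wreach w (r * w + m) A 0) \<le>
    (real r + 1) * pr p (\<lambda>A. wreach w (r * w) A 0) * pr p (\<lambda>A. wreach w m A 0)"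
proof -
  let ?n = "r * w"
  let ?Q = "\<lambda>A. \<exists>i\<in>{0..r}. wreach w m A (int ?n, int (i * w))"
  have fQ: "fdep ?Q" by (intro fdep_Bex fdep_wreach) simp
  have d1: "dep {e. fst (fst e) < int ?n} (\<lambda>A. wreach w ?n A 0)"
    unfolding wreach_def by (intro dep_Bex dep_mono[OF dep_reach]) (auto simp: fwd_cone_def)
  have d2: "dep {e. int ?n \<le> fst (fst e)} ?Q"
    unfolding wreach_def by (intro dep_Bex dep_mono[OF dep_reach]) (auto simp: fwd_cone_def)
  have "pr p (\<lambda>A. wreach w (?n + m) A 0) \<le> pr p (\<lambda>A. wreach w ?n A 0 \<and> ?Q A)"
    by (intro pr_mono p fdep_logic fdep_wreach fQ) (rule wreach_split(1)[OF w])
  also have "\<dots> = pr p (\<lambda>A. wreach w ?n A 0) * pr p ?Q"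
    by (rule pr_indep[OF fdep_wreach fQ d1 d2]) auto
  also have "\<dots> \<le> pr p (\<lambda>A. wreach w ?n A 0) * ((real r + 1) * pr p (\<lambda>A. wreach w m A 0))"
  proof (rule mult_left_mono)
    have "pr p ?Q \<le> (\<Sum>i\<in>{0..r}. pr p (\<lambda>A. wreach w m A (int ?n, int (i * w))))"
      by (intro pr_Bex_le p fdep_wreach) simp
    also have "\<dots> = (real r + 1) * pr p (\<lambda>A. wreach w m A 0)"
      by (subst pr_wreach) simp
    finally show "pr p ?Q \<le> (real r + 1) * pr p (\<lambda>A. wreach w m A 0)" .
  qed (intro expct_nonneg p fdep_logic fdep_wreach, simp)
  finally show ?thesis by (simp only: mult_ac)
qed

lemma pr_wreach_mult:
  assumes p: "0 \<le> p" "p \<le> 1" and w: "0 < w"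
  shows "pr p (\<lambda>A. wreach w (k * (r * w)) A 0)
    \<le> ((real r + 1) * pr p (\<lambda>A. wreach w (r * w) A 0)) ^ k"
proof (induction k)
  case 0
  have "wreach w 0 A 0" for A using w unfolding wreach_def by (intro bexI[of _ 0]) auto
  then show ?case by simp
next
  case (Suc k)
  have "pr p (\<lambda>A. wreach w (Suc k * (r * w)) A 0) \<le>
    (real r + 1) * pr p (\<lambda>A. wreach w (r * w) A 0) * pr p (\<lambda>A. wreach w (k * (r * w)) A 0)"
    using pr_wreach_add[OF p w, of r "k * (r * w)"] by simp
  also have "\<dots> \<le> (real r + 1) * pr p (\<lambda>A. wreach w (r * w) A 0) *
      ((real r + 1) * pr p (\<lambda>A. wreach w (r * w) A 0)) ^ k"
    using expct_nonneg[OF p fdep_logic(4)[OF fdep_wreach]] by (intro mult_left_mono Suc) auto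
  finally show ?case by simp
qed

text \<open>A finite-size criterion: the condition involves finitely many bonds, is strict, and
  concerns a single scale \<open>w\<close>. It is therefore stable under small changes of
  \<open>p\<close>.\<close>

lemma theta_tendsto_0_if_wreach_small:
  assumes p: "0 \<le> p" "p \<le> 1" and w: "0 < w"
    and lt: "(real r + 1) * pr p (\<lambda>A. wreach w (r * w) A 0) < 1"
  shows "theta p \<longlonglongrightarrow> 0"
proof (rule LIMSEQ_I)
  let ?x = "(real r + 1) * pr p (\<lambda>A. wreach w (r * w) A 0)"
  fix e :: real assume "0 < e"
  have x: "0 \<le> ?x" using expct_nonneg[OF p fdep_logic(4)[OF fdep_wreach]] by auto
  obtain k where k: "?x ^ k < e" using real_arch_pow_inv[OF \<open>0 < e\<close> lt] by blast
  have "norm (theta p n - 0) < e" if "k * (r * w) \<le> n" for n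
  proof -
    have "theta p n \<le> theta p (k * (r * w))" by (rule theta_antimono[OF p that])
    also have "\<dots> \<le> pr p (\<lambda>A. wreach w (k * (r * w)) A 0)"
      unfolding theta_def
    proof (intro pr_mono p fdep_wreach fdep_reach)
      fix A assume "reach (k * (r * w)) A 0"
      then show "wreach w (k * (r * w)) A 0"
        unfolding wreach_def using w by (intro bexI[of _ 0]) (auto simp: zero_prod_def)
    qed
    also have "\<dots> \<le> ?x ^ k" by (rule pr_wreach_mult[OF p w])
    finally show ?thesis using k theta_nonneg[OF p, of n] by simp
  qed
  then show "\<exists>N. \<forall>n\<ge>N. norm (theta p n - 0) < e" by blast
qed

text \<open>The opposite inequality would be strict, hence hold at some \<open>q > p\<close> by continuity, and it forces the
  connection probabilities to decay at \<open>q\<close>.\<close>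

lemma crossing_lower_bound:
  assumes crit: "is_critical_parameter p\<^sub>c" and p: "p\<^sub>c \<le> p" "p < 1" and w: "0 < w"
  shows "1 \<le> (real r + 1) * pr p (\<lambda>A. wreach w (r * w) A 0)"
proof (rule ccontr)
  assume neg: "\<not> ?thesis"
  let ?F = "\<lambda>p. (real r + 1) * pr p (\<lambda>A. wreach w (r * w) A 0)"
  obtain J where J: "finite J" "dep J (\<lambda>A. of_bool (wreach w (r * w) A 0) :: real)"
    using fdep_logic(4)[OF fdep_wreach] unfolding fdep_def by blast
  have "continuous_on UNIV ?F"
    unfolding expct_eq[OF J] by (intro continuous_intros continuous_bexp)
  then have "isCont ?F p" by (rule continuous_on_interior) simp
  then have "(?F \<longlongrightarrow> ?F p) (at_right p)"
    unfolding isCont_def filterlim_at_split by (rule conjunct2)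
  then have "\<forall>\<^sub>F q in at_right p. ?F q < 1"
    by (rule order_tendstoD) (use neg in simp)
  moreover have "\<forall>\<^sub>F q in at_right p. q < 1" "\<forall>\<^sub>F q in at_right p. p < q"
    using p by (auto simp: eventually_at_right_less intro: eventually_at_right_field[THEN iffD2])
  ultimately have "\<forall>\<^sub>F q in at_right p. ?F q < 1 \<and> q < 1 \<and> p < q" by eventually_elim simp
  then obtain q where q: "?F q < 1" "q < 1" "p < q"
    using eventually_happens by fastforce
  have q01: "0 \<le> q" "q \<le> 1" "p\<^sub>c < q" using q p crit by (auto simp: is_critical_parameter_def)
  interpret prob_space "percolation_law q" by (rule prob_space_percolation_law)
  have "AE \<omega> in percolation_law q. \<not> percolates \<omega>"
    by (rule AE_not_percolates[OF q01(1,2) theta_tendsto_0_if_wreach_small[OF q01(1,2) w q(1)]])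
  moreover have "AE \<omega> in percolation_law q. percolates \<omega>"
    using crit q01 by (auto simp: is_critical_parameter_def)
  ultimately have "AE \<omega> in percolation_law q. False" by eventually_elim simp
  then show False by simp
qed

text \<open>A crossing of height \<open>2 * R * w\<close> is cut at half height. The factor
  \<open>2 * R + 1\<close> comes from the lower bound for that crossing, the factor
  \<open>R + 1\<close> from the windows in which its midpoint may lie.\<close>

lemma bireach_lower_bound:
  assumes crit: "is_critical_parameter p\<^sub>c" and p: "p\<^sub>c \<le> p" "p < 1" and w: "0 < w"
  shows "1 / ((2 * real R + 1) * (real R + 1)) \<le> pr p (\<lambda>A. bireach w (R * w) A u)"
proof -
  have p01: "0 \<le> p" "p \<le> 1" using p crit by (auto simp: is_critical_parameter_def)
  let ?B = "pr p (\<lambda>A. bireach w (R * w) A u)"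
  have "pr p (\<lambda>A. wreach w (2 * R * w) A 0) \<le>
      pr p (\<lambda>A. \<exists>i\<in>{0..R}. bireach w (R * w) A (int (R * w), int (i * w)))"
  proof (intro pr_mono p01 fdep_wreach fdep_Bex fdep_bireach)
    fix A assume "wreach w (2 * R * w) A 0"
    moreover have "2 * R * w = R * w + R * w" by simp
    ultimately have "wreach w (R * w + R * w) A 0" by simp
    from wreach_split(2)[OF w this]
    show "\<exists>i\<in>{0..R}. bireach w (R * w) A (int (R * w), int (i * w))"
      by (simp add: bireach_def)
  qed simp
  also have "\<dots> \<le> (\<Sum>i\<in>{0..R}. pr p (\<lambda>A. bireach w (R * w) A (int (R * w), int (i * w))))"
    by (intro pr_Bex_le p01 fdep_bireach) simp
  also have "\<dots> = (real R + 1) * ?B"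
    by (subst pr_bireach[of p w "R * w" _ u]) simp
  finally have le: "pr p (\<lambda>A. wreach w (2 * R * w) A 0) \<le> (real R + 1) * ?B" .
  have "1 \<le> (2 * real R + 1) * pr p (\<lambda>A. wreach w (2 * R * w) A 0)"
    using crossing_lower_bound[OF crit p w, of "2 * R"] by simp
  also have "\<dots> \<le> (2 * real R + 1) * ((real R + 1) * ?B)"
    by (rule mult_left_mono[OF le]) simp
  finally have "1 \<le> (2 * real R + 1) * (real R + 1) * ?B" by (simp only: mult.assoc)
  then show ?thesis by (simp add: divide_le_eq mult.commute)
qed

section \<open>Open paths that are almost diagonal\<close>

text \<open>A partition function: the sum, over the open upward paths of length \<open>n\<close>
  from \<open>u\<close>, of the product of the weights of their directions. Giving one direction a
  small weight penalizes all paths except those that rarely take it.\<close>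

primrec path_weight :: "(bool \<Rightarrow> real) \<Rightarrow> nat \<Rightarrow> bond set \<Rightarrow> site \<Rightarrow> real" where
  "path_weight \<kappa> 0 A u = 1"
| "path_weight \<kappa> (Suc n) A u = (\<Sum>b\<in>UNIV. (\<kappa> b * of_bool ((u, b) \<in> A)) * path_weight \<kappa> n A (up b u))"

lemma fdep_path_weight: "fdep (\<lambda>A. path_weight \<kappa> n A u)"
proof (induction n arbitrary: u)
  case (Suc n)
  have "fdep (\<lambda>A. \<kappa> b * of_bool ((u, b) \<in> A))" for b
    by (rule fdep_comp[OF fdep_mem, of "\<lambda>x. \<kappa> b * of_bool x"])
  then have "fdep (\<lambda>A. (\<kappa> b * of_bool ((u, b) \<in> A)) * path_weight \<kappa> n A (up b u))" for b
    using Suc by (rule fdep_comp2)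
  then show ?case unfolding path_weight.simps by (intro fdep_sum) auto
qed simp

lemma dep_path_weight: "dep {e. fst u \<le> fst (fst e)} (\<lambda>A. path_weight \<kappa> n A u)"
proof (induction n arbitrary: u)
  case (Suc n)
  have 1: "dep {e. fst u \<le> fst (fst e)} (\<lambda>A. \<kappa> b * of_bool ((u, b) \<in> A))" for b
    by (rule dep_comp[OF dep_mem, of _ _ "\<lambda>x. \<kappa> b * of_bool x"]) simp
  have 2: "dep {e. fst u \<le> fst (fst e)} (\<lambda>A. path_weight \<kappa> n A (up b u))" for b
    by (rule dep_mono[OF Suc]) auto
  show ?case unfolding path_weight.simps by (intro dep_sum dep_comp2[of _ _ _ "(*)"] 1 2)
qed simp

lemma expct_path_weight: "expct p (\<lambda>A. path_weight \<kappa> n A u) = (p * (\<kappa> True + \<kappa> False)) ^ n"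
proof (induction n arbitrary: u)
  case (Suc n)
  have f: "fdep (\<lambda>A. \<kappa> b * of_bool ((u, b) \<in> A))" for b
    by (rule fdep_comp[OF fdep_mem, of "\<lambda>x. \<kappa> b * of_bool x"])
  have d: "dep {(u, b)} (\<lambda>A. \<kappa> b * of_bool ((u, b) \<in> A))" for b
    by (rule dep_comp[OF dep_mem, of _ _ "\<lambda>x. \<kappa> b * of_bool x"]) simp
  have "expct p (\<lambda>A. path_weight \<kappa> (Suc n) A u) =
    (\<Sum>b\<in>UNIV. expct p (\<lambda>A. (\<kappa> b * of_bool ((u, b) \<in> A)) * path_weight \<kappa> n A (up b u)))"
    unfolding path_weight.simps
    by (rule expct_sum) (auto intro!: fdep_comp2[OF f fdep_path_weight])
  also have "\<dots> = (\<Sum>b\<in>UNIV. (\<kappa> b * p) * (p * (\<kappa> True + \<kappa> False)) ^ n)"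
  proof (intro sum.cong refl)
    fix b
    have "expct p (\<lambda>A. (\<kappa> b * of_bool ((u, b) \<in> A)) * path_weight \<kappa> n A (up b u)) =
      expct p (\<lambda>A. \<kappa> b * of_bool ((u, b) \<in> A)) * expct p (\<lambda>A. path_weight \<kappa> n A (up b u))"
      by (rule expct_indep[OF f fdep_path_weight d dep_path_weight]) simp
    also have "expct p (\<lambda>A. \<kappa> b * of_bool ((u, b) \<in> A)) = \<kappa> b * p"
      using expct_cmult[OF fdep_logic(4)[OF fdep_mem]] pr_mem by metis
    finally show "expct p (\<lambda>A. (\<kappa> b * of_bool ((u, b) \<in> A)) * path_weight \<kappa> n A (up b u)) =
      (\<kappa> b * p) * (p * (\<kappa> True + \<kappa> False)) ^ n" by (simp only: Suc)
  qed
  also have "\<dots> = (p * (\<kappa> True + \<kappa> False)) ^ Suc n"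
    by (simp add: UNIV_bool algebra_simps)
  finally show ?case .
qed simp

lemma path_weight_nonneg: "(\<And>b. 0 \<le> \<kappa> b) \<Longrightarrow> 0 \<le> path_weight \<kappa> n A u"
proof (induction n arbitrary: u)
  case (Suc n)
  then show ?case unfolding path_weight.simps by (intro sum_nonneg mult_nonneg_nonneg) auto
qed simp

lemma path_weight_ge:
  assumes "\<And>b. 0 \<le> \<kappa> b" and "\<And>i. i < n \<Longrightarrow> (f i, bs i) \<in> A \<and> f (Suc i) = up (bs i) (f i)"
  shows "(\<Prod>i<n. \<kappa> (bs i)) \<le> path_weight \<kappa> n A (f 0)"
  using assms(2)
proof (induction n arbitrary: f bs)
  case (Suc n)
  have b: "(f 0, bs 0) \<in> A" "f 1 = up (bs 0) (f 0)" using Suc.prems[of 0] by auto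
  have "(\<Prod>i<n. \<kappa> (bs (Suc i))) \<le> path_weight \<kappa> n A (up (bs 0) (f 0))"
    unfolding b(2)[symmetric] One_nat_def
    by (rule Suc.IH[of "\<lambda>i. f (Suc i)" "\<lambda>i. bs (Suc i)"]) (use Suc.prems[of "Suc _"] in simp)
  then have "(\<Prod>i<Suc n. \<kappa> (bs i)) \<le>
      (\<kappa> (bs 0) * of_bool ((f 0, bs 0) \<in> A)) * path_weight \<kappa> n A (up (bs 0) (f 0))"
    using assms(1) b by (simp add: prod.lessThan_Suc_shift mult_left_mono del: prod.lessThan_Suc)
  also have "\<dots> \<le> path_weight \<kappa> (Suc n) A (f 0)"
    unfolding path_weight.simps
    using member_le_sum[of "bs 0" UNIV
      "\<lambda>b. (\<kappa> b * of_bool ((f 0, b) \<in> A)) * path_weight \<kappa> n A (up b (f 0))"]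
      assms(1) path_weight_nonneg[of \<kappa>] by auto
  finally show ?case .
qed simp

text \<open>Open paths through \<open>u\<close> have more than \<open>3 w\<close> steps to the left among the next \<open>r * w\<close> steps
  upwards, and more than \<open>3 w\<close> steps to the left among the next \<open>r * w\<close> steps downwards: a token
  moving to the right cannot run along them.\<close>

definition steep :: "real \<Rightarrow> nat \<Rightarrow> nat \<Rightarrow> bond set \<Rightarrow> site \<Rightarrow> bool" where
  "steep \<mu> r w A u \<longleftrightarrow>
     path_weight (\<lambda>b. if b = False then \<mu> else 1) (r * w) A u < \<mu> ^ (3 * w) \<and>
     path_weight (\<lambda>b. if b = True then \<mu> else 1) (r * w) (flip_bond ` A) (- u) < \<mu> ^ (3 * w)"

text \<open>The window is shifted by \<open>w\<close> so that a token that has made at most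
  \<open>w\<close> moves from the origin cannot yet be on the right of the path.\<close>

definition good :: "nat \<Rightarrow> nat \<Rightarrow> real \<Rightarrow> nat \<Rightarrow> bond set \<Rightarrow> bool" where
  "good R r \<mu> w A \<longleftrightarrow> (\<exists>j\<in>{0..<int w}. reach (R * w) A ((0, int w) + (0, j)) \<and>
     dreach (R * w) A ((0, int w) + (0, j)) \<and> steep \<mu> r w A ((0, int w) + (0, j)))"

lemma fdep_steep: "fdep (\<lambda>A. steep \<mu> r w A u)"
  unfolding steep_def
  by (intro fdep_logic fdep_comp[OF fdep_path_weight, of "\<lambda>x. x < \<mu> ^ (3 * w)"]
      fdep_comp[OF fdep_image[OF bij_flip fdep_path_weight], of "\<lambda>x. x < \<mu> ^ (3 * w)"])

lemma fdep_good: "fdep (\<lambda>A. good R r \<mu> w A)"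
  unfolding good_def by (intro fdep_Bex fdep_logic fdep_steep fdep_reach fdep_dreach) simp

text \<open>Markov's inequality for the two path weights; the assumption on \<open>r\<close>, raised
  to the power \<open>w\<close>, bounds each of the two quotients by \<open>(1 / 2) ^ w\<close>.
  This decay outweighs the union over the \<open>w\<close> sites of a window.\<close>

lemma pr_not_steep:
  assumes p: "0 \<le> p" "p \<le> 1" and \<mu>: "0 < \<mu>" "\<mu> < 1" and r: "(p * (1 + \<mu>)) ^ r \<le> \<mu> ^ 3 / 2"
  shows "pr p (\<lambda>A. \<not> steep \<mu> r w A u) \<le> 2 * (1 / 2) ^ w"
proof -
  let ?k = "\<lambda>b. if b = False then \<mu> else 1" and ?k' = "\<lambda>b. if b = True then \<mu> else 1"
  let ?P = "\<lambda>A. \<mu> ^ (3 * w) \<le> path_weight ?k (r * w) A u"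
  let ?P' = "\<lambda>A. \<mu> ^ (3 * w) \<le> path_weight ?k' (r * w) (flip_bond ` A) (- u)"
  have f': "fdep (\<lambda>A. path_weight ?k' (r * w) (flip_bond ` A) (- u))"
    by (rule fdep_image[OF bij_flip fdep_path_weight])
  have "(p * (1 + \<mu>)) ^ (r * w) / \<mu> ^ (3 * w) = ((p * (1 + \<mu>)) ^ r / \<mu> ^ 3) ^ w"
    by (simp add: power_mult power_divide)
  also have "\<dots> \<le> (1 / 2) ^ w"
    using p \<mu> r by (intro power_mono) (auto simp: field_simps)
  finally have le: "(p * (1 + \<mu>)) ^ (r * w) / \<mu> ^ (3 * w) \<le> (1 / 2) ^ w" .
  have "pr p ?P \<le> expct p (\<lambda>A. path_weight ?k (r * w) A u) / \<mu> ^ (3 * w)"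
    using \<mu> by (intro pr_markov p fdep_path_weight path_weight_nonneg) auto
  then have 1: "pr p ?P \<le> (1 / 2) ^ w" using le by (simp add: expct_path_weight add.commute)
  have "pr p ?P' \<le> expct p (\<lambda>A. path_weight ?k' (r * w) (flip_bond ` A) (- u)) / \<mu> ^ (3 * w)"
    using \<mu> by (intro pr_markov p f' path_weight_nonneg) auto
  also have "expct p (\<lambda>A. path_weight ?k' (r * w) (flip_bond ` A) (- u)) = (p * (1 + \<mu>)) ^ (r * w)"
    by (subst expct_image[OF bij_flip fdep_path_weight]) (simp add: expct_path_weight add.commute)
  finally have 2: "pr p ?P' \<le> (1 / 2) ^ w" using le by simp
  have "pr p (\<lambda>A. \<not> steep \<mu> r w A u) = pr p (\<lambda>A. ?P A \<or> ?P' A)"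
    by (simp add: steep_def not_less)
  also have "\<dots> \<le> pr p ?P + pr p ?P'"
    by (intro pr_disj_le p fdep_comp[OF fdep_path_weight] fdep_comp[OF f'])
  finally show ?thesis using 1 2 by simp
qed

lemma pr_good_ge:
  assumes p: "0 \<le> p" "p \<le> 1" and \<mu>: "0 < \<mu>" "\<mu> < 1" and r: "(p * (1 + \<mu>)) ^ r \<le> \<mu> ^ 3 / 2"
  shows "pr p (\<lambda>A. bireach w (R * w) A (0, int w)) - 2 * (real w * (1 / 2) ^ w)
    \<le> pr p (\<lambda>A. good R r \<mu> w A)"
proof -
  let ?N = "\<lambda>A. \<exists>j\<in>{0..<int w}. \<not> steep \<mu> r w A ((0, int w) + (0, j))"
  have fN: "fdep ?N" by (intro fdep_Bex fdep_logic fdep_steep) simp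
  have "pr p (\<lambda>A. bireach w (R * w) A (0, int w)) \<le> pr p (\<lambda>A. good R r \<mu> w A \<or> ?N A)"
    by (intro pr_mono p fdep_bireach fdep_logic fdep_good fN) (unfold bireach_def good_def, blast)
  also have "\<dots> \<le> pr p (\<lambda>A. good R r \<mu> w A) + pr p ?N"
    by (intro pr_disj_le p fdep_good fN)
  also have "pr p ?N \<le> (\<Sum>j\<in>{0..<int w}. pr p (\<lambda>A. \<not> steep \<mu> r w A ((0, int w) + (0, j))))"
    by (intro pr_Bex_le p fdep_logic fdep_steep) simp
  also have "\<dots> \<le> (\<Sum>j\<in>{0..<int w}. 2 * (1 / 2) ^ w)"
    by (intro sum_mono pr_not_steep p \<mu> r)
  finally show ?thesis by simp
qed

section \<open>Infinitely many good scales\<close>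

text \<open>Continuity from above shows that the upper limit of the events \<open>G n\<close> still
  has probability at least \<open>c\<close>, so it cannot be disjoint from an almost sure event. No
  independence between the \<open>G n\<close> is involved.\<close>

lemma (in prob_space) AE_and_infinitely_often:
  fixes G :: "nat \<Rightarrow> 'a set"
  assumes G: "\<And>n. G n \<in> sets M" and c: "0 < c" "\<And>n. n \<ge> n0 \<Longrightarrow> c \<le> prob (G n)"
    and V: "AE \<omega> in M. V \<omega>"
  obtains \<omega> where "V \<omega>" "\<And>n. \<exists>m\<ge>n. \<omega> \<in> G m"
proof -
  define U where "U n = (\<Union>i. G (n + i))" for n
  have U: "U n \<in> sets M" for n unfolding U_def using G by (intro sets.countable_UN) auto
  have "U n \<subseteq> U m" if "m \<le> n" for m n
  proof
    fix x assume "x \<in> U n"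
    then obtain i where "x \<in> G (n + i)" by (auto simp: U_def)
    then have "x \<in> G (m + (n - m + i))" using that by simp
    then show "x \<in> U m" unfolding U_def by blast
  qed
  then have "decseq U" unfolding decseq_def by blast
  then have lim: "(\<lambda>n. prob (U n)) \<longlonglongrightarrow> prob (\<Inter>n. U n)"
    using U by (intro finite_Lim_measure_decseq) auto
  have "c \<le> prob (U n)" if "n \<ge> n0" for n
  proof -
    have "G n \<subseteq> U n" unfolding U_def using UN_upper[of 0 UNIV "\<lambda>i. G (n + i)"] by simp
    then have "prob (G n) \<le> prob (U n)" using U by (intro finite_measure_mono)
    then show ?thesis using c(2)[OF that] by simp
  qed
  then have "c \<le> prob (\<Inter>n. U n)" by (intro LIMSEQ_le_const[OF lim]) auto
  then have pos: "prob (\<Inter>n. U n) \<noteq> 0" using c(1) by simp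
  have I: "(\<Inter>n. U n) \<in> sets M" using U by (intro sets.countable_INT) auto
  have "\<exists>\<omega>\<in>(\<Inter>n. U n). V \<omega>"
  proof (rule ccontr)
    assume n: "\<not> ?thesis"
    have "AE \<omega> in M. \<omega> \<notin> (\<Inter>n. U n)" using V by eventually_elim (use n in blast)
    then show False using pos prob_eq_0[OF I] by blast
  qed
  then obtain \<omega> where \<omega>: "V \<omega>" "\<And>n. \<omega> \<in> U n" by blast
  have "\<exists>m\<ge>n. \<omega> \<in> G m" for n using \<omega>(2)[of n] unfolding U_def by (metis UN_E le_add1)
  then show ?thesis by (rule that[OF \<omega>(1)])
qed

text \<open>The order of the quantifiers matters: \<open>\<mu>\<close> and \<open>r\<close> depend
  on \<open>p\<close> only, so that \<open>R\<close> can later tend to infinity while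
  \<open>r\<close> is fixed.\<close>

lemma infinitely_often_good:
  assumes crit: "is_critical_parameter p\<^sub>c" and p: "p\<^sub>c \<le> p" "p < 1"
  obtains \<mu> r where "0 < \<mu>" "\<mu> < 1" "0 < r"
    "\<And>R V. (AE \<omega> in percolation_law p. V \<omega>) \<Longrightarrow>
       \<exists>\<omega>. V \<omega> \<and> (\<forall>n. \<exists>w\<ge>n. good R r \<mu> w (opn \<omega>))"
proof -
  have p01: "0 \<le> p" "p \<le> 1" using p crit by (auto simp: is_critical_parameter_def)
  \<comment> \<open>Any positive value with \<open>p * (1 + \<mu>) < 1\<close> would do; it exists
    because \<open>p < 1\<close>.\<close>
  define \<mu> where "\<mu> = (1 - p) / 2"
  have \<mu>: "0 < \<mu>" "\<mu> < 1" using p p01 by (simp_all add: \<mu>_def)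
  have "p * (1 + \<mu>) = p + p * (1 - p) / 2" by (simp add: \<mu>_def algebra_simps)
  also have "\<dots> < 1"
  proof -
    have "p * (1 - p) \<le> 1 * (1 - p)" using p p01 by (intro mult_right_mono) auto
    then show ?thesis using p by (simp add: field_simps)
  qed
  finally have x: "p * (1 + \<mu>) < 1" .
  have x0: "0 \<le> p * (1 + \<mu>)" using p01 \<mu> by simp
  obtain r' where r': "(p * (1 + \<mu>)) ^ r' < \<mu> ^ 3 / 2"
    using real_arch_pow_inv[OF _ x, of "\<mu> ^ 3 / 2"] \<mu> by auto
  \<comment> \<open>The successor makes \<open>r\<close> positive, so that \<open>r \<le> R\<close>
    later yields \<open>0 < R\<close>.\<close>
  define r where "r = Suc r'"
  have r0: "0 < r" by (simp add: r_def)
  have "(p * (1 + \<mu>)) ^ r \<le> (p * (1 + \<mu>)) ^ r'"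
    unfolding r_def using x x0 by (intro power_decreasing) auto
  then have r: "(p * (1 + \<mu>)) ^ r \<le> \<mu> ^ 3 / 2" using r' by simp
  have "\<exists>\<omega>. V \<omega> \<and> (\<forall>n. \<exists>w\<ge>n. good R r \<mu> w (opn \<omega>))"
    if V: "AE \<omega> in percolation_law p. V \<omega>" for R V
  proof -
    interpret prob_space "percolation_law p" by (rule prob_space_percolation_law)
    define G where "G w = {\<omega> \<in> space (percolation_law p). good R r \<mu> w (opn \<omega>)}" for w
    define c where "c = 1 / ((2 * real R + 1) * (real R + 1))"
    have c: "0 < c" by (simp add: c_def)
    have "(\<lambda>w. real w * (1 / 2) ^ w) \<longlonglongrightarrow> (0 :: real)"
      by (rule powser_times_n_limit_0) simp
    then have "\<forall>\<^sub>F w in sequentially. real w * (1 / 2) ^ w < c / 4"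
      by (rule order_tendstoD) (use c in simp)
    then obtain n0 where n0: "\<And>w. w \<ge> n0 \<Longrightarrow> real w * (1 / 2) ^ w < c / 4"
      by (auto simp: eventually_sequentially)
    have "c / 2 \<le> prob (G w)" if w: "w \<ge> Suc n0" for w
    proof -
      have "c \<le> pr p (\<lambda>A. bireach w (R * w) A (0, int w))"
        unfolding c_def using w by (intro bireach_lower_bound[OF crit p]) simp
      then have "c - 2 * (real w * (1 / 2) ^ w) \<le> pr p (\<lambda>A. good R r \<mu> w A)"
        using pr_good_ge[OF p01 \<mu> r, of w R] by simp
      also have "\<dots> = prob (G w)"
        unfolding G_def by (rule measure_percolation_law[OF p01 fdep_good, symmetric])
      finally show ?thesis using n0[of w] w by simp
    qed
    moreover have "G w \<in> sets (percolation_law p)" for w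
      unfolding G_def by (rule sets_percolation_law[OF p01 fdep_good])
    ultimately obtain \<omega> where "V \<omega>" "\<And>n. \<exists>w\<ge>n. \<omega> \<in> G w"
      using AE_and_infinitely_often[of G "c / 2" "Suc n0" V] c V by (metis half_gt_zero)
    then show ?thesis unfolding G_def by blast
  qed
  then show ?thesis by (rule that[OF \<mu> r0])
qed

section \<open>The supercritical and critical game\<close>

lemma reach_path:
  assumes "reach n A u"
  obtains f bs where "f 0 = u" "\<And>i. i < n \<Longrightarrow> (f i, bs i) \<in> A \<and> f (Suc i) = up (bs i) (f i)"
proof -
  have "\<exists>f bs. f 0 = u \<and> (\<forall>i<n. (f i, bs i) \<in> A \<and> f (Suc i) = up (bs i) (f i))"
    using assms
  proof (induction n arbitrary: u)
    case 0
    show ?case by (rule exI[of _ "\<lambda>_. u"]) simp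
  next
    case (Suc n)
    then obtain b where b: "(u, b) \<in> A" "reach n A (up b u)" by auto
    obtain f bs where f: "f 0 = up b u"
      "\<And>i. i < n \<Longrightarrow> (f i, bs i) \<in> A \<and> f (Suc i) = up (bs i) (f i)" using Suc.IH[OF b(2)] by blast
    have "(case_nat u f i, case_nat b bs i) \<in> A \<and>
        case_nat u f (Suc i) = up (case_nat b bs i) (case_nat u f i)" if "i < Suc n" for i
      using that b f by (cases i) auto
    then show ?case by (intro exI[of _ "case_nat u f"] exI[of _ "case_nat b bs"]) auto
  qed
  then show ?thesis using that by blast
qed

lemma snd_path:
  assumes "\<And>i. i < n \<Longrightarrow> f (Suc i) = up (bs i) (f i)"
  shows "fst (f n) = fst (f 0) + int n \<and> snd (f n) = snd (f 0) + int (card {i. i < n \<and> bs i})"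
  using assms
proof (induction n)
  case (Suc n)
  have *: "{i. i < Suc n \<and> bs i} = {i. i < n \<and> bs i} \<union> (if bs n then {n} else {})"
    by (auto simp: less_Suc_eq)
  have "card {i. i < Suc n \<and> bs i} = card {i. i < n \<and> bs i} + of_bool (bs n)"
    unfolding * by (simp add: card_insert_if)
  then show ?case using Suc by (simp add: snd_up)
qed simp

lemma path_weight_power:
  assumes "0 < \<mu>" and f: "\<And>i. i < n \<Longrightarrow> (f i, bs i) \<in> A \<and> f (Suc i) = up (bs i) (f i)"
  shows "\<mu> ^ card {i. i < n \<and> bs i = d} \<le> path_weight (\<lambda>b. if b = d then \<mu> else 1) n A (f 0)"
proof -
  have "\<mu> ^ card {i. i < n \<and> bs i = d} = (\<Prod>i<n. if bs i = d then \<mu> else 1)"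
    by (simp add: prod.If_cases Int_def lessThan_def)
  also have "\<dots> \<le> path_weight (\<lambda>b. if b = d then \<mu> else 1) n A (f 0)"
    using path_weight_ge[of "\<lambda>b. if b = d then \<mu> else 1" n f bs A] assms by auto
  finally show ?thesis .
qed

lemma path_weight_less:
  assumes \<mu>: "0 < \<mu>" "\<mu> < 1"
    and f: "\<And>i. i < n \<Longrightarrow> (f i, bs i) \<in> A \<and> f (Suc i) = up (bs i) (f i)"
    and less: "path_weight (\<lambda>b. if b = d then \<mu> else 1) n A (f 0) < \<mu> ^ k"
  shows "k < card {i. i < n \<and> bs i = d}"
proof -
  have "\<mu> ^ card {i. i < n \<and> bs i = d} < \<mu> ^ k"
    using path_weight_power[where f = f and bs = bs and d = d, OF \<mu>(1) f] less
    by (rule order_le_less_trans)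
  then show ?thesis using \<mu> by (simp add: power_strict_decreasing_iff)
qed

text \<open>The graph of an open path which a token starting near the origin and moving only to the right must
  meet early: at the levels \<open>T\<close> and \<open>- T\<close> the path is on the left of the two diagonals starting at the
  origin.\<close>

definition barrier :: "bond set \<Rightarrow> int \<Rightarrow> int \<Rightarrow> int \<Rightarrow> (int \<Rightarrow> int) \<Rightarrow> bool" where
  "barrier A K T w \<gamma> \<longleftrightarrow>
     (\<forall>k. - K \<le> k \<and> k < K \<longrightarrow> (\<exists>b. ((k, \<gamma> k), b) \<in> A \<and> \<gamma> (k + 1) = \<gamma> k + of_bool b)) \<and>
     w \<le> \<gamma> 0 \<and> \<gamma> T \<le> T - w \<and> \<gamma> (- T) \<le> - w"

text \<open>The upward path and the reflected downward path are glued at height 0 into a graph over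
  the heights; the counts of left steps in \<open>steep\<close> become its bounds at the heights
  \<open>r * w\<close> and \<open>- r * w\<close>.\<close>

lemma good_barrier:
  assumes good: "good R r \<mu> w A" and \<mu>: "0 < \<mu>" "\<mu> < 1" and "r \<le> R"
  shows "\<exists>\<gamma>. barrier A (int (R * w)) (int (r * w)) (int w) \<gamma>"
proof -
  obtain j where j: "j \<in> {0..<int w}" and up: "reach (R * w) A (0, int w + j)"
    and down: "dreach (R * w) A (0, int w + j)" and st: "steep \<mu> r w A (0, int w + j)"
    using good by (auto simp: good_def)
  let ?a = "int w + j"
  have le: "r * w \<le> R * w" using \<open>r \<le> R\<close> by simp
  obtain f bs where f: "f 0 = (0, ?a)"
    "\<And>i. i < R * w \<Longrightarrow> (f i, bs i) \<in> A \<and> f (Suc i) = up (bs i) (f i)"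
    by (rule reach_path[OF up]) blast
  have "reach (R * w) (flip_bond ` A) (- (0, ?a))" using down by (simp only: dreach_flip)
  then obtain g cs where g: "g 0 = - (0, ?a)"
    "\<And>i. i < R * w \<Longrightarrow> (g i, cs i) \<in> flip_bond ` A \<and> g (Suc i) = up (cs i) (g i)"
    by (rule reach_path) blast
  have ff: "fst (f i) = int i" if "i \<le> R * w" for i
    using snd_path[of i f bs] f that by simp
  have fg: "fst (g i) = int i" if "i \<le> R * w" for i
    using snd_path[of i g cs] g that by simp
  define \<gamma> where "\<gamma> k = (if 0 \<le> k then snd (f (nat k)) else - snd (g (nat (- k))))" for k
  have \<gamma>f: "f i = (int i, \<gamma> (int i))" if "i \<le> R * w" for i
    using ff[OF that] by (simp add: \<gamma>_def prod_eq_iff)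
  have \<gamma>g: "- g i = (- int i, \<gamma> (- int i))" if "i \<le> R * w" for i
    using fg[OF that] f(1) g(1) by (cases "i = 0") (simp_all add: \<gamma>_def prod_eq_iff)
  have steps: "\<exists>b. ((k, \<gamma> k), b) \<in> A \<and> \<gamma> (k + 1) = \<gamma> k + of_bool b"
    if k: "- int (R * w) \<le> k" "k < int (R * w)" for k
  proof (cases "0 \<le> k")
    case True
    define i where "i = nat k"
    have i: "k = int i" "i < R * w" using True k by (auto simp: i_def nat_less_iff)
    have "(f i, bs i) \<in> A" "f (Suc i) = up (bs i) (f i)" using f(2)[OF i(2)] by auto
    then show ?thesis
      using \<gamma>f[of i] \<gamma>f[of "Suc i"] i by (auto simp: up_def add.commute)
  next
    case False
    define i where "i = nat (- k - 1)"
    have i: "k = - int (Suc i)" "i < R * w" using False k by (auto simp: i_def nat_less_iff)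
    have 1: "(g i, cs i) \<in> flip_bond ` A" and 2: "g (Suc i) = up (cs i) (g i)" using g(2)[OF i(2)] by auto
    have s: "- g (Suc i) = dn (cs i) (- g i)" unfolding 2 by (simp add: up_def dn_def)
    have "(- g (Suc i), cs i) \<in> A"
      unfolding s flip_image[symmetric] using 1 by simp
    moreover have "- g i = up (cs i) (- g (Suc i))" unfolding s by simp
    ultimately show ?thesis
      using \<gamma>g[of i] \<gamma>g[of "Suc i"] i by (auto simp: up_def)
  qed
  \<comment> \<open>The path starts at \<open>?a < 2 * w\<close>, so more than \<open>3 * w\<close>
    left steps leave a margin of \<open>w\<close>.\<close>
  have "3 * w < card {i. i < r * w \<and> bs i = False}"
    using st unfolding steep_def f(1)[symmetric]
    by (intro path_weight_less[OF \<mu>, of _ f bs A] f(2) less_le_trans[OF _ le]) auto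
  moreover have "card {i. i < r * w \<and> bs i = False} + card {i. i < r * w \<and> bs i} = r * w"
  proof -
    have "card ({i. i < r * w \<and> bs i = False} \<union> {i. i < r * w \<and> bs i}) =
        card {i. i < r * w \<and> bs i = False} + card {i. i < r * w \<and> bs i}"
      by (rule card_Un_disjoint) auto
    moreover have "{i. i < r * w \<and> bs i = False} \<union> {i. i < r * w \<and> bs i} = {..<r * w}" by auto
    ultimately show ?thesis by simp
  qed
  moreover have "\<gamma> (int (r * w)) = ?a + int (card {i. i < r * w \<and> bs i})"
    using snd_path[of "r * w" f bs] f le \<gamma>f[OF le] by simp
  ultimately have 1: "\<gamma> (int (r * w)) \<le> int (r * w) - int w"
    using j unfolding atLeastLessThan_iff by linarith
  have "3 * w < card {i. i < r * w \<and> cs i = True}"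
    using st unfolding steep_def g(1)[symmetric]
    by (intro path_weight_less[OF \<mu>, of _ g cs "flip_bond ` A"] g(2) less_le_trans[OF _ le]) auto
  moreover have "- \<gamma> (- int (r * w)) = - ?a + int (card {i. i < r * w \<and> cs i})"
    using snd_path[of "r * w" g cs] g le \<gamma>g[OF le] by (simp add: prod_eq_iff)
  ultimately have 2: "\<gamma> (- int (r * w)) \<le> - int w" using j by simp
  have "int w \<le> \<gamma> 0" using f(1) j by (simp add: \<gamma>_def)
  then show ?thesis using steps 1 2 unfolding barrier_def by blast
qed

lemma barrier_diff:
  assumes "barrier A K T w \<gamma>" "- K \<le> i" "i \<le> j" "j \<le> K"
  shows "\<gamma> i \<le> \<gamma> j \<and> \<gamma> j \<le> \<gamma> i + (j - i)"
  using assms(3,4)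
proof (induction j rule: int_ge_induct)
  case (step j)
  have "- K \<le> j" "j < K" using assms(2) step by auto
  then obtain b where "\<gamma> (j + 1) = \<gamma> j + of_bool b"
    using assms(1) unfolding barrier_def by blast
  then show ?case using step by (cases b) auto
qed simp

text \<open>While the token misses the path, its abscissa \<open>2 * snd - fst\<close> grows by one
  at each move and it stays on the left of the path. After \<open>2 * T\<close> such moves it would
  be at least at \<open>2 * T - n0\<close>, but at every height it can have by then the path is not
  on the right of that abscissa. The condition \<open>n0 \<le> w\<close> absorbs the unknown
  position at time \<open>n0\<close>.\<close>

lemma barrier_hit:
  assumes bar: "barrier A K T w \<gamma>" and T: "0 \<le> T" "T \<le> K" and n0: "int n0 \<le> w"
    and fst_us: "\<And>m. \<bar>fst (us m)\<bar> \<le> int m" and x: "- int n0 \<le> 2 * snd (us n0) - fst (us n0)"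
      "2 * snd (us n0) - fst (us n0) \<le> int n0"
    and on: "\<And>m. n0 \<le> m \<Longrightarrow> int m < K \<Longrightarrow> snd (us m) = \<gamma> (fst (us m)) \<Longrightarrow>
      snd (us (Suc m)) = \<gamma> (fst (us (Suc m)))"
    and off: "\<And>m. n0 \<le> m \<Longrightarrow> int m < K \<Longrightarrow> snd (us m) \<noteq> \<gamma> (fst (us m)) \<Longrightarrow>
      us (Suc m) = up True (us m) \<or> us (Suc m) = dn False (us m)"
    and m: "int n0 + 2 * T \<le> int m" "int m \<le> K"
  shows "snd (us m) = \<gamma> (fst (us m))"
proof -
  note diff = barrier_diff[OF bar]
  let ?hit = "\<lambda>m. snd (us m) = \<gamma> (fst (us m))"
  have range: "- K \<le> fst (us m)" "fst (us m) \<le> K" if "int m \<le> K" for m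
    using fst_us[of m] that by auto
  have stay: "?hit m" if "?hit i" "n0 \<le> i" "i \<le> m" "int m \<le> K" for i m
    using that(3,4)
  proof (induction m rule: dec_induct)
    case base
    show ?case by (rule that(1))
  next
    case (step m)
    then show ?case using that(2) by (intro on) auto
  qed
  have "\<gamma> 0 \<ge> w" using bar by (simp add: barrier_def)
  have n0K: "int n0 \<le> K" using m T by linarith
  have start: "snd (us n0) \<le> \<gamma> (fst (us n0))"
  proof (cases "0 \<le> fst (us n0)")
    case True
    then have "\<gamma> 0 \<le> \<gamma> (fst (us n0))" using diff[of 0 "fst (us n0)"] range[OF n0K] by simp
    then show ?thesis using \<open>w \<le> \<gamma> 0\<close> x(2) n0 fst_us[of n0] by linarith
  next
    case False
    then have "\<gamma> 0 \<le> \<gamma> (fst (us n0)) + (0 - fst (us n0))"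
      using diff[of "fst (us n0)" 0] range[OF n0K] by linarith
    then show ?thesis using \<open>w \<le> \<gamma> 0\<close> x(2) n0 fst_us[of n0] False by linarith
  qed
  \<comment> \<open>The token cannot jump over the path: off the path the gap
    \<open>\<gamma> - snd\<close> is at least one, and a single move reduces it by at most
    one.\<close>
  have inv: "snd (us m) \<le> \<gamma> (fst (us m)) \<and>
      (\<not> ?hit m \<longrightarrow> 2 * snd (us m) - fst (us m) = 2 * snd (us n0) - fst (us n0) + int (m - n0))"
    if "n0 \<le> m" "int m \<le> K" for m
    using that
  proof (induction m rule: dec_induct)
    case base
    then show ?case using start by simp
  next
    case (step m)
    have mK: "int m < K" using step.prems by simp
    show ?case
    proof (cases "?hit m")
      case True
      then show ?thesis using on[OF step.hyps(1) mK] by simp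
    next
      case False
      note IH = step.IH[OF less_imp_le[OF mK]]
      have lt: "snd (us m) + 1 \<le> \<gamma> (fst (us m))" using IH False by simp
      from off[OF step.hyps(1) mK False] show ?thesis
      proof
        assume e: "us (Suc m) = up True (us m)"
        have "\<gamma> (fst (us m)) \<le> \<gamma> (fst (us m) + 1)"
          using diff[of "fst (us m)" "fst (us m) + 1"] range[of m] range[of "Suc m"] e step.prems by simp
        then show ?thesis using lt IH False step.hyps by (simp add: e up_def)
      next
        assume e: "us (Suc m) = dn False (us m)"
        have "\<gamma> (fst (us m)) \<le> \<gamma> (fst (us m) - 1) + 1"
          using diff[of "fst (us m) - 1" "fst (us m)"] range[of m] range[of "Suc m"] e step.prems by simp
        then show ?thesis using lt IH False step.hyps by (simp add: e dn_def)
      qed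
    qed
  qed
  define h where "h = n0 + nat (2 * T)"
  have h: "n0 \<le> h" "int h = int n0 + 2 * T" using T by (auto simp: h_def)
  have hK: "int h \<le> K" using h m by linarith
  have "?hit h"
  proof (rule ccontr)
    assume no: "\<not> ?hit h"
    define k where "k = fst (us h)"
    have lt: "snd (us h) < \<gamma> k" using inv[OF h(1) hK] no by (simp add: k_def)
    have eq: "2 * snd (us h) - k = 2 * snd (us n0) - fst (us n0) + 2 * T"
      using inv[OF h(1) hK] no h by (simp add: k_def)
    have k: "- int n0 - 2 * T \<le> k" "k \<le> int n0 + 2 * T" using fst_us[of h] h by (auto simp: k_def)
    have kK: "- K \<le> k" "k \<le> K" using range[OF hK] by (auto simp: k_def)
    have b: "\<gamma> T \<le> T - w" "\<gamma> (- T) \<le> - w" using bar by (auto simp: barrier_def)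
    \<comment> \<open>As \<open>\<gamma>\<close> is nondecreasing with increments at most one per
      level, its values at \<open>T\<close> and \<open>- T\<close> bound it at all heights:
      monotonicity or the bound on the increments is used according to the position of
      \<open>k\<close>.\<close>
    consider "T \<le> k" | "0 \<le> k" "k \<le> T" | "- T \<le> k" "k \<le> 0" | "k \<le> - T" by linarith
    then have "2 * \<gamma> k \<le> - int n0 + 2 * T + k"
    proof cases
      case 1
      then have "\<gamma> k \<le> \<gamma> T + (k - T)" using diff[of T k] T kK by simp
      then show ?thesis using b n0 k by linarith
    next
      case 2
      then have "\<gamma> k \<le> \<gamma> T" using diff[of k T] T kK by simp
      then show ?thesis using b n0 2 by linarith
    next
      case 3
      then have "\<gamma> k \<le> \<gamma> (- T) + (k - (- T))" using diff[of "- T" k] T kK by simp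
      then show ?thesis using b n0 3 by linarith
    next
      case 4
      then have "\<gamma> k \<le> \<gamma> (- T)" using diff[of k "- T"] T kK by simp
      then show ?thesis using b n0 k by linarith
    qed
    then show False using lt eq x(1) by linarith
  qed
  then show ?thesis using stay[of h m] h m by simp
qed

section \<open>The strategy of Player 2\<close>

definition site_of :: "vertex \<Rightarrow> site" where
  "site_of z = (snd z, (fst z + snd z) div 2)"

lemma site_of_loc [simp]: "site_of (loc u) = u"
  by (simp add: site_of_def loc_def)

text \<open>Strategies only see the crossed edges, so the position of the token is recomputed by
  passing to the other endpoint of each edge in turn.\<close>

definition trace :: "vertex \<Rightarrow> edge list \<Rightarrow> vertex" where
  "trace z h = foldl (\<lambda>v e. THE w. e = {v, w}) z h"

lemma trace_hist: "trace z (hist z \<sigma> \<tau> n) = pos z \<sigma> \<tau> n"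
proof (induction n)
  case (Suc n)
  have "(THE w. {pos z \<sigma> \<tau> n, pos z \<sigma> \<tau> (Suc n)} = {pos z \<sigma> \<tau> n, w}) = pos z \<sigma> \<tau> (Suc n)"
    by (rule the_equality) (auto simp: doubleton_eq_iff)
  then show ?case using Suc by (simp add: trace_def hist_Suc)
qed (simp add: trace_def)

lemma pos_loc: "\<exists>v. pos (loc u) \<sigma> \<tau> m = loc v"
proof (induction m)
  case (Suc m)
  then obtain v where v: "pos (loc u) \<sigma> \<tau> m = loc v" by blast
  show ?case
    unfolding pos_Suc v by (cases "\<sigma> (hist (loc u) \<sigma> \<tau> m)") (auto simp only: move_loc)
qed auto

text \<open>The target path depends on the elapsed time \<open>length h\<close> because it changes
  from phase to phase. Below a site the bond of the path is crossed downwards, so a bond going up to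
  the right calls for \<open>Left\<close>.\<close>

definition follow :: "(nat \<Rightarrow> int \<Rightarrow> int) \<Rightarrow> strategy2" where
  "follow \<Gamma> h = (let u = site_of (trace (loc 0) h); \<gamma> = \<Gamma> (length h) in
     if snd u = \<gamma> (fst u)
     then (if \<gamma> (fst u + 1) = snd u + 1 then Right else Left,
           if \<gamma> (fst u - 1) = snd u - 1 then Left else Right)
     else (Right, Right))"

definition track :: "strategy1 \<Rightarrow> (nat \<Rightarrow> int \<Rightarrow> int) \<Rightarrow> nat \<Rightarrow> site" where
  "track \<sigma> \<Gamma> m = site_of (pos (loc 0) \<sigma> (follow \<Gamma>) m)"

lemma pos_follow: "pos (loc 0) \<sigma> (follow \<Gamma>) m = loc (track \<sigma> \<Gamma> m)"
  using pos_loc[of 0 \<sigma> "follow \<Gamma>" m] by (auto simp: track_def)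

lemma track_Suc:
  "track \<sigma> \<Gamma> (Suc m) =
    (if snd (track \<sigma> \<Gamma> m) = \<Gamma> m (fst (track \<sigma> \<Gamma> m))
     then case \<sigma> (hist (loc 0) \<sigma> (follow \<Gamma>) m) of
         Top \<Rightarrow> up (\<Gamma> m (fst (track \<sigma> \<Gamma> m) + 1) = snd (track \<sigma> \<Gamma> m) + 1) (track \<sigma> \<Gamma> m)
       | Bottom \<Rightarrow> dn (\<Gamma> m (fst (track \<sigma> \<Gamma> m) - 1) = snd (track \<sigma> \<Gamma> m) - 1) (track \<sigma> \<Gamma> m)
     else case \<sigma> (hist (loc 0) \<sigma> (follow \<Gamma>) m) of
         Top \<Rightarrow> up True (track \<sigma> \<Gamma> m) | Bottom \<Rightarrow> dn False (track \<sigma> \<Gamma> m))"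
proof -
  have "loc (track \<sigma> \<Gamma> (Suc m)) = pos (loc 0) \<sigma> (follow \<Gamma>) (Suc m)" by (rule pos_follow[symmetric])
  then show ?thesis
    unfolding pos_Suc pos_follow
    by (cases "\<sigma> (hist (loc 0) \<sigma> (follow \<Gamma>) m)")
      (auto simp: move_loc response_def follow_def trace_hist pos_follow Let_def)
qed

text \<open>About the play before \<open>n0\<close> only one fact is used: the token has made
  \<open>n0 \<le> w\<close> moves. The costs of the first \<open>n0 + 2 * T\<close> stages are
  bounded below by 0; from then on the token is on the path and every cost is 1.\<close>

lemma follow_cost:
  assumes bar: "barrier (opn \<omega>) (int K) (int T) (int w) \<gamma>" and "T \<le> K" "n0 \<le> w"
    and \<Gamma>: "\<And>m. n0 \<le> m \<Longrightarrow> m < K \<Longrightarrow> \<Gamma> m = \<gamma>"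
  shows "real K - (real w + 2 * real T) \<le>
    (\<Sum>m<K. cost \<omega> {pos (loc 0) \<sigma> (follow \<Gamma>) m, pos (loc 0) \<sigma> (follow \<Gamma>) (Suc m)})"
proof -
  let ?z = "pos (loc 0) \<sigma> (follow \<Gamma>)"
  define us where "us = track \<sigma> \<Gamma>"
  note z = pos_follow[of \<sigma> \<Gamma>, folded us_def] and us_Suc = track_Suc[of \<sigma> \<Gamma>, folded us_def]
  have ud: "\<exists>b. us (Suc m) = up b (us m) \<or> us (Suc m) = dn b (us m)" for m
    unfolding us_Suc by (auto split: action1.split)
  have us0: "us 0 = 0" by (simp add: us_def track_def)
  have fst_us: "\<bar>fst (us m)\<bar> \<le> int m \<and> \<bar>2 * snd (us m) - fst (us m)\<bar> \<le> int m" for m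
  proof (induction m)
    case (Suc m)
    obtain b where "us (Suc m) = up b (us m) \<or> us (Suc m) = dn b (us m)" using ud by blast
    then show ?case using Suc by (cases b) (auto simp: up_def dn_def)
  qed (simp add: us0)
  have steps: "\<exists>b. ((k, \<gamma> k), b) \<in> opn \<omega> \<and> \<gamma> (k + 1) = \<gamma> k + of_bool b"
    if "- int K \<le> k" "k < int K" for k
    using bar that unfolding barrier_def by blast
  have on: "snd (us (Suc m)) = \<gamma> (fst (us (Suc m))) \<and> cost \<omega> {?z m, ?z (Suc m)} = 1"
    if m: "n0 \<le> m" "m < K" and hit: "snd (us m) = \<gamma> (fst (us m))" for m
  proof -
    define k where "k = fst (us m)"
    have u: "us m = (k, \<gamma> k)" using hit by (simp add: k_def prod_eq_iff)
    have k: "- int K < k" "k < int K" using fst_us[of m] m by (auto simp: k_def)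
    show ?thesis
    proof (cases "\<sigma> (hist (loc 0) \<sigma> (follow \<Gamma>) m)")
      case Top
      obtain b where b: "((k, \<gamma> k), b) \<in> opn \<omega>" "\<gamma> (k + 1) = \<gamma> k + of_bool b"
        using steps[of k] k by auto
      have s: "us (Suc m) = up b (us m)"
        unfolding us_Suc using Top b(2) \<Gamma>[OF m] by (simp add: u)
      then have "{?z m, ?z (Suc m)} = bond_edge ((k, \<gamma> k), b)"
        by (simp add: z bond_edge_def u)
      then show ?thesis using b s by (simp add: cost_bond_edge u up_def add.commute)
    next
      case Bottom
      obtain b where b: "((k - 1, \<gamma> (k - 1)), b) \<in> opn \<omega>" "\<gamma> k = \<gamma> (k - 1) + of_bool b"
        using steps[of "k - 1"] k by auto
      have s: "us (Suc m) = dn b (us m)"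
        unfolding us_Suc using Bottom b(2) \<Gamma>[OF m] by (cases b) (simp_all add: u)
      moreover have e: "dn b (us m) = (k - 1, \<gamma> (k - 1))" using b(2) by (simp add: u dn_def)
      ultimately have "{?z m, ?z (Suc m)} = bond_edge ((k - 1, \<gamma> (k - 1)), b)"
        using up_dn(1)[of b "us m"] by (auto simp: z bond_edge_def)
      then show ?thesis using b s e by (simp add: cost_bond_edge)
    qed
  qed
  have hit: "snd (us m) = \<gamma> (fst (us m))" if "n0 + 2 * T \<le> m" "m \<le> K" for m
  proof (rule barrier_hit[OF bar])
    show "us (Suc m) = up True (us m) \<or> us (Suc m) = dn False (us m)"
      if "n0 \<le> m" "int m < int K" "snd (us m) \<noteq> \<gamma> (fst (us m))" for m
      unfolding us_Suc using that \<Gamma>[of m] by (auto split: action1.split)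
    show "- int n0 \<le> 2 * snd (us n0) - fst (us n0)" "2 * snd (us n0) - fst (us n0) \<le> int n0"
      using fst_us[of n0] by linarith+
  qed (use fst_us on assms(2,3) that in auto)
  have "real K - (real n0 + 2 * real T) \<le> (\<Sum>m<K. if n0 + 2 * T \<le> m then 1 else 0 :: real)"
  proof -
    have "{..<K} \<inter> {m. n0 + 2 * T \<le> m} = {n0 + 2 * T..<K}" by auto
    then have "(\<Sum>m<K. if n0 + 2 * T \<le> m then 1 else 0 :: real) = real (card {n0 + 2 * T..<K})"
      by (simp only: sum.If_cases[OF finite_lessThan]) simp
    then show ?thesis by simp
  qed
  also have "\<dots> \<le> (\<Sum>m<K. cost \<omega> {?z m, ?z (Suc m)})"
    using on hit cost_nonneg by (intro sum_mono) auto
  finally show ?thesis using assms(3) by simp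
qed

text \<open>As the payoff is an upper limit, it is enough that the average cost is large at the end of
  infinitely many phases; the phases grow so fast that the past is negligible.\<close>

lemma follow_guarantee:
  assumes inf: "\<And>n. \<exists>w\<ge>n. good R r \<mu> w (opn \<omega>)" and \<mu>: "0 < \<mu>" "\<mu> < 1" and r: "r \<le> R" "0 < R"
  shows "\<exists>\<tau>. \<forall>\<sigma>. ereal (1 - (1 + 2 * real r) / real R) \<le> total_cost \<omega> (loc 0) \<sigma> \<tau>"
proof -
  let ?B = "\<lambda>w. barrier (opn \<omega>) (int (R * w)) (int (r * w)) (int w)"
  have ex: "\<exists>w>n. Ex (?B w)" for n
    using inf[of "Suc n"] good_barrier[OF _ \<mu> r(1)] by (meson Suc_le_lessD)
  \<comment> \<open>Phase \<open>i\<close> ends at time \<open>R * ws i\<close>. The growth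
    condition makes this time at most the next scale, as \<open>follow_cost\<close> requires of
    \<open>n0\<close>, and makes \<open>ws\<close> strictly increasing.\<close>
  have "\<exists>ws. \<forall>i. Ex (?B (ws i)) \<and> (R * ws i + ws i < ws (Suc i))"
  proof (rule dependent_nat_choice)
    show "\<exists>w. Ex (?B w)" using ex[of 0] by blast
    show "\<exists>w'. Ex (?B w') \<and> R * w + w < w'" for w i using ex[of "R * w + w"] by blast
  qed
  then obtain ws where ws: "\<And>i. Ex (?B (ws i))" "\<And>i. R * ws i + ws i < ws (Suc i)" by blast
  obtain g where g: "\<And>i. ?B (ws i) (g i)" using ws(1) by metis
  have mono: "strict_mono ws" by (rule strict_monoI_Suc) (use ws(2) in \<open>meson le_add2 le_less_trans\<close>)
  \<comment> \<open>The phase to which time \<open>m\<close> belongs, that is, the first one that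
    has not ended.\<close>
  define idx where "idx m = (LEAST i. m < R * ws i)" for m
  define \<Gamma> where "\<Gamma> m = g (idx m)" for m
  have \<Gamma>: "\<Gamma> m = g (Suc i)" if "R * ws i \<le> m" "m < R * ws (Suc i)" for m i
  proof -
    have "idx m = Suc i"
      unfolding idx_def
    proof (rule Least_equality)
      show "m < R * ws (Suc i)" by (rule that(2))
    next
      fix y assume "m < R * ws y"
      with that(1) have "R * ws i < R * ws y" by (rule le_less_trans)
      then have "ws i < ws y" by simp
      then show "Suc i \<le> y" using strict_mono_less[OF mono] by simp
    qed
    then show ?thesis by (simp add: \<Gamma>_def)
  qed
  have "ereal (1 - (1 + 2 * real r) / real R) \<le> total_cost \<omega> (loc 0) \<sigma> (follow \<Gamma>)" for \<sigma>
  proof -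
    let ?z = "pos (loc 0) \<sigma> (follow \<Gamma>)"
    let ?avg = "\<lambda>n. ereal (1 / real n * (\<Sum>m<n. cost \<omega> {?z m, ?z (Suc m)}))"
    have "\<exists>n\<ge>N. ereal (1 - (1 + 2 * real r) / real R) \<le> ?avg n" for N
    proof -
      \<comment> \<open>Phase \<open>Suc N\<close> has a predecessor, whose end
        \<open>R * ws N\<close> serves as \<open>n0\<close>, and it ends after time
        \<open>N\<close>.\<close>
      let ?w = "ws (Suc N)"
      let ?n = "R * ?w"
      have w: "N < ?w" using strict_mono_imp_increasing[OF mono, of "Suc N"] by simp
      have "1 * ?w \<le> ?n" using r(2) by (intro mult_le_mono1) simp
      then have n: "N \<le> ?n" using w by linarith
      have "real ?n - (real ?w + 2 * real (r * ?w)) \<le> (\<Sum>m<?n. cost \<omega> {?z m, ?z (Suc m)})"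
      proof (rule follow_cost[OF g[of "Suc N"]])
        show "r * ?w \<le> R * ?w" using r(1) by simp
        show "R * ws N \<le> ?w" using ws(2)[of N] by simp
        show "\<Gamma> m = g (Suc N)" if "R * ws N \<le> m" "m < R * ?w" for m using \<Gamma>[OF that] .
      qed
      from mult_left_mono[OF this, of "1 / real ?n"]
      have "1 / real ?n * (real ?n - (real ?w + 2 * real (r * ?w)))
        \<le> 1 / real ?n * (\<Sum>m<?n. cost \<omega> {?z m, ?z (Suc m)})" by simp
      moreover have "1 / real ?n * (real ?n - (real ?w + 2 * real (r * ?w))) =
          1 - (1 + 2 * real r) / real R"
        using w r(2) by (simp add: field_simps)
      ultimately show ?thesis using n by (intro exI[of _ ?n]) simp
    qed
    then show ?thesis
      unfolding total_cost_pos limsup_INF_SUP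
      by (intro INF_greatest) (meson SUP_upper2 atLeast_iff)
  qed
  then show ?thesis by blast
qed

section \<open>The almost sure value\<close>

lemma total_cost_le_1: "total_cost \<omega> z \<sigma> \<tau> \<le> 1"
proof -
  have "1 / real n * (\<Sum>m<n. cost \<omega> {pos z \<sigma> \<tau> m, pos z \<sigma> \<tau> (Suc m)}) \<le> 1" for n
  proof -
    have "(\<Sum>m<n. cost \<omega> {pos z \<sigma> \<tau> m, pos z \<sigma> \<tau> (Suc m)}) \<le> real n"
      using sum_bounded_above[of "{..<n}" "\<lambda>m. cost \<omega> {pos z \<sigma> \<tau> m, pos z \<sigma> \<tau> (Suc m)}" 1] cost_le_1
      by simp
    then show ?thesis by (cases "n = 0") (simp_all add: field_simps)
  qed
  then show ?thesis
    unfolding total_cost_pos by (intro Limsup_bounded always_eventually) (simp add: one_ereal_def)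
qed

lemma has_value_le_1:
  assumes "has_value \<omega> z v"
  shows "v \<le> 1"
proof -
  have "ereal v = (INF \<sigma>. SUP \<tau>. total_cost \<omega> z \<sigma> \<tau>)" using assms by (simp add: has_value_def)
  also have "\<dots> \<le> 1" by (rule INF_lower2[of undefined]) (auto intro: SUP_least total_cost_le_1)
  finally show ?thesis by (simp add: one_ereal_def)
qed

text \<open>For each \<open>R\<close> some realization has value \<open>v\<close> and admits good
  scales infinitely often. The realization may vary with \<open>R\<close>, but \<open>v\<close> does
  not, so \<open>R\<close> can tend to infinity in the resulting inequality.\<close>

lemma value_eq_1:
  assumes crit: "is_critical_parameter p\<^sub>c" and p: "p\<^sub>c \<le> p" "p < 1" and v: "is_as_value p v"
  shows "v = 1"
proof -
  obtain \<mu> r where \<mu>: "0 < \<mu>" "\<mu> < 1" and r: "0 < r" and io: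
    "\<And>R V. (AE \<omega> in percolation_law p. V \<omega>) \<Longrightarrow>
       \<exists>\<omega>. V \<omega> \<and> (\<forall>n. \<exists>w\<ge>n. good R r \<mu> w (opn \<omega>))"
    using infinitely_often_good[OF crit p] by metis
  have bounds: "1 - (1 + 2 * real r) / real R \<le> v \<and> v \<le> 1" if R: "r \<le> R" for R
  proof -
    obtain \<omega> where \<omega>: "\<forall>z\<in>vertices. has_value \<omega> z v" "\<And>n. \<exists>w\<ge>n. good R r \<mu> w (opn \<omega>)"
      using io[OF v[unfolded is_as_value_def], of R] by blast
    have hv: "has_value \<omega> (loc 0) v" using \<omega>(1) loc_in_vertices by blast
    obtain \<tau> where \<tau>: "\<And>\<sigma>. ereal (1 - (1 + 2 * real r) / real R) \<le> total_cost \<omega> (loc 0) \<sigma> \<tau>"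
      using follow_guarantee[OF \<omega>(2) \<mu> R] r R by auto
    have "ereal (1 - (1 + 2 * real r) / real R) \<le> (INF \<sigma>. total_cost \<omega> (loc 0) \<sigma> \<tau>)"
      by (intro INF_greatest \<tau>)
    also have "\<dots> \<le> (SUP \<tau>. INF \<sigma>. total_cost \<omega> (loc 0) \<sigma> \<tau>)" by (rule SUP_upper) simp
    also have "\<dots> = ereal v" using hv by (simp add: has_value_def)
    finally show ?thesis using has_value_le_1[OF hv] by simp
  qed
  have "(\<lambda>R. 1 - (1 + 2 * real r) * (1 / real R)) \<longlonglongrightarrow> 1 - (1 + 2 * real r) * 0"
    by (intro tendsto_intros lim_1_over_n)
  then have "(\<lambda>R. 1 - (1 + 2 * real r) / real R) \<longlonglongrightarrow> 1" by simp
  then have "1 \<le> v" by (rule LIMSEQ_le_const2) (use bounds in blast)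
  then show ?thesis using bounds[of r] by simp
qed

text \<open>Here \<open>p * (1 + \<mu>) < 1\<close> fails for every positive \<open>\<mu>\<close>,
  so no path can be shown to be steep; but almost surely every edge is open and every play costs
  1.\<close>

lemma value_1:
  assumes v: "is_as_value 1 v"
  shows "v = 1"
proof -
  interpret prob_space "percolation_law 1" by (rule prob_space_percolation_law)
  have "AE \<omega> in percolation_law 1. e \<in> opn \<omega>" for e
  proof -
    have "prob {\<omega> \<in> space (percolation_law 1). e \<in> opn \<omega>} = 1"
      by (subst measure_percolation_law) (auto simp: pr_mem)
    moreover have "{\<omega> \<in> space (percolation_law 1). e \<in> opn \<omega>} \<in> events"
      by (rule sets_percolation_law) auto
    ultimately show ?thesis using prob_Collect_eq_1[of "\<lambda>\<omega>. e \<in> opn \<omega>"] by simp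
  qed
  then have "AE \<omega> in percolation_law 1. \<forall>e. e \<in> opn \<omega>" by (simp only: AE_all_countable simp_thms)
  then have "AE \<omega> in percolation_law 1. v = 1"
    using v[unfolded is_as_value_def]
  proof eventually_elim
    case (elim \<omega>)
    have hv: "has_value \<omega> (loc 0) v" using elim(2) loc_in_vertices by blast
    have opn: "e \<in> opn \<omega>" for e using elim(1) by blast
    have "1 \<le> total_cost \<omega> (loc 0) \<sigma> \<tau>" for \<sigma> \<tau>
    proof -
      let ?z = "pos (loc 0) \<sigma> \<tau>"
      have c: "cost \<omega> {?z m, ?z (Suc m)} = 1" for m
      proof -
        obtain u where u: "?z m = loc u" using pos_loc by blast
        show ?thesis
        proof (cases "\<sigma> (hist (loc 0) \<sigma> \<tau> m)")
          case Top
          then obtain b where "?z (Suc m) = loc (up b u)" using u by (auto simp: pos_Suc move_loc)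
          then have "{?z m, ?z (Suc m)} = bond_edge (u, b)" using u by (simp add: bond_edge_def)
          then show ?thesis by (simp only: cost_bond_edge opn) simp
        next
          case Bottom
          then obtain b where "?z (Suc m) = loc (dn b u)" using u by (auto simp: pos_Suc move_loc)
          then have "{?z m, ?z (Suc m)} = bond_edge (dn b u, b)" using u by (auto simp: bond_edge_def)
          then show ?thesis by (simp only: cost_bond_edge opn) simp
        qed
      qed
      have "limsup (\<lambda>n. ereal (1 / real n * (\<Sum>m<n. cost \<omega> {?z m, ?z (Suc m)}))) = 1"
      proof (rule lim_imp_Limsup)
        show "((\<lambda>n. ereal (1 / real n * (\<Sum>m<n. cost \<omega> {?z m, ?z (Suc m)}))) \<longlongrightarrow> 1) sequentially"
          by (rule tendsto_eventually)
            (auto simp: c one_ereal_def intro: eventually_mono[OF eventually_gt_at_top[of 0]])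
      qed simp
      then show ?thesis by (simp add: total_cost_pos)
    qed
    then have "1 \<le> (SUP \<tau>. INF \<sigma>. total_cost \<omega> (loc 0) \<sigma> \<tau>)"
      by (intro SUP_upper2[of undefined] INF_greatest) auto
    then have "1 \<le> v" using hv by (simp add: has_value_def one_ereal_def)
    then show ?case using has_value_le_1[OF hv] by simp
  qed
  then show ?thesis by simp
qed

theorem theorem5p1:
  fixes p p\<^sub>c v\<^sub>p :: real
  assumes "0 \<le> p" "p \<le> 1"
    and "is_critical_parameter p\<^sub>c"
    and "is_as_value p v\<^sub>p"
  shows "v\<^sub>p = 1 \<longleftrightarrow> p \<ge> p\<^sub>c"
proof
  assume "p \<ge> p\<^sub>c"
  then show "v\<^sub>p = 1" using assms value_eq_1[of p\<^sub>c p] value_1 by (cases "p = 1") auto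
next
  assume v: "v\<^sub>p = 1"
  show "p \<ge> p\<^sub>c"
  proof (rule ccontr)
    assume "\<not> p \<ge> p\<^sub>c"
    \<comment> \<open>Exponential decay at \<open>p\<close> is derived from the convergence of
      \<open>theta\<close> to 0 at a strictly larger parameter, which must still be below
      \<open>p\<^sub>c\<close>.\<close>
    define q where "q = (p + p\<^sub>c) / 2"
    have q: "p < q" "q < p\<^sub>c" "q < 1" "0 \<le> q"
      using \<open>\<not> p \<ge> p\<^sub>c\<close> assms by (auto simp: q_def is_critical_parameter_def)
    then have "AE \<omega> in percolation_law q. \<not> percolates \<omega>"
      using assms(3) by (auto simp: is_critical_parameter_def)
    then have "theta q \<longlonglongrightarrow> 0" using q by (intro theta_tendsto_0) auto
    then have "v\<^sub>p < 1" using value_lt_1[of p q v\<^sub>p] assms q by blast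
    then show False using v by simp
  qed
qed

end
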